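(* Let $(T,\mathfrak n)$ be a regular local ring with $\ell=\dim T\ge3$, $\mathfrak a\subsetneq T$ an ideal with $\mathfrak a\subseteq\mathfrak n^2$, and $n\ge2$ an integer. Suppose that $R=T/\mathfrak a$ is a Cohen-Macaulay local ring with $\dim R=1$ which is not Gorenstein, let $K$ be a fractional canonical ideal of $R$, and set $\mathfrak m=\mathfrak n/\mathfrak a$, $\mathfrak c=R:R[K]$, $r=\mathrm r(R)$. Suppose that $R$ is an $n$-Goto ring and $v(R/\mathfrak c)=1$. Let $x_1,\ldots,x_\ell$ be a minimal system of generators of $\mathfrak m$ with $\mathfrak c=(x_1^n,x_2,\ldots,x_\ell)$, and let $I_i=(x_1^i,x_2,\ldots,x_\ell)$ for $1\le i\le n$. Let $\ell_n>0$ and $\ell_i\ge0$ ($1\le i<n$) be the integers with $\sum_{i=1}^n\ell_i=r-1$ and $K/R\cong\bigoplus_{i=1}^n(R/I_i)^{\oplus\ell_i}$. Let $X_j\in\mathfrak n$ be a lift of $x_j$ for each $1\le j\le\ell$, and set $J_i=(X_1^i,X_2,\ldots,X_\ell)\subseteq T$ for $1\le i\le n$. Choose $f_{ij}\in K$ ($1\le i\le n$, $1\le j\le\ell_i$) such that $K=R+\sum_{i=1}^n\sum_{j=1}^{\ell_i}Rf_{ij}$ and $K/R=\bigoplus_{i=1}^n\bigoplus_{j=1}^{\ell_i}R\,\overline{f_{ij}}$ with $R\,\overline{f_{ij}}\cong R/I_i$, where $\overline{f_{ij}}$ is the image of $f_{ij}$ in $K/R$. Then the $T$-module $K$ has a minimal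 free presentation $F_1\overset{\mathbb M}{\longrightarrow}F_0\overset{\mathbb N}{\longrightarrow}K\to0$ in which $$\mathbb N=\big[-1\ \ f_{n1}\cdots f_{n\ell_n}\ \ f_{n-1,1}\cdots f_{n-1,\ell_{n-1}}\ \cdots\ f_{11}\cdots f_{1\ell_1}\big]$$ and $\mathbb M$ has the following form: its rows are indexed by a first row followed by rows $(k,i)$ with $1\le k\le n$, $1\le i\le\ell_k$ (ordered as the entries $f_{ki}$ in $\mathbb N$); its columns consist, for each $(k,i)$ in the same order, of a block of $\ell$ columns whose first-row entries are $a_{i1}^{(k)},a_{i2}^{(k)},\ldots,a_{i\ell}^{(k)}$, whose entries in row $(k,i)$ are $X_1^k,X_2,\ldots,X_\ell$, and whose other entries are $0$; followed by $q\ge0$ further columns whose first-row entries are $c_1,\ldots,c_q$ and whose other entries are $0$. Here $a_{ij}^{(n)}\in J_n$ ($1\le i\le\ell_n$, $1\le j\le\ell$), $a_{ij}^{(k)}\in J_n$ ($1\le k<n$, $1\le i\le\ell_k$, $2\le j\le\ell$), $a_{i1}^{(k)}\in\mathfrak n$ ($1\le k<n$, $1\le i\le\ell_k$), and $c_1,\ldots,c_q\in\mathfrak n$. Moreover, one has the equality $$\mathfrak a=\sum_{i=1}^n\sum_{j=1}^{\ell_i}\mathrm I_2\begin{pmatrix} a_{j1}^{(i)} & a_{j2}^{(i)} & \cdots & a_{j\ell}^{(i)} \\ X_1^i & X_2 & \cdots & X_\ell \end{pmatrix}+(c_1,c_2,\ldots,c_q).$$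
   Context: $\mathrm Q(R)$ is the total ring of fractions of $R$, $\overline R$ the integral closure of $R$ in $\mathrm Q(R)$, and $X:Y=\{z\in\mathrm Q(R)\mid zY\subseteq X\}$. A fractional canonical ideal of $R$ is an $R$-submodule $K$ of $\mathrm Q(R)$ with $R\subseteq K\subseteq\overline R$ and $K\cong\mathrm K_R$, the canonical module. $\mathrm r(R)$ is the Cohen-Macaulay type; $v(-)$ is the embedding dimension (minimal number of generators of the maximal ideal); $\mathrm I_2(-)$ is the ideal generated by the $2\times2$ minors. For $n\ge0$, $R$ is an $n$-Goto ring if $K^2=K^3$ and $\ell_R(K^2/K)=n$ (equivalently, some, or any, canonical ideal $I\cong\mathrm K_R$, $I\neq R$, having a parameter ideal $(a)$ as a reduction satisfies $I^3=aI^2$ and $\ell_R(I^2/aI)=n$). It is known that, when $R$ is $n$-Goto with $n\ge2$ and $v(R/\mathfrak c)=1$, there exist a minimal system of generators $x_1,\ldots,x_\ell$ of $\mathfrak m$ with $\mathfrak c=(x_1^n,x_2,\ldots,x_\ell)$ and, with $I_i=(x_1^i,x_2,\ldots,x_\ell)$ for $1\le i\le n$, a decomposition $K/R\cong\bigoplus_{i=1}^n(R/I_i)^{\oplus\ell_i}$ for some integers $\ell_n>0$ and $\ell_i\ge0$ ($1\le i<n$) with $\sum_{i=1}^n\ell_i=r-1$. $K$ is a $T$-module via $T\to R$. Since $\mathfrak a\subseteq\mathfrak n^2$, $\mu_R(\mathfrak m)=\ell$. *)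

theory Defs
  imports "HOL-Algebra.Module" "HOL-Algebra.Ideal_Product" "HOL-Algebra.Generated_Rings"
    "HOL-Algebra.Ring_Divisibility" "HOL-Library.Extended_Nat"
begin

section \<open>Local rings\<close>

definition local_ring :: "('a, 'r) ring_scheme \<Rightarrow> bool" where
  "local_ring R \<longleftrightarrow> cring R \<and> (\<exists>!M. maximalideal M R)"

definition max_ideal :: "('a, 'r) ring_scheme \<Rightarrow> 'a set" where
  "max_ideal R = (THE M. maximalideal M R)"

definition krull_dim :: "('a, 'r) ring_scheme \<Rightarrow> enat" where
  "krull_dim R = Sup {enat k | k P.
     (\<forall>i\<le>k. primeideal (P i) R) \<and> (\<forall>i<k. P i \<subset> P (Suc i))}"


section \<open>Modules\<close>

text \<open>Module records inherit the multiplicative fields of rings.  In the constructions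
  below these fields carry no meaning.\<close>

definition reg_module :: "('a, 'r) ring_scheme \<Rightarrow> ('a, 'a) module" where
  "reg_module R = \<lparr>carrier = carrier R, monoid.mult = monoid.mult R, one = one R,
     zero = zero R, add = add R, smult = monoid.mult R\<rparr>"

definition restrict_mod :: "('a, 'b) module \<Rightarrow> 'b set \<Rightarrow> ('a, 'b) module" where
  "restrict_mod M N = M\<lparr>carrier := N\<rparr>"

definition mod_quot :: "('a, 'b) module \<Rightarrow> 'b set \<Rightarrow> ('a, 'b set) module" where
  "mod_quot M N = \<lparr>carrier = a_rcosets\<^bsub>M\<^esub> N, monoid.mult = undefined, one = undefined,
     zero = N, add = set_add M,
     smult = (\<lambda>r C. \<Union>z\<in>C. N +>\<^bsub>M\<^esub> (r \<odot>\<^bsub>M\<^esub> z))\<rparr>"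

definition direct_sum :: "'i set \<Rightarrow> ('i \<Rightarrow> ('a, 'b) module) \<Rightarrow> ('a, 'i \<Rightarrow> 'b) module" where
  \<comment> \<open>only used for finite index sets\<close>
  "direct_sum S M = \<lparr>carrier = (\<Pi>\<^sub>E s\<in>S. carrier (M s)), monoid.mult = undefined, one = undefined,
     zero = (\<lambda>s\<in>S. \<zero>\<^bsub>M s\<^esub>), add = (\<lambda>u v. \<lambda>s\<in>S. u s \<oplus>\<^bsub>M s\<^esub> v s),
     smult = (\<lambda>r u. \<lambda>s\<in>S. r \<odot>\<^bsub>M s\<^esub> u s)\<rparr>"

definition mod_span :: "('a, 'r) ring_scheme \<Rightarrow> ('a, 'b) module \<Rightarrow> 'b set \<Rightarrow> 'b set" where
  "mod_span R M S = \<Inter>{N. submodule N R M \<and> S \<subseteq> N}"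

definition mod_hom ::
  "('a, 'r) ring_scheme \<Rightarrow> ('a, 'b) module \<Rightarrow> ('a, 'c) module \<Rightarrow> ('b \<Rightarrow> 'c) set" where
  "mod_hom R M N = {h \<in> carrier M \<rightarrow> carrier N.
     (\<forall>x\<in>carrier M. \<forall>y\<in>carrier M. h (x \<oplus>\<^bsub>M\<^esub> y) = h x \<oplus>\<^bsub>N\<^esub> h y) \<and>
     (\<forall>r\<in>carrier R. \<forall>x\<in>carrier M. h (r \<odot>\<^bsub>M\<^esub> x) = r \<odot>\<^bsub>N\<^esub> h x)}"

definition mod_iso :: "('a, 'r) ring_scheme \<Rightarrow> ('a, 'b) module \<Rightarrow> ('a, 'c) module \<Rightarrow> bool" where
  "mod_iso R M N \<longleftrightarrow> (\<exists>h\<in>mod_hom R M N. bij_betw h (carrier M) (carrier N))"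

definition internal_direct_sum ::
  "('a, 'r) ring_scheme \<Rightarrow> ('a, 'b) module \<Rightarrow> 'i set \<Rightarrow> ('i \<Rightarrow> 'b set) \<Rightarrow> bool" where
  "internal_direct_sum R M S N \<longleftrightarrow> finite S \<and> (\<forall>s\<in>S. submodule (N s) R M) \<and>
     bij_betw (\<lambda>u. \<Oplus>\<^bsub>M\<^esub> s\<in>S. u s) (\<Pi>\<^sub>E s\<in>S. N s) (carrier M)"

definition fin_gen :: "('a, 'r) ring_scheme \<Rightarrow> ('a, 'b) module \<Rightarrow> bool" where
  "fin_gen R M \<longleftrightarrow> (\<exists>S. finite S \<and> S \<subseteq> carrier M \<and> mod_span R M S = carrier M)"

definition min_num_gens :: "('a, 'r) ring_scheme \<Rightarrow> ('a, 'b) module \<Rightarrow> enat" where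
  "min_num_gens R M = Inf {enat (card S) | S.
     finite S \<and> S \<subseteq> carrier M \<and> mod_span R M S = carrier M}"

definition mod_length :: "('a, 'r) ring_scheme \<Rightarrow> ('a, 'b) module \<Rightarrow> enat" where
  "mod_length R M = Sup {enat k | k N.
     (\<forall>i\<le>k. submodule (N i) R M) \<and> (\<forall>i<k. N i \<subset> N (Suc i))}"

definition minimal_generators ::
  "('a, 'r) ring_scheme \<Rightarrow> 'a set \<Rightarrow> nat \<Rightarrow> (nat \<Rightarrow> 'a) \<Rightarrow> bool" where
  "minimal_generators R I l x \<longleftrightarrow> x ` {1..l} \<subseteq> carrier R \<and> genideal R (x ` {1..l}) = I \<and>
     (\<forall>S. S \<subset> {1..l} \<longrightarrow> genideal R (x ` S) \<noteq> I)"

definition emb_dim :: "('a, 'r) ring_scheme \<Rightarrow> enat" where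
  "emb_dim R = min_num_gens R (restrict_mod (reg_module R) (max_ideal R))"

definition regular_local_ring :: "('a, 'r) ring_scheme \<Rightarrow> bool" where
  "regular_local_ring R \<longleftrightarrow> local_ring R \<and> noetherian_ring R \<and> krull_dim R = emb_dim R"


section \<open>Free modules, matrices and presentations\<close>

definition free_mod :: "('a, 'r) ring_scheme \<Rightarrow> 'i set \<Rightarrow> ('a, 'i \<Rightarrow> 'a) module" where
  "free_mod R S = direct_sum S (\<lambda>_. reg_module R)"

definition row_map ::
  "('a, 'b) module \<Rightarrow> 'i set \<Rightarrow> ('i \<Rightarrow> 'b) \<Rightarrow> ('i \<Rightarrow> 'a) \<Rightarrow> 'b" where
  "row_map M S g v = (\<Oplus>\<^bsub>M\<^esub> s\<in>S. v s \<odot>\<^bsub>M\<^esub> g s)"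

definition mat_map ::
  "('a, 'r) ring_scheme \<Rightarrow> 'i set \<Rightarrow> 'j set \<Rightarrow> ('i \<Rightarrow> 'j \<Rightarrow> 'a) \<Rightarrow> ('j \<Rightarrow> 'a) \<Rightarrow> 'i \<Rightarrow> 'a" where
  "mat_map R S0 S1 A v = (\<lambda>i\<in>S0. \<Oplus>\<^bsub>R\<^esub> j\<in>S1. A i j \<otimes>\<^bsub>R\<^esub> v j)"

definition free_presentation ::
  "('a, 'r) ring_scheme \<Rightarrow> ('a, 'b) module \<Rightarrow> 'i set \<Rightarrow> 'j set \<Rightarrow>
   ('i \<Rightarrow> 'j \<Rightarrow> 'a) \<Rightarrow> ('i \<Rightarrow> 'b) \<Rightarrow> bool" where
  "free_presentation R M S0 S1 A g \<longleftrightarrow> finite S0 \<and> finite S1 \<and>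
     (\<forall>i\<in>S0. \<forall>j\<in>S1. A i j \<in> carrier R) \<and> (\<forall>i\<in>S0. g i \<in> carrier M) \<and>
     row_map M S0 g ` carrier (free_mod R S0) = carrier M \<and>
     mat_map R S0 S1 A ` carrier (free_mod R S1) =
       {v \<in> carrier (free_mod R S0). row_map M S0 g v = \<zero>\<^bsub>M\<^esub>}"

text \<open>A presentation over a local ring is minimal if both \<open>F\<^sub>0 \<rightarrow> M\<close> and
  \<open>F\<^sub>1 \<rightarrow> ker (F\<^sub>0 \<rightarrow> M)\<close> are minimal free covers, i.e. their kernels have entries
  in the maximal ideal.\<close>

definition minimal_free_presentation ::
  "('a, 'r) ring_scheme \<Rightarrow> ('a, 'b) module \<Rightarrow> 'i set \<Rightarrow> 'j set \<Rightarrow>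
   ('i \<Rightarrow> 'j \<Rightarrow> 'a) \<Rightarrow> ('i \<Rightarrow> 'b) \<Rightarrow> bool" where
  "minimal_free_presentation R M S0 S1 A g \<longleftrightarrow> free_presentation R M S0 S1 A g \<and>
     (\<forall>v\<in>carrier (free_mod R S0). row_map M S0 g v = \<zero>\<^bsub>M\<^esub> \<longrightarrow>
        (\<forall>i\<in>S0. v i \<in> max_ideal R)) \<and>
     (\<forall>w\<in>carrier (free_mod R S1). mat_map R S0 S1 A w = \<zero>\<^bsub>free_mod R S0\<^esub> \<longrightarrow>
        (\<forall>j\<in>S1. w j \<in> max_ideal R))"


section \<open>Ext, depth, type and canonical modules\<close>

text \<open>A resolution of \<open>N\<close> by free modules \<open>F\<^sub>i\<close> of rank \<open>b i\<close>: the matrix \<open>D i\<close> gives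
  \<open>F\<^sub>i\<^sub>+\<^sub>1 \<rightarrow> F\<^sub>i\<close>, and \<open>g\<close> lists the images of the basis of \<open>F\<^sub>0\<close> in \<open>N\<close>.\<close>

fun free_resolution ::
  "('a, 'r) ring_scheme \<Rightarrow> ('a, 'b) module \<Rightarrow>
   (nat \<Rightarrow> nat) \<times> (nat \<Rightarrow> nat \<Rightarrow> nat \<Rightarrow> 'a) \<times> (nat \<Rightarrow> 'b) \<Rightarrow> bool" where
  "free_resolution R N (b, D, g) \<longleftrightarrow>
     free_presentation R N {..<b 0} {..<b 1} (D 0) g \<and>
     (\<forall>i. (\<forall>s<b i. \<forall>t<b (Suc i). D i s t \<in> carrier R) \<and>
       mat_map R {..<b (Suc i)} {..<b (Suc (Suc i))} (D (Suc i)) `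
           carrier (free_mod R {..<b (Suc (Suc i))}) =
         {v \<in> carrier (free_mod R {..<b (Suc i)}).
            mat_map R {..<b i} {..<b (Suc i)} (D i) v = \<zero>\<^bsub>free_mod R {..<b i}\<^esub>})"

text \<open>Cohomology of \<open>Hom(F, M)\<close>, with \<open>Hom(R\<^sup>b, M)\<close> identified with \<open>M\<^sup>b\<close>.\<close>

definition Ext_of_res ::
  "('a, 'r) ring_scheme \<Rightarrow> nat \<Rightarrow>
   (nat \<Rightarrow> nat) \<times> (nat \<Rightarrow> nat \<Rightarrow> nat \<Rightarrow> 'a) \<times> (nat \<Rightarrow> 'b) \<Rightarrow>
   ('a, 'c) module \<Rightarrow> ('a, (nat \<Rightarrow> 'c) set) module" where
  "Ext_of_res R i F M = (case F of (b, D, g) \<Rightarrow>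
     let C = (\<lambda>k. direct_sum {..<b k} (\<lambda>_. M));
         d = (\<lambda>k u. \<lambda>t\<in>{..<b (Suc k)}. \<Oplus>\<^bsub>M\<^esub> s\<in>{..<b k}. D k s t \<odot>\<^bsub>M\<^esub> u s);
         Z = {u \<in> carrier (C i). d i u = \<zero>\<^bsub>C (Suc i)\<^esub>};
         B = (case i of 0 \<Rightarrow> {\<zero>\<^bsub>C 0\<^esub>} | Suc k \<Rightarrow> d k ` carrier (C k))
     in mod_quot (restrict_mod (C i) Z) B)"

text \<open>Up to isomorphism the result does not depend on the resolution.  It is meaningful
  for finitely generated \<open>N\<close> over a Noetherian ring.\<close>

definition Ext ::
  "('a, 'r) ring_scheme \<Rightarrow> nat \<Rightarrow> ('a, 'b) module \<Rightarrow> ('a, 'c) module \<Rightarrow>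
   ('a, (nat \<Rightarrow> 'c) set) module" where
  "Ext R i N M = Ext_of_res R i (SOME F. free_resolution R N F) M"

definition smult_span ::
  "('a, 'r) ring_scheme \<Rightarrow> ('a, 'b) module \<Rightarrow> 'a set \<Rightarrow> 'b set" where
  "smult_span R M S = mod_span R M {s \<odot>\<^bsub>M\<^esub> z | s z. s \<in> S \<and> z \<in> carrier M}"

definition regular_sequence ::
  "('a, 'r) ring_scheme \<Rightarrow> ('a, 'b) module \<Rightarrow> 'a list \<Rightarrow> bool" where
  "regular_sequence R M xs \<longleftrightarrow> set xs \<subseteq> carrier R \<and>
     smult_span R M (set xs) \<noteq> carrier M \<and>
     (\<forall>i<length xs. \<forall>z\<in>carrier M.
        (xs ! i) \<odot>\<^bsub>M\<^esub> z \<in> smult_span R M (set (take i xs)) \<longrightarrow>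
        z \<in> smult_span R M (set (take i xs)))"

definition depth :: "('a, 'r) ring_scheme \<Rightarrow> ('a, 'b) module \<Rightarrow> enat" where
  "depth R M = Sup {enat (length xs) | xs.
     set xs \<subseteq> max_ideal R \<and> regular_sequence R M xs}"

definition CM_local_ring :: "('a, 'r) ring_scheme \<Rightarrow> bool" where
  "CM_local_ring R \<longleftrightarrow>
     local_ring R \<and> noetherian_ring R \<and> depth R (reg_module R) = krull_dim R"

text \<open>The type \<open>dim\<^sub>k Ext\<^sup>t(k, M)\<close>, where \<open>t\<close> is the depth of \<open>M\<close> and \<open>k\<close> the residue
  field.\<close>

definition mod_type :: "('a, 'r) ring_scheme \<Rightarrow> ('a, 'b) module \<Rightarrow> enat" where
  "mod_type R M = mod_length R
     (Ext R (the_enat (depth R M)) (mod_quot (reg_module R) (max_ideal R)) M)"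

definition CM_type :: "('a, 'r) ring_scheme \<Rightarrow> enat" where
  "CM_type R = mod_type R (reg_module R)"

text \<open>The test modules \<open>B\<close> have their elements in the element type of the ring.  By Baer's
  criterion this is no restriction, as every ideal occurs as a submodule of such a \<open>B\<close>.\<close>

definition injective_module :: "('a, 'r) ring_scheme \<Rightarrow> ('a, 'b) module \<Rightarrow> bool" where
  "injective_module R E \<longleftrightarrow> module R E \<and>
     (\<forall>(B :: ('a, 'a) module) A. module R B \<and> submodule A R B \<longrightarrow>
        (\<forall>g\<in>mod_hom R (restrict_mod B A) E. \<exists>h\<in>mod_hom R B E. \<forall>x\<in>A. h x = g x))"

text \<open>Existence of a finite injective resolution \<open>0 \<rightarrow> M \<rightarrow> E\<^sub>0 \<rightarrow> E\<^sub>1 \<rightarrow> \<dots> \<rightarrow> E\<^sub>s \<rightarrow> 0\<close>.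
  The element type \<open>nat \<Rightarrow> 'a\<close> of the \<open>E\<^sub>i\<close> is large enough: for a finitely generated
  module over a nonzero Noetherian ring, the terms of the minimal injective resolution have
  at most \<open>max(|R|, \<aleph>\<^sub>0)\<close> elements.\<close>

definition finite_inj_dim :: "('a, 'r) ring_scheme \<Rightarrow> ('a, 'b) module \<Rightarrow> bool" where
  "finite_inj_dim R M \<longleftrightarrow>
     (\<exists>(s :: nat) (E :: nat \<Rightarrow> ('a, nat \<Rightarrow> 'a) module) e d.
        (\<forall>i. injective_module R (E i)) \<and> (\<forall>i>s. carrier (E i) = {\<zero>\<^bsub>E i\<^esub>}) \<and>
        e \<in> mod_hom R M (E 0) \<and> inj_on e (carrier M) \<and>
        (\<forall>i. d i \<in> mod_hom R (E i) (E (Suc i))) \<and>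
        e ` carrier M = {z \<in> carrier (E 0). d 0 z = \<zero>\<^bsub>E 1\<^esub>} \<and>
        (\<forall>i. d i ` carrier (E i) =
           {z \<in> carrier (E (Suc i)). d (Suc i) z = \<zero>\<^bsub>E (Suc (Suc i))\<^esub>}))"

definition gorenstein_local_ring :: "('a, 'r) ring_scheme \<Rightarrow> bool" where
  "gorenstein_local_ring R \<longleftrightarrow>
     local_ring R \<and> noetherian_ring R \<and> finite_inj_dim R (reg_module R)"

text \<open>A canonical module of a Cohen-Macaulay local ring (unique up to isomorphism): a maximal
  Cohen-Macaulay module of type 1 and of finite injective dimension.\<close>

definition canonical_module :: "('a, 'r) ring_scheme \<Rightarrow> ('a, 'b) module \<Rightarrow> bool" where
  "canonical_module R C \<longleftrightarrow> module R C \<and> fin_gen R C \<and> depth R C = krull_dim R \<and>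
     mod_type R C = 1 \<and> finite_inj_dim R C"


section \<open>Fractional ideals in the total ring of fractions\<close>

definition nonzerodivisors :: "('a, 'r) ring_scheme \<Rightarrow> 'a set" where
  "nonzerodivisors R = {s \<in> carrier R. \<forall>r\<in>carrier R. s \<otimes>\<^bsub>R\<^esub> r = \<zero>\<^bsub>R\<^esub> \<longrightarrow> r = \<zero>\<^bsub>R\<^esub>}"

text \<open>\<open>\<phi>: R \<rightarrow> Q\<close> exhibits \<open>Q\<close> as the total ring of fractions of \<open>R\<close>.  Below, \<open>R\<close> is
  identified with its image \<open>\<phi> ` carrier R\<close>.\<close>

definition total_fraction_ring ::
  "('a, 'r) ring_scheme \<Rightarrow> ('q, 's) ring_scheme \<Rightarrow> ('a \<Rightarrow> 'q) \<Rightarrow> bool" where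
  "total_fraction_ring R Q \<phi> \<longleftrightarrow> cring R \<and> cring Q \<and>
     \<phi> \<in> ring_hom R Q \<and> inj_on \<phi> (carrier R) \<and> \<phi> ` nonzerodivisors R \<subseteq> Units Q \<and>
     (\<forall>z\<in>carrier Q. \<exists>r\<in>carrier R. \<exists>s\<in>nonzerodivisors R. z \<otimes>\<^bsub>Q\<^esub> \<phi> s = \<phi> r)"

definition integral_closure ::
  "('a, 'r) ring_scheme \<Rightarrow> ('q, 's) ring_scheme \<Rightarrow> ('a \<Rightarrow> 'q) \<Rightarrow> 'q set" where
  "integral_closure R Q \<phi> = {z \<in> carrier Q. \<exists>(d :: nat) c. (\<forall>i<d. c i \<in> carrier R) \<and>
     z [^]\<^bsub>Q\<^esub> d \<oplus>\<^bsub>Q\<^esub> (\<Oplus>\<^bsub>Q\<^esub> i\<in>{..<d}. \<phi> (c i) \<otimes>\<^bsub>Q\<^esub> z [^]\<^bsub>Q\<^esub> i) = \<zero>\<^bsub>Q\<^esub>}"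

text \<open>The subset \<open>K\<close> of \<open>Q\<close> as a module, with scalars acting through \<open>\<psi>\<close>.\<close>

definition frac_module ::
  "('q, 's) ring_scheme \<Rightarrow> ('a \<Rightarrow> 'q) \<Rightarrow> 'q set \<Rightarrow> ('a, 'q) module" where
  "frac_module Q \<psi> K = \<lparr>carrier = K, monoid.mult = monoid.mult Q, one = one Q,
     zero = zero Q, add = add Q, smult = (\<lambda>r z. \<psi> r \<otimes>\<^bsub>Q\<^esub> z)\<rparr>"

definition frac_span ::
  "('a, 'r) ring_scheme \<Rightarrow> ('q, 's) ring_scheme \<Rightarrow> ('a \<Rightarrow> 'q) \<Rightarrow> 'q set \<Rightarrow> 'q set" where
  "frac_span R Q \<phi> S = mod_span R (frac_module Q \<phi> (carrier Q)) S"

definition frac_prod ::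
  "('a, 'r) ring_scheme \<Rightarrow> ('q, 's) ring_scheme \<Rightarrow> ('a \<Rightarrow> 'q) \<Rightarrow> 'q set \<Rightarrow> 'q set \<Rightarrow> 'q set" where
  "frac_prod R Q \<phi> Y Z = frac_span R Q \<phi> {y \<otimes>\<^bsub>Q\<^esub> z | y z. y \<in> Y \<and> z \<in> Z}"

definition colon :: "('q, 's) ring_scheme \<Rightarrow> 'q set \<Rightarrow> 'q set \<Rightarrow> 'q set" where
  "colon Q Y Z = {q \<in> carrier Q. \<forall>z\<in>Z. q \<otimes>\<^bsub>Q\<^esub> z \<in> Y}"

definition fractional_canonical_ideal ::
  "('a, 'r) ring_scheme \<Rightarrow> ('q, 's) ring_scheme \<Rightarrow> ('a \<Rightarrow> 'q) \<Rightarrow> 'q set \<Rightarrow> bool" where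
  "fractional_canonical_ideal R Q \<phi> K \<longleftrightarrow>
     submodule K R (frac_module Q \<phi> (carrier Q)) \<and>
     \<phi> ` carrier R \<subseteq> K \<and> K \<subseteq> integral_closure R Q \<phi> \<and>
     canonical_module R (frac_module Q \<phi> K)"

text \<open>The \<open>n\<close>-Goto property of \<open>R\<close>, read off a fractional canonical ideal \<open>K\<close>.  It does
  not depend on the choice of \<open>K\<close>.\<close>

definition n_Goto ::
  "('a, 'r) ring_scheme \<Rightarrow> ('q, 's) ring_scheme \<Rightarrow> ('a \<Rightarrow> 'q) \<Rightarrow> 'q set \<Rightarrow> nat \<Rightarrow> bool" where
  "n_Goto R Q \<phi> K n \<longleftrightarrow>
     (let K2 = frac_prod R Q \<phi> K K
      in K2 = frac_prod R Q \<phi> K2 K \<and>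
         mod_length R (mod_quot (frac_module Q \<phi> K2) K) = enat n)"

text \<open>The ideal \<open>R : R[K]\<close>, pulled back along \<open>\<phi>\<close> to an ideal of \<open>R\<close>.\<close>

definition goto_conductor ::
  "('a, 'r) ring_scheme \<Rightarrow> ('q, 's) ring_scheme \<Rightarrow> ('a \<Rightarrow> 'q) \<Rightarrow> 'q set \<Rightarrow> 'a set" where
  "goto_conductor R Q \<phi> K = {r \<in> carrier R.
     \<phi> r \<in> colon Q (\<phi> ` carrier R) (generate_ring Q (\<phi> ` carrier R \<union> K))}"


section \<open>The presentation matrices\<close>

text \<open>The sequence \<open>x\<^sub>1\<^sup>k, x\<^sub>2, x\<^sub>3, \<dots>\<close>.\<close>

definition first_pow :: "('a, 'r) ring_scheme \<Rightarrow> (nat \<Rightarrow> 'a) \<Rightarrow> nat \<Rightarrow> nat \<Rightarrow> 'a" where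
  "first_pow R x k j = (if j = 1 then x 1 [^]\<^bsub>R\<^esub> k else x j)"

definition first_pow_ideal :: "('a, 'r) ring_scheme \<Rightarrow> nat \<Rightarrow> (nat \<Rightarrow> 'a) \<Rightarrow> nat \<Rightarrow> 'a set" where
  "first_pow_ideal R l x k = genideal R (first_pow R x k ` {1..l})"

definition blocks :: "nat \<Rightarrow> (nat \<Rightarrow> nat) \<Rightarrow> (nat \<times> nat) set" where
  "blocks n L = {(k, i). 1 \<le> k \<and> k \<le> n \<and> 1 \<le> i \<and> i \<le> L k}"

text \<open>Rows are \<open>None\<close> (the first row) and \<open>Some (k, i)\<close>.  Columns are \<open>Inl ((k, i), j)\<close> (the
  \<open>j\<close>-th column of the block \<open>(k, i)\<close>) and \<open>Inr s\<close> (the \<open>s\<close>-th further column).\<close>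

definition pres_rows :: "nat \<Rightarrow> (nat \<Rightarrow> nat) \<Rightarrow> (nat \<times> nat) option set" where
  "pres_rows n L = insert None (Some ` blocks n L)"

definition pres_cols ::
  "nat \<Rightarrow> (nat \<Rightarrow> nat) \<Rightarrow> nat \<Rightarrow> nat \<Rightarrow> ((nat \<times> nat) \<times> nat + nat) set" where
  "pres_cols n L l q = Inl ` (blocks n L \<times> {1..l}) \<union> Inr ` {1..q}"

fun pres_N :: "('q, 's) ring_scheme \<Rightarrow> (nat \<Rightarrow> nat \<Rightarrow> 'q) \<Rightarrow> (nat \<times> nat) option \<Rightarrow> 'q" where
  "pres_N Q f None = \<ominus>\<^bsub>Q\<^esub> \<one>\<^bsub>Q\<^esub>"
| "pres_N Q f (Some (k, i)) = f k i"

text \<open>\<open>A k i j\<close> stands for the entry \<open>a\<^sub>i\<^sub>j\<close> with upper index \<open>(k)\<close>.\<close>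

fun pres_M ::
  "('a, 'r) ring_scheme \<Rightarrow> (nat \<Rightarrow> 'a) \<Rightarrow> (nat \<Rightarrow> nat \<Rightarrow> nat \<Rightarrow> 'a) \<Rightarrow> (nat \<Rightarrow> 'a) \<Rightarrow>
   (nat \<times> nat) option \<Rightarrow> (nat \<times> nat) \<times> nat + nat \<Rightarrow> 'a" where
  "pres_M T X A c None (Inl ((k, i), j)) = A k i j"
| "pres_M T X A c (Some p) (Inl ((k, i), j)) =
     (if p = (k, i) then first_pow T X k j else \<zero>\<^bsub>T\<^esub>)"
| "pres_M T X A c None (Inr s) = c s"
| "pres_M T X A c (Some p) (Inr s) = \<zero>\<^bsub>T\<^esub>"

text \<open>The ideal of \<open>2 \<times> 2\<close> minors of the \<open>2 \<times> l\<close> matrix with rows \<open>u\<close> and \<open>v\<close>.\<close>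

definition I2 :: "('a, 'r) ring_scheme \<Rightarrow> nat \<Rightarrow> (nat \<Rightarrow> 'a) \<Rightarrow> (nat \<Rightarrow> 'a) \<Rightarrow> 'a set" where
  "I2 T l u v = genideal T {u p \<otimes>\<^bsub>T\<^esub> v q \<ominus>\<^bsub>T\<^esub> u q \<otimes>\<^bsub>T\<^esub> v p | p q. 1 \<le> p \<and> p < q \<and> q \<le> l}"

definition ideal_sum :: "('a, 'r) ring_scheme \<Rightarrow> 'i set \<Rightarrow> ('i \<Rightarrow> 'a set) \<Rightarrow> 'a set" where
  "ideal_sum T S I = genideal T (\<Union>s\<in>S. I s)"

end

theory Submission
  imports Defs
begin

text \<open>
  Write \<open>\<nn> = (X\<^sub>1, \<dots>, X\<^sub>l)\<close>; as \<open>T\<close> is regular, the sequence \<open>X\<^sub>1\<^sup>k, X\<^sub>2, \<dots>, X\<^sub>l\<close> is regular, so its syzygies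
  are the Koszul relations.  The socle of \<open>K\<^sup>2 / K\<close> has length at most one, because \<open>(K : \<mm>) / K\<close>
  embeds into \<open>Ext\<^sup>1(R / \<mm>, K)\<close>.  Since \<open>\<cc> K\<^sup>2 \<subseteq> R\<close>, only \<open>x\<^sub>1\<close> acts nontrivially on \<open>K\<^sup>2 / K\<close>, so this module
  is uniserial; having length \<open>n\<close>, it is not annihilated by \<open>x\<^sub>1\<^sup>n\<^sup>-\<^sup>1\<close>.  Hence \<open>x\<^sub>1\<^sup>n\<^sup>-\<^sup>1 \<notin> \<cc>\<close>, which forces \<open>\<aa> \<subseteq> J\<^sub>n\<close>.
  A relation \<open>t\<^sub>0 = \<Sum> t\<^sub>k\<^sub>i f\<^sub>k\<^sub>i\<close> therefore has \<open>t\<^sub>k\<^sub>i \<in> J\<^sub>k\<close>, and multiples of the relations expressing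
  \<open>X\<^sub>1\<^sup>k f\<^sub>k\<^sub>i, X\<^sub>2 f\<^sub>k\<^sub>i, \<dots> \<in> R\<close> reduce it to one with all \<open>t\<^sub>k\<^sub>i = 0\<close> and \<open>t\<^sub>0 \<in> \<aa>\<close>.  The Koszul relations
  yield the minors among those, and the \<open>c\<^sub>s\<close> are chosen as a minimal set of generators of \<open>\<aa>\<close> over the minors.
  The entries lie in \<open>J\<^sub>n\<close> because \<open>\<cc> K \<subseteq> \<cc>\<close>, and in \<open>\<nn>\<close> because \<open>K\<close> is integral over \<open>R\<close>.
\<close>

section \<open>Ideals saturated at a prime\<close>

text \<open>Regularity of \<open>T\<close> is used as the coincidence of the Krull dimension with
  the number \<open>l\<close> of generators of \<nn>, whereas the Koszul argument needs each
  \<open>X\<^sub>j\<close> to be a nonzerodivisor modulo the later ones. The bridge is a form of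
  Krull's principal ideal theorem that moves an element into the lower part of a chain of primes and
  keeps the ends and the length: a chain of length \<open>l\<close> that ends in \<nn> can be
  adapted to the parameters, and then its members are the ideals generated by the last few of them,
  which are therefore prime. \<open>Ext\<close> is computed on a resolution about which nothing is
  known, not even that it starts in rank one. The class of a socle element is therefore written
  down, and shown to be nonzero, for free modules of arbitrary rank. The inclusion \<aa> \<subseteq>
  \<open>J\<^sub>n\<close> is the hinge because the annihilators of the generators of
  \<open>K / R\<close> are known only over \<open>R\<close>. Seen from \<open>T\<close> they are
  \<open>J\<^sub>k + \<aa>\<close>, and only when \<aa> is absorbed do they become the ideals
  generated by the entries \<open>X\<^sub>1\<^sup>k, X\<^sub>2, ...\<close> of a block, so that
  multiples of columns can clear a relation below the first row.\<close>

context ring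
begin

lemma ideal_rules:
  assumes "ideal J R"
  shows "J \<subseteq> carrier R" "\<zero> \<in> J"
    and "\<And>a. a \<in> J \<Longrightarrow> a \<in> carrier R"
    and "\<And>a b. a \<in> J \<Longrightarrow> b \<in> J \<Longrightarrow> a \<oplus> b \<in> J"
    and "\<And>a. a \<in> J \<Longrightarrow> \<ominus> a \<in> J"
    and "\<And>a b. a \<in> J \<Longrightarrow> b \<in> J \<Longrightarrow> a \<ominus> b \<in> J"
    and "\<And>a r. a \<in> J \<Longrightarrow> r \<in> carrier R \<Longrightarrow> r \<otimes> a \<in> J"
    and "\<And>a r. a \<in> J \<Longrightarrow> r \<in> carrier R \<Longrightarrow> a \<otimes> r \<in> J"
proof -
  interpret ideal J R by fact
  show "J \<subseteq> carrier R" "\<zero> \<in> J"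
    and "\<And>a. a \<in> J \<Longrightarrow> a \<in> carrier R"
    and "\<And>a b. a \<in> J \<Longrightarrow> b \<in> J \<Longrightarrow> a \<oplus> b \<in> J"
    and "\<And>a. a \<in> J \<Longrightarrow> \<ominus> a \<in> J"
    and "\<And>a b. a \<in> J \<Longrightarrow> b \<in> J \<Longrightarrow> a \<ominus> b \<in> J"
    and "\<And>a r. a \<in> J \<Longrightarrow> r \<in> carrier R \<Longrightarrow> r \<otimes> a \<in> J"
    and "\<And>a r. a \<in> J \<Longrightarrow> r \<in> carrier R \<Longrightarrow> a \<otimes> r \<in> J"
    using a_subset by (auto simp: I_l_closed I_r_closed minus_eq)
qed

lemma ideal_add_cancel:
  assumes "ideal J R" "a \<in> J" "b \<in> carrier R" "a \<oplus> b \<in> J"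
  shows "b \<in> J"
proof -
  have "b = (a \<oplus> b) \<ominus> a"
    using assms(3) ideal_rules(3)[OF assms(1,2)] by algebra
  then show ?thesis using ideal_rules(6)[OF assms(1) assms(4,2)] by simp
qed

end

context cring
begin

lemma idealI':
  assumes "J \<subseteq> carrier R" "\<zero> \<in> J" "\<And>a b. a \<in> J \<Longrightarrow> b \<in> J \<Longrightarrow> a \<oplus> b \<in> J"
    and "\<And>a r. a \<in> J \<Longrightarrow> r \<in> carrier R \<Longrightarrow> r \<otimes> a \<in> J"
  shows "ideal J R"
proof (rule idealI)
  show "ring R" by (rule ring_axioms)
  show "subgroup J (add_monoid R)"
  proof (rule add.subgroupI)
    fix a assume "a \<in> J"
    then have "\<ominus> a = (\<ominus> \<one>) \<otimes> a" "a \<in> carrier R" using assms(1) by (auto simp: l_minus)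
    then show "\<ominus> a \<in> J" using assms(4)[OF \<open>a \<in> J\<close>, of "\<ominus> \<one>"] by simp
  qed (use assms in auto)
  show "x \<otimes> a \<in> J" "a \<otimes> x \<in> J" if "a \<in> J" "x \<in> carrier R" for a x
    using assms(1) assms(4)[OF that] that by (auto simp: m_comm subset_iff)
qed

lemma mem_add_cgenideal:
  "a \<in> J <+>\<^bsub>R\<^esub> PIdl z \<longleftrightarrow> (\<exists>j\<in>J. \<exists>r\<in>carrier R. a = j \<oplus> r \<otimes> z)"
  by (auto simp: set_add_def' cgenideal_def)

lemma add_cgenideal_mono: "J \<subseteq> J' \<Longrightarrow> J <+>\<^bsub>R\<^esub> PIdl z \<subseteq> J' <+>\<^bsub>R\<^esub> PIdl z"
  by (auto simp: set_add_def')

lemma add_cgenideal: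
  assumes "ideal J R" "z \<in> carrier R"
  shows "ideal (J <+>\<^bsub>R\<^esub> PIdl z) R" "J \<subseteq> J <+>\<^bsub>R\<^esub> PIdl z" "z \<in> J <+>\<^bsub>R\<^esub> PIdl z"
proof -
  note J = ideal_rules[OF assms(1)]
  show "ideal (J <+>\<^bsub>R\<^esub> PIdl z) R"
    using add_ideals[OF assms(1) cgenideal_ideal[OF assms(2)]] .
  show "J \<subseteq> J <+>\<^bsub>R\<^esub> PIdl z"
  proof
    fix j assume "j \<in> J"
    then show "j \<in> J <+>\<^bsub>R\<^esub> PIdl z" using assms(2) J unfolding mem_add_cgenideal
      by (intro bexI[of _ j] bexI[of _ \<zero>]) auto
  qed
  show "z \<in> J <+>\<^bsub>R\<^esub> PIdl z" using assms(2) J unfolding mem_add_cgenideal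
    by (intro bexI[of _ \<zero>] bexI[of _ \<one>]) auto
qed

text \<open>The contraction of the localisation of \<open>J\<close> at \<open>P\<close>: localisations are avoided by working
  with these ideals of the ring itself.\<close>

definition loc_contr :: "'a set \<Rightarrow> 'a set \<Rightarrow> 'a set" where
  "loc_contr P J = {a \<in> carrier R. \<exists>s\<in>carrier R - P. s \<otimes> a \<in> J}"

text \<open>For a prime \<open>P\<close> these ideals correspond, with their inclusions, to the
  ideals of the localisation at \<open>P\<close>. Chain conditions and Nakayama's lemma for the
  localisation can thus be stated in the ring itself.\<close>

definition sat_ideal :: "'a set \<Rightarrow> 'a set \<Rightarrow> bool" where
  "sat_ideal P J \<longleftrightarrow> ideal J R \<and> (\<forall>s\<in>carrier R - P. \<forall>a\<in>carrier R. s \<otimes> a \<in> J \<longrightarrow> a \<in> J)"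

lemma loc_contrI: "a \<in> carrier R \<Longrightarrow> s \<in> carrier R - P \<Longrightarrow> s \<otimes> a \<in> J \<Longrightarrow> a \<in> loc_contr P J"
  by (auto simp: loc_contr_def)

lemma loc_contr_mono: "J \<subseteq> J' \<Longrightarrow> loc_contr P J \<subseteq> loc_contr P J'"
  by (auto simp: loc_contr_def)

lemma prime_compl_mult:
  assumes "primeideal P R" "s \<in> carrier R - P" "t \<in> carrier R - P"
  shows "s \<otimes> t \<in> carrier R - P"
  using assms primeideal.I_prime[OF assms(1), of s t] by auto

lemma prime_compl_one: "primeideal P R \<Longrightarrow> \<one> \<in> carrier R - P"
  using ideal.one_imp_carrier[of P R] primeideal.axioms(1) primeideal.I_notcarr by blast

lemma loc_contr:
  assumes P: "primeideal P R" and J: "ideal J R"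
  shows "sat_ideal P (loc_contr P J)" "J \<subseteq> loc_contr P J"
proof -
  note J = ideal_rules[OF J]
  show sub: "J \<subseteq> loc_contr P J"
    using prime_compl_one[OF P] J by (force simp: loc_contr_def)
  have "ideal (loc_contr P J) R"
  proof (rule idealI')
    show "loc_contr P J \<subseteq> carrier R" by (auto simp: loc_contr_def)
    show "\<zero> \<in> loc_contr P J" using sub J by auto
  next
    fix a b assume "a \<in> loc_contr P J" "b \<in> loc_contr P J"
    then obtain s t where st: "a \<in> carrier R" "b \<in> carrier R" "s \<in> carrier R - P" "t \<in> carrier R - P"
      "s \<otimes> a \<in> J" "t \<otimes> b \<in> J" by (auto simp: loc_contr_def)
    have "(s \<otimes> t) \<otimes> (a \<oplus> b) = t \<otimes> (s \<otimes> a) \<oplus> s \<otimes> (t \<otimes> b)"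
      using st by (auto simp: r_distr m_ac)
    also have "\<dots> \<in> J" using st J by auto
    finally show "a \<oplus> b \<in> loc_contr P J"
      using st by (intro loc_contrI[OF _ prime_compl_mult[OF P st(3,4)]]) auto
  next
    fix a r assume "a \<in> loc_contr P J" and r: "r \<in> carrier R"
    then obtain s where s: "a \<in> carrier R" "s \<in> carrier R - P" "s \<otimes> a \<in> J"
      by (auto simp: loc_contr_def)
    have "s \<otimes> (r \<otimes> a) = r \<otimes> (s \<otimes> a)" using s r by (auto simp: m_ac)
    then show "r \<otimes> a \<in> loc_contr P J" using s r J(7)[OF s(3) r] by (intro loc_contrI[OF _ s(2)]) auto
  qed
  moreover have "a \<in> loc_contr P J"
    if sa: "s \<in> carrier R - P" "a \<in> carrier R" "s \<otimes> a \<in> loc_contr P J" for s a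
  proof -
    obtain t where t: "t \<in> carrier R - P" "t \<otimes> (s \<otimes> a) \<in> J" using sa(3) by (auto simp: loc_contr_def)
    then have "(t \<otimes> s) \<otimes> a \<in> J" using sa by (simp add: m_assoc)
    then show ?thesis using loc_contrI[OF sa(2) prime_compl_mult[OF P t(1) sa(1)]] by simp
  qed
  ultimately show "sat_ideal P (loc_contr P J)" by (auto simp: sat_ideal_def)
qed

end

section \<open>Noetherian rings: Nakayama's lemma, Artinian localisations and Krull's principal
  ideal theorem\<close>

locale noetherian_cring = noetherian_ring + cring
begin

text \<open>Zorn's lemma applies because the union of a nonempty chain of ideals of a Noetherian
  ring is a member of the chain.\<close>

lemma ideal_maximal_element:
  assumes "\<S> \<noteq> {}" "\<And>J. J \<in> \<S> \<Longrightarrow> ideal J R"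
  obtains M where "M \<in> \<S>" "\<And>J. J \<in> \<S> \<Longrightarrow> M \<subseteq> J \<Longrightarrow> J = M"
proof -
  have "\<exists>M\<in>\<S>. \<forall>J\<in>\<S>. M \<subseteq> J \<longrightarrow> J = M"
  proof (rule subset_Zorn)
    fix C assume C: "subset.chain \<S> C"
    show "\<exists>U\<in>\<S>. \<forall>J\<in>C. J \<subseteq> U"
    proof (cases "C = {}")
      case True then show ?thesis using assms(1) by auto
    next
      case False
      have "subset.chain {I. ideal I R} C" using C assms(2) by (auto simp: pred_on.chain_def)
      then have "\<Union>C \<in> C" using ideal_chain_is_trivial[OF False] by blast
      then show ?thesis using C by (auto simp: pred_on.chain_def)
    qed
  qed
  then show ?thesis using that by blast
qed

text \<open>Nakayama's lemma for the localisation at \<open>P\<close>: a maximal saturated ideal containing \<open>C\<close>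
  but not \<open>N\<close> contains \<open>P N\<close>.\<close>

lemma local_nakayama:
  assumes P: "primeideal P R" and C: "sat_ideal P C" and N: "ideal N R"
    and H: "\<And>D a. sat_ideal P D \<Longrightarrow> C \<subseteq> D \<Longrightarrow> (\<And>p b. p \<in> P \<Longrightarrow> b \<in> N \<Longrightarrow> p \<otimes> b \<in> D) \<Longrightarrow>
        a \<in> N \<Longrightarrow> \<exists>s\<in>carrier R - P. s \<otimes> a \<in> D"
  shows "N \<subseteq> C"
proof (rule ccontr)
  assume "\<not> N \<subseteq> C"
  note N = ideal_rules[OF N]
  note P' = ideal_rules[OF primeideal.axioms(1)[OF P]]
  define \<S> where "\<S> = {D. sat_ideal P D \<and> C \<subseteq> D \<and> \<not> N \<subseteq> D}"
  have "\<S> \<noteq> {}" using C \<open>\<not> N \<subseteq> C\<close> by (auto simp: \<S>_def)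
  then obtain D where D: "D \<in> \<S>" and max: "\<And>J. J \<in> \<S> \<Longrightarrow> D \<subseteq> J \<Longrightarrow> J = D"
    by (rule ideal_maximal_element) (auto simp: \<S>_def sat_ideal_def)
  have D': "sat_ideal P D" "C \<subseteq> D" "\<not> N \<subseteq> D" "ideal D R" using D by (auto simp: \<S>_def sat_ideal_def)
  note D'' = ideal_rules[OF D'(4)]
  have PN: "p \<otimes> b \<in> D" if p: "p \<in> P" and b: "b \<in> N" for p b
  proof (rule ccontr)
    assume *: "p \<otimes> b \<notin> D"
    have pb: "p \<in> carrier R" "b \<in> carrier R" using p b P' N by auto
    \<comment> \<open>Enlarging \<open>D\<close> by \<open>p b\<close> and saturating would force
      all of \<open>N\<close>, and so \<open>b\<close> itself, into the larger ideal. Then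
      \<open>s b = d + r p b\<close> with \<open>s\<close> outside \<open>P\<close>, and
      \<open>s - r p\<close>, which is outside \<open>P\<close> as well, carries \<open>b\<close>
      into \<open>D\<close>.\<close>
    let ?E = "loc_contr P (D <+>\<^bsub>R\<^esub> PIdl (p \<otimes> b))"
    note E0 = add_cgenideal[OF D'(4), of "p \<otimes> b"]
    have E: "sat_ideal P ?E" "D <+>\<^bsub>R\<^esub> PIdl (p \<otimes> b) \<subseteq> ?E"
      using loc_contr[OF P E0(1)] pb by auto
    have "p \<otimes> b \<in> ?E" "D \<subseteq> ?E" using E E0 pb by auto
    then have "?E \<notin> \<S>" using * max by blast
    then have "b \<in> ?E" using E \<open>D \<subseteq> ?E\<close> D' b by (auto simp: \<S>_def)
    then obtain s where s: "s \<in> carrier R - P" "s \<otimes> b \<in> D <+>\<^bsub>R\<^esub> PIdl (p \<otimes> b)"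
      by (auto simp: loc_contr_def)
    then obtain d r where dr: "d \<in> D" "r \<in> carrier R" "s \<otimes> b = d \<oplus> r \<otimes> (p \<otimes> b)"
      by (auto simp: mem_add_cgenideal)
    have c: "d \<in> carrier R" "s \<in> carrier R" using dr D'' s by auto
    have "(s \<ominus> r \<otimes> p) \<otimes> b = s \<otimes> b \<ominus> r \<otimes> (p \<otimes> b)"
      using c pb dr(2) by (simp add: minus_eq l_distr l_minus m_assoc)
    also have "\<dots> = d" unfolding dr(3) using c pb dr(2) by (simp add: minus_eq a_assoc r_neg)
    finally have 1: "(s \<ominus> r \<otimes> p) \<otimes> b \<in> D" using dr by simp
    have "s \<ominus> r \<otimes> p \<notin> P"
    proof
      assume "s \<ominus> r \<otimes> p \<in> P"
      then have "(s \<ominus> r \<otimes> p) \<oplus> r \<otimes> p \<in> P" using p dr P' by auto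
      moreover have "(s \<ominus> r \<otimes> p) \<oplus> r \<otimes> p = s" using c pb dr(2) by (simp add: minus_eq a_assoc l_neg)
      ultimately show False using s by auto
    qed
    then have "b \<in> D" using 1 D'(1) pb c dr(2) by (auto simp: sat_ideal_def)
    then show False using * D'' pb by auto
  qed
  have "N \<subseteq> D"
  proof
    fix a assume a: "a \<in> N"
    obtain s where "s \<in> carrier R - P" "s \<otimes> a \<in> D" using H[OF D'(1,2) PN a] by blast
    then show "a \<in> D" using D'(1) N(3)[OF a] unfolding sat_ideal_def by blast
  qed
  then show False using D' by simp
qed

end

context noetherian_cring
begin

text \<open>The localisation of \<open>R / M\<close> at \<open>P\<close> is Artinian if \<open>P\<close> is the only prime between \<open>M\<close> and
  \<open>P\<close>: by Noetherian induction, as an ideal \<open>J\<close> of it that is not the whole ring has an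
  upper neighbour \<open>J + (z)\<close> with \<open>P z \<subseteq> J\<close>.\<close>

lemma sat_ideal_dcc:
  assumes P: "primeideal P R"
    and min: "\<And>Q. primeideal Q R \<Longrightarrow> M \<subseteq> Q \<Longrightarrow> Q \<subseteq> P \<Longrightarrow> Q = P"
    and I: "\<And>k::nat. sat_ideal P (I k)" "\<And>k. M \<subseteq> I k" "\<And>k. I (Suc k) \<subseteq> I k" and M: "ideal M R"
  shows "\<exists>k. \<forall>j\<ge>k. I j = I k"
proof -
  \<comment> \<open>The condition concerns all descending chains of saturated ideals that contain
    \<open>J\<close>, so it can be transferred from a larger ideal back to \<open>J\<close>. The
    induction looks at a maximal \<open>J\<close> for which it fails.\<close>
  define dcc where "dcc J \<longleftrightarrow> (\<forall>I. (\<forall>k::nat. sat_ideal P (I k) \<and> J \<subseteq> I k \<and> I (Suc k) \<subseteq> I k) \<longrightarrow>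
      (\<exists>k. \<forall>j\<ge>k. I j = I k))" for J
  define \<S> where "\<S> = {J. sat_ideal P J \<and> M \<subseteq> J \<and> \<not> dcc J}"
  have "\<S> = {}"
  proof (rule ccontr)
    assume "\<S> \<noteq> {}"
    then obtain J where J: "J \<in> \<S>" and maxJ: "\<And>D. D \<in> \<S> \<Longrightarrow> J \<subseteq> D \<Longrightarrow> D = J"
      by (rule ideal_maximal_element) (auto simp: \<S>_def sat_ideal_def)
    have J1: "sat_ideal P J" "ideal J R" "M \<subseteq> J" "\<not> dcc J" using J by (auto simp: \<S>_def sat_ideal_def)
    note J' = ideal_rules[OF J1(2)]
    have satJ: "a \<in> J" if "s \<in> carrier R - P" "a \<in> carrier R" "s \<otimes> a \<in> J" for s a
      using J1(1) that unfolding sat_ideal_def by blast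
    define ann where "ann z = {r \<in> carrier R. r \<otimes> z \<in> J}" for z
    have ann: "ideal (ann z) R" if "z \<in> carrier R" for z
    proof (rule idealI')
      show "ann z \<subseteq> carrier R" "\<zero> \<in> ann z" using that J' by (auto simp: ann_def)
      show "a \<oplus> b \<in> ann z" if "a \<in> ann z" "b \<in> ann z" for a b
        using that \<open>z \<in> carrier R\<close> J' by (auto simp: ann_def l_distr)
      show "r \<otimes> a \<in> ann z" if "a \<in> ann z" "r \<in> carrier R" for a r
        using that \<open>z \<in> carrier R\<close> J' by (auto simp: ann_def m_assoc)
    qed
    have "J \<noteq> carrier R"
    proof
      assume *: "J = carrier R"
      have "dcc J" unfolding dcc_def
      proof (intro allI impI)
        fix I assume "\<forall>k::nat. sat_ideal P (I k) \<and> J \<subseteq> I k \<and> I (Suc k) \<subseteq> I k"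
        then have "I k = carrier R" for k using * ideal_rules(1)[of "I k"] by (auto simp: sat_ideal_def)
        then show "\<exists>k. \<forall>j\<ge>k. I j = I k" by simp
      qed
      then show False using J1 by simp
    qed
    then have "ann ` (carrier R - J) \<noteq> {}" using J' by auto
    then obtain A where A: "A \<in> ann ` (carrier R - J)"
      and maxA: "\<And>D. D \<in> ann ` (carrier R - J) \<Longrightarrow> A \<subseteq> D \<Longrightarrow> D = A"
      by (rule ideal_maximal_element) (use ann in auto)
    obtain z where z: "z \<in> carrier R" "z \<notin> J" "A = ann z" using A by auto
    note annz = ideal_rules[OF ann[OF z(1)]]
    \<comment> \<open>An annihilator that is maximal among those of nonzero elements of
      \<open>R / J\<close> is prime. It lies between \<open>M\<close> and \<open>P\<close>, so it is
      \<open>P\<close>, and \<open>z\<close> spans an upper neighbour of \<open>J\<close>.\<close>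
    have primeA: "primeideal (ann z) R"
    proof (rule primeidealI[OF ann[OF z(1)] is_cring])
      have "\<one> \<notin> ann z" using z by (simp add: ann_def)
      then show "carrier R \<noteq> ann z" by blast
    next
      fix a b assume ab: "a \<in> carrier R" "b \<in> carrier R" "a \<otimes> b \<in> ann z"
      show "a \<in> ann z \<or> b \<in> ann z"
      proof (rule ccontr)
        assume n: "\<not> (a \<in> ann z \<or> b \<in> ann z)"
        have "b \<otimes> z \<in> carrier R - J" using n ab z by (auto simp: ann_def)
        moreover have "ann z \<subseteq> ann (b \<otimes> z)"
        proof
          fix r assume "r \<in> ann z"
          then have r: "r \<in> carrier R" "r \<otimes> z \<in> J" by (auto simp: ann_def)
          have "r \<otimes> (b \<otimes> z) = b \<otimes> (r \<otimes> z)" using r ab z by (simp add: m_ac)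
          also have "\<dots> \<in> J" using r ab J' by auto
          finally show "r \<in> ann (b \<otimes> z)" using r by (simp add: ann_def)
        qed
        ultimately have "ann (b \<otimes> z) = ann z" using maxA z(3) by blast
        moreover have "a \<in> ann (b \<otimes> z)" using ab z by (auto simp: ann_def m_assoc)
        ultimately show False using n by simp
      qed
    qed
    have "M \<subseteq> ann z" using J1(3) J' z ideal_rules(1)[OF M] by (auto simp: ann_def)
    moreover have "ann z \<subseteq> P" using satJ[OF _ z(1)] z(2) by (auto simp: ann_def)
    ultimately have annP: "ann z = P" using min[OF primeA] by blast
    have Pz: "p \<otimes> z \<in> J" if "p \<in> P" for p using that annP by (auto simp: ann_def)
    let ?E = "loc_contr P (J <+>\<^bsub>R\<^esub> PIdl z)"
    note E0 = add_cgenideal[OF J1(2) z(1)]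
    note E = loc_contr[OF P E0(1)]
    have "J \<subseteq> ?E" "z \<in> ?E" using E E0 by auto
    then have "?E \<notin> \<S>" using maxJ z by blast
    then have dccE: "dcc ?E" using E \<open>J \<subseteq> ?E\<close> J1 by (auto simp: \<S>_def)
    have "dcc J" unfolding dcc_def
    proof (intro allI impI)
      fix I assume I: "\<forall>k::nat. sat_ideal P (I k) \<and> J \<subseteq> I k \<and> I (Suc k) \<subseteq> I k"
      have Ii: "ideal (I k) R" "J \<subseteq> I k" for k using I by (auto simp: sat_ideal_def)
      note Ir = ideal_rules[OF Ii(1)]
      have satI: "a \<in> I k" if "s \<in> carrier R - P" "a \<in> carrier R" "s \<otimes> a \<in> I k" for s a k
        using I that unfolding sat_ideal_def by blast
      have mono: "I j \<subseteq> I k" if "k \<le> j" for j k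
        using lift_Suc_antimono_le[where f = I and n = k and n' = j] that I by blast
      show "\<exists>k. \<forall>j\<ge>k. I j = I k"
      proof (cases "\<forall>k. z \<in> I k")
        case True
        have "?E \<subseteq> I k" for k
        proof
          fix e assume "e \<in> ?E"
          then obtain s j r where *: "e \<in> carrier R" "s \<in> carrier R - P" "j \<in> J" "r \<in> carrier R"
            "s \<otimes> e = j \<oplus> r \<otimes> z" by (auto simp: loc_contr_def mem_add_cgenideal)
          have "s \<otimes> e \<in> I k" unfolding *(5) using * True Ir(4,7) Ii by blast
          then show "e \<in> I k" using satI * by blast
        qed
        then show ?thesis using dccE I unfolding dcc_def by blast
      next
        case False
        then obtain k0 where k0: "z \<notin> I k0" by blast
        then have nz: "z \<notin> I k" if "k \<ge> k0" for k using mono[OF that] by blast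
        \<comment> \<open>The members from \<open>k0\<close> on miss \<open>z\<close>, so by
          saturation every \<open>r\<close> with \<open>r z\<close> in such a member lies in
          \<open>P\<close>, and then \<open>r z\<close> is already in \<open>J\<close>. Hence
          nothing is lost by adding \<open>z\<close>: equality of the enlarged ideals gives equality
          of the members themselves.\<close>
        define I' where "I' k = loc_contr P (I (k0 + k) <+>\<^bsub>R\<^esub> PIdl z)" for k
        have I0: "ideal (I k <+>\<^bsub>R\<^esub> PIdl z) R" "I k \<subseteq> I k <+>\<^bsub>R\<^esub> PIdl z" for k
          using add_cgenideal[OF Ii(1) z(1)] by auto
        have "sat_ideal P (I' k)" "?E \<subseteq> I' k" "I' (Suc k) \<subseteq> I' k" for k
        proof -
          show "sat_ideal P (I' k)" unfolding I'_def using loc_contr[OF P I0(1)] by blast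
          show "?E \<subseteq> I' k" "I' (Suc k) \<subseteq> I' k" unfolding I'_def
            by (intro loc_contr_mono add_cgenideal_mono Ii(2) mono; simp)+
        qed
        then obtain k1 where k1: "\<And>j. j \<ge> k1 \<Longrightarrow> I' j = I' k1" using dccE unfolding dcc_def by blast
        have "I j = I (k0 + k1)" if j: "j \<ge> k0 + k1" for j
        proof
          show "I j \<subseteq> I (k0 + k1)" using mono j by blast
          show "I (k0 + k1) \<subseteq> I j"
          proof
            fix w assume w: "w \<in> I (k0 + k1)"
            have wc: "w \<in> carrier R" using w Ir(3) by blast
            have "w \<in> I' k1" unfolding I'_def using w I0(2) loc_contr(2)[OF P I0(1)] by blast
            also have "I' k1 = I' (j - k0)" using k1[of "j - k0"] j by auto
            finally have "w \<in> loc_contr P (I j <+>\<^bsub>R\<^esub> PIdl z)" unfolding I'_def using j by simp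
            then obtain s i r where *: "s \<in> carrier R - P" "i \<in> I j" "r \<in> carrier R"
              "s \<otimes> w = i \<oplus> r \<otimes> z" by (auto simp: loc_contr_def mem_add_cgenideal)
            have c: "i \<in> carrier R" "s \<in> carrier R" using * Ir(3) by auto
            have "i \<in> I (k0 + k1)" using * mono j by blast
            moreover have "i \<oplus> r \<otimes> z \<in> I (k0 + k1)" using w Ir(7)[OF w c(2)] *(4) by simp
            ultimately have "r \<otimes> z \<in> I (k0 + k1)"
              using ideal_add_cancel[OF Ii(1)] *(3) z by blast
            then have "r \<in> P" using satI[of r z] *(3) z nz[of "k0 + k1"] by auto
            then have "r \<otimes> z \<in> I j" using Pz Ii(2) by blast
            then have "s \<otimes> w \<in> I j" unfolding *(4) using * Ir(4) by blast
            then show "w \<in> I j" using satI * wc by blast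
          qed
        qed
        then show ?thesis by blast
      qed
    qed
    then show False using J1 by simp
  qed
  moreover have "sat_ideal P (loc_contr P M)" "M \<subseteq> loc_contr P M" using loc_contr[OF P M] by auto
  ultimately have "dcc (loc_contr P M)" by (auto simp: \<S>_def)
  moreover have "loc_contr P M \<subseteq> I k" for k
    using I(1,2)[of k] unfolding sat_ideal_def loc_contr_def by blast
  ultimately show ?thesis using I unfolding dcc_def by blast
qed

lemma prime_pow_notin:
  assumes "primeideal P R" "y \<in> carrier R" "y \<notin> P"
  shows "y [^] (k::nat) \<notin> P"
proof (induction k)
  case 0 then show ?case using prime_compl_one[OF assms(1)] by simp
next
  case (Suc k) then show ?case using primeideal.I_prime[OF assms(1), of "y [^] k" y] assms by auto
qed

text \<open>If \<open>Q2\<close> were minimal over \<open>Q0 + (x)\<close>, then with \<open>N k\<close> the localisation of \<open>Q0 + (y\<^sup>k)\<close> at \<open>Q1\<close>, for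
  some \<open>y\<close> in \<open>Q1\<close> but not in \<open>Q0\<close>, the chain \<open>N k + (x)\<close> would become stationary, and \<open>N k\<close> with it
  by Nakayama's lemma.\<close>

lemma krull_principal_ideal:
  assumes Q: "primeideal Q0 R" "primeideal Q1 R" "primeideal Q2 R" "Q0 \<subset> Q1" "Q1 \<subset> Q2"
    and x: "x \<in> Q2"
  shows "\<exists>Q. primeideal Q R \<and> Q0 \<subset> Q \<and> Q \<subset> Q2 \<and> x \<in> Q"
proof (rule ccontr)
  assume no: "\<not> ?thesis"
  then have x1: "x \<notin> Q1" using Q by blast
  note i0 = primeideal.axioms(1)[OF Q(1)] and i1 = primeideal.axioms(1)[OF Q(2)]
    and i2 = primeideal.axioms(1)[OF Q(3)]
  note r0 = ideal_rules[OF i0] and r1 = ideal_rules[OF i1] and r2 = ideal_rules[OF i2]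
  have xc: "x \<in> carrier R" using r2 x by auto
  obtain y where y: "y \<in> Q1" "y \<notin> Q0" "y \<in> carrier R" using Q r1 by blast
  \<comment> \<open>The negated claim amounts to \<open>Q2\<close> being the only prime between this
    ideal and \<open>Q2\<close>, which is what \<open>sat_ideal_dcc\<close> asks for.\<close>
  define M where "M = Q0 <+>\<^bsub>R\<^esub> PIdl x"
  note M = add_cgenideal[OF i0 xc, folded M_def]
  have min: "S = Q2" if S: "primeideal S R" "M \<subseteq> S" "S \<subseteq> Q2" for S
  proof (rule ccontr)
    assume "S \<noteq> Q2"
    moreover have "x \<in> S" "Q0 \<subseteq> S" using M S by auto
    moreover have "x \<notin> Q0" using x1 Q by auto
    ultimately show False using no S by blast
  qed
  define N where "N k = loc_contr Q1 (Q0 <+>\<^bsub>R\<^esub> PIdl (y [^] (k::nat)))" for k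
  have y_pow: "y [^] k \<in> carrier R" for k :: nat using y by auto
  note N0 = add_cgenideal[OF i0 y_pow]
  have satN: "sat_ideal Q1 (N k)" for k unfolding N_def using loc_contr(1)[OF Q(2) N0(1)] .
  then have Ni: "ideal (N k) R" for k by (auto simp: sat_ideal_def)
  note Nr = ideal_rules[OF Ni]
  have "Q0 \<subseteq> N k" "y [^] k \<in> N k" for k
    unfolding N_def using loc_contr(2)[OF Q(2) N0(1)] N0(2,3) by blast+
  note N2 = this
  have Nanti: "N (Suc k) \<subseteq> N k" for k
  proof -
    have "Q0 <+>\<^bsub>R\<^esub> PIdl (y [^] Suc k) \<subseteq> Q0 <+>\<^bsub>R\<^esub> PIdl (y [^] k)"
    proof
      fix a assume "a \<in> Q0 <+>\<^bsub>R\<^esub> PIdl (y [^] Suc k)"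
      then obtain j r where "j \<in> Q0" "r \<in> carrier R" "a = j \<oplus> r \<otimes> y [^] Suc k"
        by (auto simp: mem_add_cgenideal)
      moreover have "r \<otimes> y [^] Suc k = (r \<otimes> y) \<otimes> y [^] k" using y calculation by (simp add: m_ac)
      ultimately show "a \<in> Q0 <+>\<^bsub>R\<^esub> PIdl (y [^] k)" unfolding mem_add_cgenideal
        using y by (metis m_closed)
    qed
    then show ?thesis unfolding N_def by (auto simp: loc_contr_def)
  qed
  define I where "I k = loc_contr Q2 (N k <+>\<^bsub>R\<^esub> PIdl x)" for k
  note I0 = add_cgenideal[OF Ni xc]
  have satI: "sat_ideal Q2 (I k)" for k unfolding I_def using loc_contr(1)[OF Q(3) I0(1)] .
  have "N k <+>\<^bsub>R\<^esub> PIdl x \<subseteq> I k" for k unfolding I_def using loc_contr(2)[OF Q(3) I0(1)] .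
  note I2 = this
  have "M \<subseteq> N k <+>\<^bsub>R\<^esub> PIdl x" for k unfolding M_def by (intro add_cgenideal_mono N2)
  then have MI: "M \<subseteq> I k" for k using I2 by blast
  have Ianti: "I (Suc k) \<subseteq> I k" for k unfolding I_def by (intro loc_contr_mono add_cgenideal_mono Nanti)
  obtain k where k: "\<forall>j\<ge>k. I j = I k"
    using sat_ideal_dcc[where I = I and M = M, OF Q(3) min satI MI Ianti M(1)] by auto
  have IS: "I (Suc k) = I k" using k le_SucI[OF order_refl] by blast
  have "N k \<subseteq> N (Suc k)"
  proof (rule local_nakayama[OF Q(3) _ Ni])
    \<comment> \<open>Saturation at \<open>Q1\<close> is the stronger condition, as the complement
      of \<open>Q2\<close> is smaller.\<close>
    show "sat_ideal Q2 (N (Suc k))" using satN[of "Suc k"] Q(5) unfolding sat_ideal_def by blast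
  next
    fix D a assume D: "sat_ideal Q2 D" "N (Suc k) \<subseteq> D"
      and PN: "\<And>p b. p \<in> Q2 \<Longrightarrow> b \<in> N k \<Longrightarrow> p \<otimes> b \<in> D" and a: "a \<in> N k"
    have Di: "ideal D R" using D by (auto simp: sat_ideal_def)
    have "a \<in> I k" using a I2 I0(2) by blast
    then have "a \<in> I (Suc k)" unfolding IS .
    then obtain s b r where *: "s \<in> carrier R - Q2" "b \<in> N (Suc k)" "r \<in> carrier R"
      "s \<otimes> a = b \<oplus> r \<otimes> x" by (auto simp: I_def loc_contr_def mem_add_cgenideal)
    \<comment> \<open>Both \<open>s a\<close> and \<open>b\<close> lie in \<open>N k\<close>, hence
      so does \<open>r x\<close>. Since \<open>x\<close> is outside \<open>Q1\<close> and
      \<open>N k\<close> is saturated there, \<open>r\<close> itself lies in \<open>N k\<close>, so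
      \<open>a\<close> is in \<open>N (Suc k)\<close> up to a product from \<open>Q2\<close> and
      \<open>N k\<close>.\<close>
    have "b \<oplus> r \<otimes> x \<in> N k" using Nr(7)[OF a, of s] * by auto
    moreover have "b \<in> N k" using * Nanti by blast
    ultimately have "r \<otimes> x \<in> N k" using ideal_add_cancel[OF Ni] * xc by blast
    then have "x \<otimes> r \<in> N k" using * xc by (simp add: m_comm)
    then have "r \<in> N k" using satN[of k] x1 xc * unfolding sat_ideal_def by blast
    then have "x \<otimes> r \<in> D" using PN x by blast
    then have "s \<otimes> a \<in> D" unfolding *(4) using * D(2) xc ideal_rules(4)[OF Di] by (auto simp: m_comm)
    then show "\<exists>s\<in>carrier R - Q2. s \<otimes> a \<in> D" using * by blast
  qed
  then have "y [^] k \<in> N (Suc k)" using N2(2) by blast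
  then obtain s q t where *: "s \<in> carrier R - Q1" "q \<in> Q0" "t \<in> carrier R"
    "s \<otimes> y [^] k = q \<oplus> t \<otimes> y [^] Suc k" by (auto simp: N_def loc_contr_def mem_add_cgenideal)
  have c: "s \<in> carrier R" "q \<in> carrier R" "y [^] k \<in> carrier R" using * r0 y by auto
  have "(s \<ominus> t \<otimes> y) \<otimes> u = s \<otimes> u \<ominus> t \<otimes> (u \<otimes> y)" if "u \<in> carrier R" for u
    using c(1) *(3) y(3) that by algebra
  from this[OF c(3)] have "(s \<ominus> t \<otimes> y) \<otimes> y [^] k = s \<otimes> y [^] k \<ominus> t \<otimes> y [^] Suc k"
    by simp
  also have "\<dots> = q" unfolding *(4) using c *(3) y by (simp add: minus_eq a_assoc r_neg del: nat_pow_Suc)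
  \<comment> \<open>As \<open>y\<close> is outside the prime \<open>Q0\<close>, the power can be
    cancelled. Then \<open>s - t y\<close> lies in \<open>Q0 \<subset> Q1\<close>, and together with
    \<open>y \<in> Q1\<close> this puts \<open>s\<close> into \<open>Q1\<close>, contrary to its
    choice.\<close>
  finally have "(s \<ominus> t \<otimes> y) \<otimes> y [^] k \<in> Q0" using * by simp
  then have "s \<ominus> t \<otimes> y \<in> Q0"
    using primeideal.I_prime[OF Q(1), of "s \<ominus> t \<otimes> y" "y [^] k"] prime_pow_notin[OF Q(1) y(3,2), of k] c *(3) y
    by auto
  then have "s \<ominus> t \<otimes> y \<in> Q1" using Q(4) by blast
  then have "(s \<ominus> t \<otimes> y) \<oplus> t \<otimes> y \<in> Q1" by (rule r1(4)) (rule r1(7)[OF y(1) *(3)])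
  moreover have "(s \<ominus> t \<otimes> y) \<oplus> t \<otimes> y = s" using c y *(3) by (simp add: minus_eq a_assoc l_neg)
  ultimately show False using * by simp
qed

end

section \<open>Regular parameters\<close>

context cring
begin

lemma add_cgenideal_least:
  assumes "ideal I R" "J \<subseteq> I" "z \<in> I"
  shows "J <+>\<^bsub>R\<^esub> PIdl z \<subseteq> I"
proof
  fix a assume "a \<in> J <+>\<^bsub>R\<^esub> PIdl z"
  then obtain j r where "j \<in> J" "r \<in> carrier R" "a = j \<oplus> r \<otimes> z" by (auto simp: mem_add_cgenideal)
  then show "a \<in> I" using ideal_rules(4)[OF assms(1)] ideal_rules(7)[OF assms(1,3)] assms(2) by auto
qed

lemma Idl_insert:
  assumes "z \<in> carrier R" "S \<subseteq> carrier R"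
  shows "Idl (insert z S) = Idl S <+>\<^bsub>R\<^esub> PIdl z"
proof
  note A = add_cgenideal[OF genideal_ideal[OF assms(2)] assms(1)]
  have S: "S \<subseteq> Idl S" using genideal_self[OF assms(2)] .
  show "Idl (insert z S) \<subseteq> Idl S <+>\<^bsub>R\<^esub> PIdl z"
    using S A by (intro genideal_minimal) auto
  have i: "ideal (Idl (insert z S)) R" using assms by (intro genideal_ideal) auto
  have s: "insert z S \<subseteq> Idl (insert z S)" using assms by (intro genideal_self) auto
  have "Idl S \<subseteq> Idl (insert z S)" using s by (intro genideal_minimal[OF i]) auto
  then show "Idl S <+>\<^bsub>R\<^esub> PIdl z \<subseteq> Idl (insert z S)"
    using s by (intro add_cgenideal_least[OF i]) auto
qed

lemma Idl_mono: "S \<subseteq> S' \<Longrightarrow> S' \<subseteq> carrier R \<Longrightarrow> Idl S \<subseteq> Idl S'"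
  using genideal_minimal[OF genideal_ideal, of S' S] genideal_self[of S'] by blast

lemma ideal_finsum:
  assumes "ideal J R" "\<And>j. j \<in> S \<Longrightarrow> u j \<in> J"
  shows "(\<Oplus>j\<in>S. u j) \<in> J"
proof (cases "finite S")
  case True
  then show ?thesis using assms(2)
  proof (induction S)
    case empty
    then show ?case using ideal_rules(2)[OF assms(1)] by simp
  next
    case (insert s S)
    then have "u \<in> S \<rightarrow> carrier R" "u s \<in> carrier R" using ideal_rules(3)[OF assms(1)] by auto
    then show ?case using insert ideal_rules(4)[OF assms(1)] by simp
  qed
next
  case False
  then show ?thesis using ideal_rules(2)[OF assms(1)] by (simp add: finsum_infinite)
qed

lemma mem_Idl_image:
  assumes "finite S" "Y \<in> S \<rightarrow> carrier R"
  shows "a \<in> Idl (Y ` S) \<longleftrightarrow> (\<exists>b. b \<in> S \<rightarrow> carrier R \<and> a = (\<Oplus>j\<in>S. b j \<otimes> Y j))"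
  using assms
proof (induction S arbitrary: a)
  case empty
  have "Idl {} = {\<zero>}" using genideal_minimal[OF zeroideal, of "{}"] ideal_rules(2)[OF genideal_ideal[of "{}"]] by auto
  then show ?case by simp
next
  case (insert s S)
  have Y: "Y s \<in> carrier R" "Y ` S \<subseteq> carrier R" "Y \<in> S \<rightarrow> carrier R" using insert by auto
  have eq: "(\<Oplus>j\<in>insert s S. b j \<otimes> Y j) = b s \<otimes> Y s \<oplus> (\<Oplus>j\<in>S. b j \<otimes> Y j)"
    if "b \<in> insert s S \<rightarrow> carrier R" for b
    using that insert(1,2) Y by (intro finsum_insert) auto
  show ?case
  proof
    assume "a \<in> Idl (Y ` insert s S)"
    then obtain j r where jr: "j \<in> Idl (Y ` S)" "r \<in> carrier R" "a = j \<oplus> r \<otimes> Y s"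
      using Idl_insert[OF Y(1,2)] by (auto simp: mem_add_cgenideal)
    then obtain b where b: "b \<in> S \<rightarrow> carrier R" "j = (\<Oplus>j\<in>S. b j \<otimes> Y j)"
      using insert.IH[OF Y(3)] by auto
    have b': "b(s := r) \<in> insert s S \<rightarrow> carrier R" using b jr insert by auto
    have "(\<Oplus>j\<in>S. (b(s := r)) j \<otimes> Y j) = j" unfolding b(2)
      using b insert Y by (intro finsum_cong') auto
    then have "a = (\<Oplus>j\<in>insert s S. (b(s := r)) j \<otimes> Y j)"
      unfolding eq[OF b'] jr(3) using jr Y ideal_rules(3)[OF genideal_ideal[OF Y(2)] jr(1)]
      by (simp add: a_comm)
    then show "\<exists>b. b \<in> insert s S \<rightarrow> carrier R \<and> a = (\<Oplus>j\<in>insert s S. b j \<otimes> Y j)"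
      using b' by blast
  next
    assume "\<exists>b. b \<in> insert s S \<rightarrow> carrier R \<and> a = (\<Oplus>j\<in>insert s S. b j \<otimes> Y j)"
    then obtain b where b: "b \<in> insert s S \<rightarrow> carrier R" "a = (\<Oplus>j\<in>insert s S. b j \<otimes> Y j)"
      by blast
    have i: "ideal (Idl (Y ` insert s S)) R" using Y by (intro genideal_ideal) auto
    have "Y ` insert s S \<subseteq> Idl (Y ` insert s S)" using Y by (intro genideal_self) auto
    then show "a \<in> Idl (Y ` insert s S)"
      unfolding b(2) using b(1) ideal_rules(7)[OF i] by (intro ideal_finsum[OF i]) auto
  qed
qed

text \<open>Denominators outside \<open>M\<close> are invertible and can be cancelled in any ideal.
  With \<open>P = M\<close>, \<open>local_nakayama\<close> becomes the usual lemma of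
  Nakayama.\<close>

lemma sat_ideal_local:
  assumes "carrier R - M \<subseteq> Units R" "ideal C R"
  shows "sat_ideal M C"
  unfolding sat_ideal_def
proof (intro conjI ballI impI assms(2))
  fix s a assume s: "s \<in> carrier R - M" and a: "a \<in> carrier R" "s \<otimes> a \<in> C"
  then have "s \<in> Units R" using assms(1) by auto
  then have "a = inv s \<otimes> (s \<otimes> a)" "inv s \<in> carrier R" using a s by (auto simp: m_assoc[symmetric])
  then show "a \<in> C" using ideal_rules(7)[OF assms(2) a(2)] by metis
qed

lemma Idl_tail_Suc:
  assumes "Suc m \<le> l" "X ` {1..l} \<subseteq> carrier R"
  shows "Idl (X ` {m<..l}) = Idl (X ` {Suc m<..l}) <+>\<^bsub>R\<^esub> PIdl (X (Suc m))"
proof -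
  have "{m<..l} = insert (Suc m) {Suc m<..l}" using assms(1) by auto
  moreover have "X (Suc m) \<in> carrier R" "X ` {Suc m<..l} \<subseteq> carrier R"
    using assms by (auto simp: image_subset_iff)
  ultimately show ?thesis using Idl_insert[of "X (Suc m)" "X ` {Suc m<..l}"] by simp
qed

lemma ideal_Idl_tail:
  fixes l :: nat
  assumes "X ` {1..l} \<subseteq> carrier R"
  shows "ideal (Idl (X ` {m<..l})) R"
proof -
  have "{m<..l} \<subseteq> {1..l}" by auto
  then show ?thesis using assms by (intro genideal_ideal) blast
qed

lemma ideal_I2:
  assumes "u \<in> {1..l} \<rightarrow> carrier R" "v \<in> {1..l} \<rightarrow> carrier R"
  shows "ideal (I2 R l u v) R"
    and "1 \<le> p \<Longrightarrow> p < q \<Longrightarrow> q \<le> l \<Longrightarrow> u p \<otimes> v q \<ominus> u q \<otimes> v p \<in> I2 R l u v"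
proof -
  have *: "{u p \<otimes> v q \<ominus> u q \<otimes> v p | p q. 1 \<le> p \<and> p < q \<and> q \<le> l} \<subseteq> carrier R"
    using assms by (auto simp: Pi_iff)
  show "ideal (I2 R l u v) R" unfolding I2_def by (rule genideal_ideal[OF *])
  show "1 \<le> p \<Longrightarrow> p < q \<Longrightarrow> q \<le> l \<Longrightarrow> u p \<otimes> v q \<ominus> u q \<otimes> v p \<in> I2 R l u v"
    unfolding I2_def using genideal_self[OF *] by blast
qed

text \<open>Exactness of the Koszul complex of a regular sequence in degree one.\<close>

lemma regular_sequence_relation:
  assumes Y: "Y \<in> {1..l} \<rightarrow> carrier R" and a: "a \<in> {1..l} \<rightarrow> carrier R"
    and reg: "\<And>j r. j \<in> {1..l} \<Longrightarrow> r \<in> carrier R \<Longrightarrow> r \<otimes> Y j \<in> Idl (Y ` {j<..l}) \<Longrightarrow> r \<in> Idl (Y ` {j<..l})"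
    and "m \<le> l" "w \<in> {m<..l} \<rightarrow> carrier R" "(\<Oplus>j\<in>{m<..l}. w j \<otimes> Y j) = \<zero>"
  shows "(\<forall>j\<in>{m<..l}. w j \<in> Idl (Y ` {1..l})) \<and> (\<Oplus>j\<in>{m<..l}. w j \<otimes> a j) \<in> I2 R l a Y"
  using assms(4-)
proof (induction "l - m" arbitrary: m w)
  case 0
  then have "{m<..l} = {}" by auto
  then show ?case using ideal_rules(2)[OF ideal_I2(1)[OF a Y]] by simp
next
  case (Suc d)
  let ?m = "Suc m" and ?S = "{Suc m<..l}"
  have S: "{m<..l} = insert ?m ?S" "?m \<in> {1..l}" "?S \<subseteq> {1..l}" "finite ?S" "?m \<notin> ?S"
    using Suc.hyps(2) by auto
  have c: "Y ?m \<in> carrier R" "a ?m \<in> carrier R" "w ?m \<in> carrier R"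
    using Y a S Suc.prems(2) by auto
  have cS: "Y j \<in> carrier R" "a j \<in> carrier R" "w j \<in> carrier R" if "j \<in> ?S" for j
    using that Y a S Suc.prems(2) by auto
  have YS: "Y \<in> ?S \<rightarrow> carrier R" using cS by auto
  have Yi: "Y ` {1..l} \<subseteq> carrier R" using Y by auto
  note iT = ideal_Idl_tail[OF Yi, of ?m]
  have sum_in: "(\<Oplus>j\<in>?S. w j \<otimes> Y j) \<in> Idl (Y ` ?S)"
  proof (rule ideal_finsum[OF iT])
    fix j assume j: "j \<in> ?S"
    have "Y ` ?S \<subseteq> Idl (Y ` ?S)" using YS by (intro genideal_self) auto
    then show "w j \<otimes> Y j \<in> Idl (Y ` ?S)" using j cS(3)[OF j] by (intro ideal_rules(7)[OF iT]) auto
  qed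
  have eq0: "w ?m \<otimes> Y ?m \<oplus> (\<Oplus>j\<in>?S. w j \<otimes> Y j) = \<zero>"
    using Suc.prems(3) S c cS unfolding S(1) by (subst (asm) finsum_insert) auto
  then have "w ?m \<otimes> Y ?m \<in> Idl (Y ` ?S)"
    using ideal_add_cancel[OF iT sum_in, of "w ?m \<otimes> Y ?m"] ideal_rules(2)[OF iT]
      ideal_rules(3)[OF iT sum_in] c by (simp add: a_comm)
  then have wm: "w ?m \<in> Idl (Y ` ?S)" using reg[OF S(2) c(3)] by simp
  then obtain b where b: "b \<in> ?S \<rightarrow> carrier R" "w ?m = (\<Oplus>j\<in>?S. b j \<otimes> Y j)"
    using mem_Idl_image[OF S(4) YS] by auto
  have cb: "b j \<in> carrier R" if "j \<in> ?S" for j using b that by auto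
  \<comment> \<open>Adding the Koszul relations with coefficients \<open>b j\<close> to
    \<open>w\<close> kills the coefficient at \<open>?m\<close> and leaves a relation among the
    later \<open>Y j\<close>. Paired with \<open>a\<close>, those Koszul relations give multiples of
    minors, the elements \<open>t j\<close> below.\<close>
  define w' where "w' j = w j \<oplus> b j \<otimes> Y ?m" for j
  have cw': "w' j \<in> carrier R" if "j \<in> ?S" for j using cb cS c that by (simp add: w'_def)
  have "(\<Oplus>j\<in>?S. w' j \<otimes> Y j) = (\<Oplus>j\<in>?S. w j \<otimes> Y j \<oplus> (b j \<otimes> Y j) \<otimes> Y ?m)"
  proof (intro finsum_cong' refl)
    fix j assume j: "j \<in> ?S"
    show "w' j \<otimes> Y j = w j \<otimes> Y j \<oplus> (b j \<otimes> Y j) \<otimes> Y ?m"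
      unfolding w'_def using cS[OF j] cb[OF j] c by algebra
  qed (use cb cS c in auto)
  also have "\<dots> = (\<Oplus>j\<in>?S. w j \<otimes> Y j) \<oplus> w ?m \<otimes> Y ?m"
    unfolding b(2) using cb cS c by (subst finsum_addf) (auto simp: finsum_ldistr)
  also have "\<dots> = \<zero>" using eq0 c cS by (subst a_comm) auto
  finally have IH: "\<forall>j\<in>?S. w' j \<in> Idl (Y ` {1..l})" "(\<Oplus>j\<in>?S. w' j \<otimes> a j) \<in> I2 R l a Y"
    using Suc.hyps(1)[of ?m w'] Suc.hyps(2) cw' by auto
  have iA: "ideal (Idl (Y ` {1..l})) R" using genideal_ideal[OF Yi] .
  have Yin: "Y j \<in> Idl (Y ` {1..l})" if "j \<in> {1..l}" for j using genideal_self[OF Yi] that by auto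
  have "w ?m \<in> Idl (Y ` {1..l})" using wm Idl_mono[of "Y ` ?S" "Y ` {1..l}"] S(3) Yi by blast
  moreover have "w j \<in> Idl (Y ` {1..l})" if "j \<in> ?S" for j
  proof (rule ideal_add_cancel[OF iA])
    show "b j \<otimes> Y ?m \<in> Idl (Y ` {1..l})" using ideal_rules(7)[OF iA Yin[OF S(2)] cb[OF that]] .
    show "b j \<otimes> Y ?m \<oplus> w j \<in> Idl (Y ` {1..l})"
      using IH(1) that cS(3)[OF that] cb[OF that] c by (auto simp: w'_def a_comm)
  qed (use cS that in auto)
  moreover have "(\<Oplus>j\<in>{m<..l}. w j \<otimes> a j) \<in> I2 R l a Y"
  proof -
    define t where "t j = b j \<otimes> (a ?m \<otimes> Y j \<ominus> a j \<otimes> Y ?m)" for j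
    note i2 = ideal_I2[OF a Y]
    have t: "t j \<in> I2 R l a Y" if "j \<in> ?S" for j
      unfolding t_def using that cb by (intro ideal_rules(7)[OF i2(1)] i2(2)) auto
    have ct: "t j \<in> carrier R" if "j \<in> ?S" for j using ideal_rules(3)[OF i2(1) t[OF that]] .
    have "(\<Oplus>j\<in>{m<..l}. w j \<otimes> a j) = (\<Oplus>j\<in>?S. w j \<otimes> a j) \<oplus> w ?m \<otimes> a ?m"
      using S c cS unfolding S(1) by (subst finsum_insert) (auto simp: a_comm)
    also have "\<dots> = (\<Oplus>j\<in>?S. w j \<otimes> a j \<oplus> (b j \<otimes> Y j) \<otimes> a ?m)"
      unfolding b(2) using cb cS c by (subst finsum_addf) (auto simp: finsum_ldistr)
    also have "\<dots> = (\<Oplus>j\<in>?S. w' j \<otimes> a j \<oplus> t j)"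
    proof (intro finsum_cong' refl)
      fix j assume j: "j \<in> ?S"
      show "w j \<otimes> a j \<oplus> (b j \<otimes> Y j) \<otimes> a ?m = w' j \<otimes> a j \<oplus> t j"
        unfolding w'_def t_def using cS[OF j] cb[OF j] c by algebra
    qed (use cw' ct cS in auto)
    also have "\<dots> = (\<Oplus>j\<in>?S. w' j \<otimes> a j) \<oplus> (\<Oplus>j\<in>?S. t j)"
      using cw' ct cS by (intro finsum_addf) auto
    also have "\<dots> \<in> I2 R l a Y"
      by (intro ideal_rules(4)[OF i2(1) IH(2)] ideal_finsum[OF i2(1)] t)
    finally show ?thesis .
  qed
  ultimately show ?case unfolding S(1) by auto
qed

end

section \<open>Chains of primes adapted to a system of parameters\<close>

definition prime_chain :: "('a, 'r) ring_scheme \<Rightarrow> nat \<Rightarrow> (nat \<Rightarrow> 'a set) \<Rightarrow> bool" where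
  "prime_chain R k Q \<longleftrightarrow> (\<forall>i\<le>k. primeideal (Q i) R) \<and> (\<forall>i<k. Q i \<subset> Q (Suc i))"

lemma prime_chain_shift: "prime_chain R (j + k) Q \<Longrightarrow> prime_chain R k (\<lambda>i. Q (j + i))"
  by (auto simp: prime_chain_def)

lemma prime_chain_primeideal: "prime_chain R k Q \<Longrightarrow> i \<le> k \<Longrightarrow> primeideal (Q i) R"
  and prime_chain_ideal: "prime_chain R k Q \<Longrightarrow> i \<le> k \<Longrightarrow> ideal (Q i) R"
  using primeideal.axioms(1) by (auto simp: prime_chain_def)

lemma prime_chain_strict: "prime_chain R k Q \<Longrightarrow> i < k \<Longrightarrow> Q i \<subset> Q (Suc i)"
  by (simp add: prime_chain_def)

lemma prime_chain_mono: "prime_chain R k Q \<Longrightarrow> i \<le> j \<Longrightarrow> j \<le> k \<Longrightarrow> Q i \<subseteq> Q j"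
proof (induction j)
  case (Suc j)
  then show ?case using prime_chain_strict[of R k Q j] by (cases "i = Suc j") auto
qed simp

text \<open>Each use of \<open>krull_principal_ideal\<close> replaces the member just below one that
  contains \<open>x\<close> by a prime that contains \<open>x\<close> too, and leaves the neighbours
  alone. So \<open>x\<close> descends from the top of the chain to member 1.\<close>

lemma (in noetherian_cring) prime_chain_through:
  assumes "prime_chain R (Suc k) Q" "x \<in> Q (Suc k)"
  shows "\<exists>Q'. prime_chain R (Suc k) Q' \<and> Q' 0 = Q 0 \<and> Q' (Suc k) = Q (Suc k) \<and> x \<in> Q' 1"
  using assms
proof (induction k arbitrary: Q)
  case 0
  then show ?case by auto
next
  case (Suc k)
  have "\<exists>P. primeideal P R \<and> Q k \<subset> P \<and> P \<subset> Q (Suc (Suc k)) \<and> x \<in> P"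
    using Suc.prems by (intro krull_principal_ideal[of _ "Q (Suc k)"]) (auto simp: prime_chain_def)
  then obtain P where P: "primeideal P R" "Q k \<subset> P" "P \<subset> Q (Suc (Suc k))" "x \<in> P" by blast
  have "prime_chain R (Suc k) (Q(Suc k := P))"
    using Suc.prems(1) P by (auto simp: prime_chain_def less_Suc_eq)
  then have "\<exists>Q'. prime_chain R (Suc k) Q' \<and> Q' 0 = (Q(Suc k := P)) 0 \<and>
      Q' (Suc k) = (Q(Suc k := P)) (Suc k) \<and> x \<in> Q' 1"
    using P(4) by (intro Suc.IH; simp only: fun_upd_same)
  then obtain Q' where Q': "prime_chain R (Suc k) Q'" "Q' 0 = Q 0" "Q' (Suc k) = P" "x \<in> Q' 1"
    by auto
  let ?Q = "Q'(Suc (Suc k) := Q (Suc (Suc k)))"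
  have "prime_chain R (Suc (Suc k)) ?Q"
    using Q' P Suc.prems(1) by (auto simp: prime_chain_def less_Suc_eq le_Suc_eq)
  moreover have "?Q 0 = Q 0" "?Q (Suc (Suc k)) = Q (Suc (Suc k))" "x \<in> ?Q 1" using Q' by simp_all
  ultimately show ?case by blast
qed

context noetherian_cring
begin

text \<open>Each generator still missing at the bottom allows at most one step:
  \<open>prime_chain_through\<close> puts \<open>X (Suc m)\<close> into member 1, and the chain from
  there on is shorter by one and starts with one more generator.\<close>

lemma prime_chain_le_generators:
  assumes "X ` {1..l} \<subseteq> carrier R" "Idl (X ` {1..l}) = M" "m \<le> l"
    and "prime_chain R k Q" "Q k = M" "Idl (X ` {m<..l}) \<subseteq> Q 0"
  shows "k \<le> m"
  using assms(3-)
proof (induction m arbitrary: k Q)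
  case 0
  have "{0<..l} = {1..l}" by auto
  then have "M \<subseteq> Q 0" using 0 assms(2) by simp
  show ?case
  proof (rule ccontr)
    assume "\<not> k \<le> 0"
    then have "Q 0 \<subset> Q 1" "Q 1 \<subseteq> Q k" using 0 prime_chain_mono[of R k Q 1 k] by (auto simp: prime_chain_def)
    then show False using \<open>M \<subseteq> Q 0\<close> 0 by auto
  qed
next
  case (Suc m)
  show ?case
  proof (cases k)
    case (Suc k')
    have X: "X ` {1..l} \<subseteq> Idl (X ` {1..l})" using assms(1) by (rule genideal_self)
    then have "X (Suc m) \<in> Q (Suc k')" using Suc.prems \<open>k = Suc k'\<close> assms(2) by auto
    then obtain Q' where Q': "prime_chain R (Suc k') Q'" "Q' 0 = Q 0" "Q' (Suc k') = M" "X (Suc m) \<in> Q' 1"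
      using prime_chain_through[of k' Q "X (Suc m)"] Suc.prems \<open>k = Suc k'\<close> by auto
    have p1: "ideal (Q' 1) R" "Q' 0 \<subseteq> Q' 1"
      using prime_chain_ideal[OF Q'(1), of 1] prime_chain_mono[OF Q'(1), of 0 1] by auto
    have "Idl (X ` {m<..l}) \<subseteq> Q' 1"
      unfolding Idl_tail_Suc[OF Suc.prems(1) assms(1)] 
      using p1 Q'(2,4) Suc.prems(4) by (intro add_cgenideal_least) auto
    then have "k' \<le> m"
      using Suc.IH[of k' "\<lambda>i. Q' (1 + i)"] prime_chain_shift[of R 1 k' Q'] Q' Suc.prems(1) by auto
    then show ?thesis using \<open>k = Suc k'\<close> by simp
  qed simp
qed

text \<open>Generators enter from the last one on, each of them by
  \<open>prime_chain_through\<close> applied to the part of the chain that is not yet adapted. In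
  the end member \<open>i\<close> contains the last \<open>i\<close> generators.\<close>

lemma prime_chain_adapted:
  assumes "X ` {1..l} \<subseteq> carrier R" "Idl (X ` {1..l}) = M" "prime_chain R l Q" "Q l = M" "j \<le> l"
  shows "\<exists>Q. prime_chain R l Q \<and> Q l = M \<and> (\<forall>i\<le>j. Idl (X ` {l - i<..l}) \<subseteq> Q i)"
  using assms(5)
proof (induction j)
  case 0
  have "ideal (Q 0) R" using prime_chain_ideal[OF assms(3)] by simp
  then have "Idl (X ` {l<..l}) \<subseteq> Q 0" by (intro genideal_minimal) auto
  then show ?case using assms by auto
next
  case (Suc j)
  then obtain Q where Q: "prime_chain R l Q" "Q l = M" "\<And>i. i \<le> j \<Longrightarrow> Idl (X ` {l - i<..l}) \<subseteq> Q i"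
    by auto
  define k where "k = l - Suc j"
  have l: "l = j + Suc k" using Suc.prems by (simp add: k_def)
  have X: "X ` {1..l} \<subseteq> Idl (X ` {1..l})" using assms(1) by (rule genideal_self)
  have "X (Suc k) \<in> Q (j + Suc k)" using X assms(2) Q(2) l by auto
  then obtain Q' where Q': "prime_chain R (Suc k) Q'" "Q' 0 = Q j" "Q' (Suc k) = M" "X (Suc k) \<in> Q' 1"
    using prime_chain_through[of k "\<lambda>i. Q (j + i)" "X (Suc k)"] prime_chain_shift[of R j "Suc k" Q] Q l
    by auto
  \<comment> \<open>The adapted lower part is kept. \<open>Q'\<close> is indexed from member
    \<open>j\<close> on, and \<open>Q' 0 = Q j\<close> makes the two parts fit.\<close>
  define Q'' where "Q'' i = (if i \<le> j then Q i else Q' (i - j))" for i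
  have "prime_chain R l Q''" unfolding prime_chain_def
  proof (intro conjI allI impI)
    fix i assume "i \<le> l"
    then show "primeideal (Q'' i) R" using Q(1) Q'(1) l by (auto simp: Q''_def prime_chain_def)
  next
    fix i assume i: "i < l"
    consider "i < j" | "i = j" | "i > j" by linarith
    then show "Q'' i \<subset> Q'' (Suc i)"
    proof cases
      case 1 then show ?thesis using Q(1) i by (auto simp: Q''_def prime_chain_def)
    next
      case 2
      have "Q' 0 \<subset> Q' (Suc 0)" using Q'(1) unfolding prime_chain_def by blast
      then show ?thesis using Q'(2) 2 by (simp add: Q''_def)
    next
      case 3
      then have "Q' (i - j) \<subset> Q' (Suc (i - j))" using Q'(1) i l unfolding prime_chain_def by auto
      then show ?thesis using 3 by (simp add: Q''_def Suc_diff_le)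
    qed
  qed
  moreover have "Q'' l = M" using Q'(3) l by (simp add: Q''_def)
  moreover have "Idl (X ` {l - i<..l}) \<subseteq> Q'' i" if "i \<le> Suc j" for i
  proof (cases "i = Suc j")
    case True
    have p1: "ideal (Q' 1) R" "Q' 0 \<subseteq> Q' 1"
      using prime_chain_ideal[OF Q'(1), of 1] prime_chain_mono[OF Q'(1), of 0 1] by auto
    have "Idl (X ` {Suc k<..l}) \<subseteq> Q' 0" using Q(3)[of j] Q'(2) l by simp
    moreover have "Idl (X ` {k<..l}) = Idl (X ` {Suc k<..l}) <+>\<^bsub>R\<^esub> PIdl (X (Suc k))"
      using l by (intro Idl_tail_Suc[OF _ assms(1)]) simp
    ultimately have "Idl (X ` {k<..l}) \<subseteq> Q' 1"
      using add_cgenideal_least[OF p1(1) _ Q'(4), of "Idl (X ` {Suc k<..l})"] p1(2) by auto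
    then show ?thesis using True l by (simp add: Q''_def)
  qed (use that Q(3) in \<open>auto simp: Q''_def\<close>)
  ultimately show ?case by blast
qed

text \<open>The members of a chain of primes adapted to the generators are generated by them, by
  Nakayama's lemma.\<close>

lemma regular_parameters_prime:
  assumes "X ` {1..l} \<subseteq> carrier R" "Idl (X ` {1..l}) = M" "prime_chain R l Q" "Q l = M"
    and local: "carrier R - M \<subseteq> Units R" and m: "m \<le> l"
  shows "primeideal (Idl (X ` {m<..l})) R" "1 \<le> m \<Longrightarrow> X m \<notin> Idl (X ` {m<..l})"
proof -
  obtain Q where Q: "prime_chain R l Q" "Q l = M" "\<And>i. i \<le> l \<Longrightarrow> Idl (X ` {l - i<..l}) \<subseteq> Q i"
    using prime_chain_adapted[OF assms(1-4) order_refl] by auto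
  have pM: "primeideal M R" using Q by (auto simp: prime_chain_def)
  have Xc: "X (Suc m) \<in> carrier R" if "Suc m \<le> l" for m using assms(1) that by auto
  \<comment> \<open>Otherwise the chain of length \<open>Suc m\<close> from this member up to
    \<open>M\<close> would start above all generators but the first \<open>m\<close>, against the
    bound of \<open>prime_chain_le_generators\<close>.\<close>
  have X: "X (Suc m) \<notin> Q (l - Suc m)" if m: "Suc m \<le> l" for m
  proof
    assume *: "X (Suc m) \<in> Q (l - Suc m)"
    have p: "ideal (Q (l - Suc m)) R" using prime_chain_ideal[OF Q(1)] by simp
    have "Idl (X ` {m<..l}) \<subseteq> Q (l - Suc m)"
      unfolding Idl_tail_Suc[OF m assms(1)] using * Q(3)[of "l - Suc m"] m
      by (intro add_cgenideal_least[OF p]) auto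
    then have "Suc m \<le> m"
      using prime_chain_le_generators[OF assms(1,2), of m "Suc m" "\<lambda>i. Q (l - Suc m + i)"]
        prime_chain_shift[of R "l - Suc m" "Suc m" Q] Q m by auto
    then show False by simp
  qed
  have eq: "Q (l - m) = Idl (X ` {m<..l})" if "m \<le> l" for m
    using that
  proof (induction m)
    case 0
    have "{0<..l} = {1..l}" by auto
    then show ?case using Q(2) assms(2) by simp
  next
    case (Suc m)
    let ?C = "Idl (X ` {Suc m<..l})" and ?N = "Q (l - Suc m)"
    have pN: "primeideal ?N R" using Q(1) by (auto simp: prime_chain_def)
    note N = ideal_rules[OF primeideal.axioms(1)[OF pN]]
    have C: "ideal ?C R" using ideal_Idl_tail[OF assms(1)] .
    have sat: "sat_ideal M ?C" by (rule sat_ideal_local[OF local C])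
    have CN: "?C \<subseteq> ?N" using Q(3)[of "l - Suc m"] Suc.prems by auto
    have "?N \<subseteq> ?C"
    proof (rule local_nakayama[OF pM sat primeideal.axioms(1)[OF pN]])
      fix D a assume D: "sat_ideal M D" "?C \<subseteq> D"
        and MN: "\<And>p b. p \<in> M \<Longrightarrow> b \<in> ?N \<Longrightarrow> p \<otimes> b \<in> D" and a: "a \<in> ?N"
      have Di: "ideal D R" using D by (auto simp: sat_ideal_def)
      \<comment> \<open>By induction the next larger prime is \<open>?C\<close> together with
        \<open>X (Suc m)\<close>. The coefficient \<open>r\<close> of \<open>X (Suc m)\<close> in an
        element of the prime \<open>?N\<close> lies in \<open>?N\<close>, because
        \<open>X (Suc m)\<close> does not. So \<open>?N\<close> is contained in
        \<open>?C + M ?N\<close>.\<close>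
      have "?N \<subseteq> Q (l - m)" using prime_chain_mono[OF Q(1)] Suc.prems by auto
      then have "a \<in> ?C <+>\<^bsub>R\<^esub> PIdl (X (Suc m))"
        using a Suc Idl_tail_Suc[OF Suc.prems assms(1)] by auto
      then obtain c r where *: "c \<in> ?C" "r \<in> carrier R" "a = c \<oplus> r \<otimes> X (Suc m)"
        by (auto simp: mem_add_cgenideal)
      have "r \<otimes> X (Suc m) \<in> ?N"
        using ideal_add_cancel[OF primeideal.axioms(1)[OF pN], of c "r \<otimes> X (Suc m)"] * CN a
          Xc[OF Suc.prems] by auto
      then have "r \<in> ?N"
        using primeideal.I_prime[OF pN *(2) Xc[OF Suc.prems]] X[OF Suc.prems] by auto
      moreover have "X (Suc m) \<in> M" using genideal_self[OF assms(1)] assms(2) Suc.prems by auto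
      ultimately have "r \<otimes> X (Suc m) \<in> D" using MN Xc[OF Suc.prems] *(2) by (metis m_comm)
      then have "a \<in> D" using * D(2) ideal_rules(4)[OF Di] by auto
      then show "\<exists>s\<in>carrier R - M. s \<otimes> a \<in> D" using prime_compl_one[OF pM] N(3)[OF a] 
        by (intro bexI[of _ \<one>]) auto
    qed
    then show ?case using CN by auto
  qed
  show "primeideal (Idl (X ` {m<..l})) R" using eq[OF m] Q(1) m by (metis prime_chain_def diff_le_self)
  show "X m \<notin> Idl (X ` {m<..l})" if "1 \<le> m"
    using X[of "m - 1"] eq[OF m] m that by auto
qed

end

section \<open>Modules\<close>

text \<open>Stated for additive maps of abelian groups, so that inclusions of submodules, coordinate
  projections, passage to cosets and scalar action on a fixed element are all instances.\<close>

lemma finsum_hom: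
  assumes M: "abelian_group M" and N: "abelian_group N"
    and h: "h \<in> carrier M \<rightarrow> carrier N"
    "\<And>x y. x \<in> carrier M \<Longrightarrow> y \<in> carrier M \<Longrightarrow> h (x \<oplus>\<^bsub>M\<^esub> y) = h x \<oplus>\<^bsub>N\<^esub> h y"
    and u: "u \<in> S \<rightarrow> carrier M"
  shows "h (finsum M u S) = finsum N (\<lambda>s. h (u s)) S"
proof -
  interpret M: abelian_group M by fact
  interpret N: abelian_group N by fact
  have c: "h x \<in> carrier N" if "x \<in> carrier M" for x using h(1) that by auto
  have "h \<zero>\<^bsub>M\<^esub> \<oplus>\<^bsub>N\<^esub> h \<zero>\<^bsub>M\<^esub> = h \<zero>\<^bsub>M\<^esub>" using h(2)[of "\<zero>\<^bsub>M\<^esub>" "\<zero>\<^bsub>M\<^esub>"] by simp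
  then have h0: "h \<zero>\<^bsub>M\<^esub> = \<zero>\<^bsub>N\<^esub>" using c[of "\<zero>\<^bsub>M\<^esub>"] by (metis M.zero_closed N.add.r_cancel_one')
  show ?thesis using u
  proof (induction S rule: infinite_finite_induct)
    case (insert s S)
    then have "u s \<in> carrier M" "u \<in> S \<rightarrow> carrier M" by auto
    then show ?case using insert c h(2)
      by (subst M.finsum_insert, simp_all) (subst N.finsum_insert, auto)
  qed (auto simp: h0)
qed

context module
begin

lemma submodule_rules:
  assumes "submodule N R M"
  shows "N \<subseteq> carrier M" "\<zero>\<^bsub>M\<^esub> \<in> N"
    and "\<And>a. a \<in> N \<Longrightarrow> a \<in> carrier M"
    and "\<And>a b. a \<in> N \<Longrightarrow> b \<in> N \<Longrightarrow> a \<oplus>\<^bsub>M\<^esub> b \<in> N"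
    and "\<And>a. a \<in> N \<Longrightarrow> \<ominus>\<^bsub>M\<^esub> a \<in> N"
    and "\<And>a b. a \<in> N \<Longrightarrow> b \<in> N \<Longrightarrow> a \<ominus>\<^bsub>M\<^esub> b \<in> N"
    and "\<And>a r. a \<in> N \<Longrightarrow> r \<in> carrier R \<Longrightarrow> r \<odot>\<^bsub>M\<^esub> a \<in> N"
  using submoduleE[OF assms] subgroup.one_closed[OF submodule.axioms(1)[OF assms]]
  by (auto simp: M.minus_eq)

lemma submoduleI':
  assumes "N \<subseteq> carrier M" "\<zero>\<^bsub>M\<^esub> \<in> N" "\<And>a b. a \<in> N \<Longrightarrow> b \<in> N \<Longrightarrow> a \<oplus>\<^bsub>M\<^esub> b \<in> N"
    and "\<And>a r. a \<in> N \<Longrightarrow> r \<in> carrier R \<Longrightarrow> r \<odot>\<^bsub>M\<^esub> a \<in> N"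
  shows "submodule N R M"
proof (rule submoduleI)
  fix a assume a: "a \<in> N"
  then have "\<ominus>\<^bsub>M\<^esub> a = (\<ominus> \<one>) \<odot>\<^bsub>M\<^esub> a" using assms(1) by (auto simp: smult_l_minus)
  then show "\<ominus>\<^bsub>M\<^esub> a \<in> N" using assms(4)[OF a, of "\<ominus> \<one>"] by simp
qed (use assms in auto)

lemma submodule_add_cancel:
  assumes "submodule N R M" "a \<in> N" "b \<in> carrier M" "a \<oplus>\<^bsub>M\<^esub> b \<in> N"
  shows "b \<in> N"
proof -
  note a = submodule_rules(3)[OF assms(1,2)]
  have "(a \<oplus>\<^bsub>M\<^esub> b) \<ominus>\<^bsub>M\<^esub> a = (b \<oplus>\<^bsub>M\<^esub> a) \<ominus>\<^bsub>M\<^esub> a" using a assms(3) by (simp add: M.a_comm)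
  also have "\<dots> = b" using a assms(3) by (simp add: M.minus_eq M.a_assoc M.r_neg)
  finally show ?thesis using submodule_rules(6)[OF assms(1) assms(4,2)] by simp
qed

lemma submodule_finsum:
  assumes "submodule N R M" "\<And>s. s \<in> S \<Longrightarrow> u s \<in> N"
  shows "(\<Oplus>\<^bsub>M\<^esub>s\<in>S. u s) \<in> N"
  using assms(2)
proof (induction S rule: infinite_finite_induct)
  case (insert s S)
  then have "u \<in> S \<rightarrow> carrier M" "u s \<in> carrier M" using submodule_rules(3)[OF assms(1)] by auto
  then show ?case using insert submodule_rules(4)[OF assms(1)] by simp
qed (use submodule_rules(2)[OF assms(1)] in \<open>auto simp: M.finsum_infinite\<close>)

text \<open>Adjoining one element at a time builds the short chains of submodules that are later
  tested against the length of \<open>Ext\<close>.\<close>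

lemma submodule_add_multiples:
  assumes "submodule N R M" "z \<in> carrier M"
  shows "submodule {a \<oplus>\<^bsub>M\<^esub> r \<odot>\<^bsub>M\<^esub> z | a r. a \<in> N \<and> r \<in> carrier R} R M" (is "submodule ?H R M")
    and "N \<subseteq> {a \<oplus>\<^bsub>M\<^esub> r \<odot>\<^bsub>M\<^esub> z | a r. a \<in> N \<and> r \<in> carrier R}"
    and "z \<in> {a \<oplus>\<^bsub>M\<^esub> r \<odot>\<^bsub>M\<^esub> z | a r. a \<in> N \<and> r \<in> carrier R}"
proof -
  note N = submodule_rules[OF assms(1)]
  show sub: "N \<subseteq> ?H"
  proof
    fix a assume "a \<in> N"
    then have "a = a \<oplus>\<^bsub>M\<^esub> \<zero> \<odot>\<^bsub>M\<^esub> z" using assms N by auto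
    then show "a \<in> ?H" using \<open>a \<in> N\<close> by blast
  qed
  have "z = \<zero>\<^bsub>M\<^esub> \<oplus>\<^bsub>M\<^esub> \<one> \<odot>\<^bsub>M\<^esub> z" using assms by simp
  then show "z \<in> ?H" using N(2) by blast
  show "submodule ?H R M"
  proof (rule submoduleI')
    show "?H \<subseteq> carrier M" using N assms by auto
    show "\<zero>\<^bsub>M\<^esub> \<in> ?H" using sub N by auto
  next
    fix p q assume "p \<in> ?H" "q \<in> ?H"
    then obtain a r b s where *: "a \<in> N" "r \<in> carrier R" "p = a \<oplus>\<^bsub>M\<^esub> r \<odot>\<^bsub>M\<^esub> z"
      "b \<in> N" "s \<in> carrier R" "q = b \<oplus>\<^bsub>M\<^esub> s \<odot>\<^bsub>M\<^esub> z" by blast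
    then have "p \<oplus>\<^bsub>M\<^esub> q = (a \<oplus>\<^bsub>M\<^esub> b) \<oplus>\<^bsub>M\<^esub> (r \<oplus> s) \<odot>\<^bsub>M\<^esub> z"
      using N(3)[of a] N(3)[of b] assms by (simp add: smult_l_distr M.a_ac)
    then show "p \<oplus>\<^bsub>M\<^esub> q \<in> ?H" using * N(4) by blast
  next
    fix p t assume "p \<in> ?H" and t: "t \<in> carrier R"
    then obtain a r where *: "a \<in> N" "r \<in> carrier R" "p = a \<oplus>\<^bsub>M\<^esub> r \<odot>\<^bsub>M\<^esub> z" by blast
    then have "t \<odot>\<^bsub>M\<^esub> p = t \<odot>\<^bsub>M\<^esub> a \<oplus>\<^bsub>M\<^esub> (t \<otimes> r) \<odot>\<^bsub>M\<^esub> z"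
      using t N(3)[of a] assms by (simp add: smult_r_distr smult_assoc1)
    then show "t \<odot>\<^bsub>M\<^esub> p \<in> ?H" using * t N(7) by blast
  qed
qed

end

lemma mod_span_submodule:
  assumes "module R M" "S \<subseteq> carrier M"
  shows "submodule (mod_span R M S) R M" "S \<subseteq> mod_span R M S"
proof -
  interpret module R M by fact
  have "submodule (carrier M) R M" by (rule carrier_is_submodule)
  then have c: "mod_span R M S \<subseteq> carrier M" using assms(2) by (auto simp: mod_span_def)
  show "S \<subseteq> mod_span R M S" by (auto simp: mod_span_def)
  show "submodule (mod_span R M S) R M"
    using c by (intro submoduleI') (auto simp: mod_span_def dest: submodule_rules)
qed

lemma mod_span_least: "submodule N R M \<Longrightarrow> S \<subseteq> N \<Longrightarrow> mod_span R M S \<subseteq> N"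
  by (auto simp: mod_span_def)

lemma restrict_mod_simps [simp]:
  "carrier (restrict_mod M N) = N" "add (restrict_mod M N) = add M" "zero (restrict_mod M N) = zero M"
  "smult (restrict_mod M N) = smult M"
  by (auto simp: restrict_mod_def)

lemma module_restrict_mod:
  assumes "module R M" "submodule N R M"
  shows "module R (restrict_mod M N)"
  unfolding restrict_mod_def using submodule.submodule_is_module[OF assms(2,1)] .

lemma submodule_restrict_mod:
  assumes "module R M" "submodule N R M" "H \<subseteq> N"
  shows "submodule H R (restrict_mod M N) \<longleftrightarrow> submodule H R M"
proof -
  interpret M: module R M by fact
  interpret N: module R "restrict_mod M N" by (rule module_restrict_mod[OF assms(1,2)])
  show ?thesis
  proof
    assume "submodule H R (restrict_mod M N)"
    note * = N.submodule_rules[OF this]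
    show "submodule H R M" using * assms(3) M.submodule_rules[OF assms(2)] by (intro M.submoduleI') auto
  next
    assume "submodule H R M"
    note * = M.submodule_rules[OF this]
    show "submodule H R (restrict_mod M N)" using * assms(3) by (intro N.submoduleI') auto
  qed
qed

lemma finsum_restrict_mod:
  assumes "module R M" "submodule N R M" "u \<in> S \<rightarrow> N"
  shows "finsum (restrict_mod M N) u S = finsum M u S"
proof -
  interpret M: module R M by fact
  interpret N: module R "restrict_mod M N" by (rule module_restrict_mod[OF assms(1,2)])
  have "(\<lambda>x. x) (finsum (restrict_mod M N) u S) = finsum M (\<lambda>s. (\<lambda>x. x) (u s)) S"
    using assms M.submodule_rules(3)[OF assms(2)]
    by (intro finsum_hom N.abelian_group_axioms M.abelian_group_axioms) auto
  then show ?thesis by simp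
qed

text \<open>\<open>mod_quot\<close> is only defined on the unextended record type of modules.\<close>

locale plain_module = module R M for R (structure) and M :: "('a, 'b) module"


section \<open>Quotient modules and chains that compute their length\<close>

context plain_module
begin

lemma abelian_subgroup_submodule: "submodule N R M \<Longrightarrow> abelian_subgroup N M"
  using abelian_subgroupI3[of N M] submodule.axioms(1)[of N R M] M.abelian_group_axioms
  by (auto simp: additive_subgroup_def)

lemma mod_coset_eq_iff:
  assumes "submodule N R M" "z \<in> carrier M" "z' \<in> carrier M"
  shows "N +>\<^bsub>M\<^esub> z = N +>\<^bsub>M\<^esub> z' \<longleftrightarrow> z \<ominus>\<^bsub>M\<^esub> z' \<in> N"
proof -
  interpret N: abelian_subgroup N M by (rule abelian_subgroup_submodule[OF assms(1)])
  have "z \<ominus>\<^bsub>M\<^esub> z' \<in> N \<longleftrightarrow> z \<in> N +>\<^bsub>M\<^esub> z'"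
    using N.a_rcos_module[of z' z] assms by (simp add: M.minus_eq)
  also have "\<dots> \<longleftrightarrow> N +>\<^bsub>M\<^esub> z = N +>\<^bsub>M\<^esub> z'"
    using N.a_repr_independence'[of z z'] N.a_rcos_self[of z] assms by metis
  finally show ?thesis by blast
qed

lemma mod_coset_eq_zero_iff:
  assumes "submodule N R M" "z \<in> carrier M"
  shows "N +>\<^bsub>M\<^esub> z = N \<longleftrightarrow> z \<in> N"
proof -
  interpret N: abelian_subgroup N M by (rule abelian_subgroup_submodule[OF assms(1)])
  have "N +>\<^bsub>M\<^esub> \<zero>\<^bsub>M\<^esub> = N" using N.a_subset by simp
  moreover have "N +>\<^bsub>M\<^esub> \<zero>\<^bsub>M\<^esub> = N +>\<^bsub>M\<^esub> z \<longleftrightarrow> \<ominus>\<^bsub>M\<^esub> z \<in> N"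
    using mod_coset_eq_iff[OF assms(1) M.zero_closed assms(2)] assms(2) by (simp add: M.minus_eq)
  moreover have "\<ominus>\<^bsub>M\<^esub> z \<in> N \<longleftrightarrow> z \<in> N"
    using submodule_rules(5)[OF assms(1)] assms(2) by (metis M.minus_minus)
  ultimately show ?thesis by metis
qed

text \<open>The scalar action of \<open>mod_quot\<close> is a union over all representatives of a
  coset. Two representatives differ by an element of \<open>N\<close>, so the union collapses to a
  single coset.\<close>

lemma mod_quot_simps:
  assumes "submodule N R M"
  shows "carrier (mod_quot M N) = (\<lambda>z. N +>\<^bsub>M\<^esub> z) ` carrier M" "zero (mod_quot M N) = N"
    and "z \<in> carrier M \<Longrightarrow> z' \<in> carrier M \<Longrightarrow>
      (N +>\<^bsub>M\<^esub> z) \<oplus>\<^bsub>mod_quot M N\<^esub> (N +>\<^bsub>M\<^esub> z') = N +>\<^bsub>M\<^esub> (z \<oplus>\<^bsub>M\<^esub> z')"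
    and "r \<in> carrier R \<Longrightarrow> z \<in> carrier M \<Longrightarrow>
      r \<odot>\<^bsub>mod_quot M N\<^esub> (N +>\<^bsub>M\<^esub> z) = N +>\<^bsub>M\<^esub> (r \<odot>\<^bsub>M\<^esub> z)"
proof -
  interpret N: abelian_subgroup N M by (rule abelian_subgroup_submodule[OF assms])
  note N = submodule_rules[OF assms]
  show "carrier (mod_quot M N) = (\<lambda>z. N +>\<^bsub>M\<^esub> z) ` carrier M" "zero (mod_quot M N) = N"
    by (auto simp: mod_quot_def A_RCOSETS_def')
  show "z \<in> carrier M \<Longrightarrow> z' \<in> carrier M \<Longrightarrow>
      (N +>\<^bsub>M\<^esub> z) \<oplus>\<^bsub>mod_quot M N\<^esub> (N +>\<^bsub>M\<^esub> z') = N +>\<^bsub>M\<^esub> (z \<oplus>\<^bsub>M\<^esub> z')"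
    by (simp add: mod_quot_def N.a_rcos_sum)
  assume r: "r \<in> carrier R" and z: "z \<in> carrier M"
  have *: "N +>\<^bsub>M\<^esub> (r \<odot>\<^bsub>M\<^esub> y) = N +>\<^bsub>M\<^esub> (r \<odot>\<^bsub>M\<^esub> z)" if y: "y \<in> N +>\<^bsub>M\<^esub> z" for y
  proof -
    obtain a where a: "a \<in> N" "y = a \<oplus>\<^bsub>M\<^esub> z" using y by (auto simp: a_r_coset_def')
    have ac: "a \<in> carrier M" using N a by auto
    have "r \<odot>\<^bsub>M\<^esub> y \<ominus>\<^bsub>M\<^esub> r \<odot>\<^bsub>M\<^esub> z = r \<odot>\<^bsub>M\<^esub> a"
      unfolding a(2) using r z ac by (simp add: smult_r_distr M.minus_eq M.a_assoc M.r_neg)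
    then show ?thesis using mod_coset_eq_iff[OF assms] r z ac a N(7) by simp
  qed
  have "z \<in> N +>\<^bsub>M\<^esub> z" using N.a_rcos_self z by blast
  then have "(\<Union>y\<in>N +>\<^bsub>M\<^esub> z. N +>\<^bsub>M\<^esub> (r \<odot>\<^bsub>M\<^esub> y)) = N +>\<^bsub>M\<^esub> (r \<odot>\<^bsub>M\<^esub> z)" using * by blast
  then show "r \<odot>\<^bsub>mod_quot M N\<^esub> (N +>\<^bsub>M\<^esub> z) = N +>\<^bsub>M\<^esub> (r \<odot>\<^bsub>M\<^esub> z)"
    by (simp add: mod_quot_def)
qed

lemma module_mod_quot:
  assumes "submodule N R M"
  shows "module R (mod_quot M N)"
proof -
  note Q = mod_quot_simps[OF assms]
  have z: "zero (mod_quot M N) = N +>\<^bsub>M\<^esub> \<zero>\<^bsub>M\<^esub>"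
    using Q(2) mod_coset_eq_zero_iff[OF assms M.zero_closed] submodule_rules(2)[OF assms] by simp
  have "abelian_group (mod_quot M N)"
  proof (rule abelian_groupI)
    fix C assume "C \<in> carrier (mod_quot M N)"
    then obtain c where c: "c \<in> carrier M" "C = N +>\<^bsub>M\<^esub> c" using Q(1) by auto
    show "\<exists>D\<in>carrier (mod_quot M N). D \<oplus>\<^bsub>mod_quot M N\<^esub> C = \<zero>\<^bsub>mod_quot M N\<^esub>"
      unfolding z c(2) using c(1) by (intro bexI[of _ "N +>\<^bsub>M\<^esub> (\<ominus>\<^bsub>M\<^esub> c)"]) (auto simp: Q(1,3) M.l_neg)
  next
    show "\<zero>\<^bsub>mod_quot M N\<^esub> \<in> carrier (mod_quot M N)" unfolding z Q(1) by blast
    show "\<zero>\<^bsub>mod_quot M N\<^esub> \<oplus>\<^bsub>mod_quot M N\<^esub> C = C" if "C \<in> carrier (mod_quot M N)" for C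
      using that unfolding z Q(1) by (auto simp: Q(3))
  qed (auto simp: Q(1,3) M.a_ac)
  then show ?thesis
  proof (rule moduleI[OF R.is_cring])
  qed (auto simp: Q(1,3,4) smult_l_distr smult_r_distr smult_assoc1)
qed

lemma submodule_mod_quot_image:
  assumes N: "submodule N R M" and H: "submodule H R M"
  shows "submodule ((\<lambda>z. N +>\<^bsub>M\<^esub> z) ` H) R (mod_quot M N)"
proof -
  interpret Q: module R "mod_quot M N" by (rule module_mod_quot[OF N])
  note Q = mod_quot_simps[OF N] and H = submodule_rules[OF H]
  have "N +>\<^bsub>M\<^esub> \<zero>\<^bsub>M\<^esub> = N" using mod_coset_eq_zero_iff[OF N] submodule_rules(2)[OF N] by simp
  then have "\<zero>\<^bsub>mod_quot M N\<^esub> \<in> (\<lambda>z. N +>\<^bsub>M\<^esub> z) ` H" using H(2) Q(2) by (metis imageI)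
  then show ?thesis
  proof (rule Q.submoduleI'[rotated])
    show "(\<lambda>z. N +>\<^bsub>M\<^esub> z) ` H \<subseteq> carrier (mod_quot M N)" unfolding Q(1) using H(1) by blast
    show "C \<oplus>\<^bsub>mod_quot M N\<^esub> D \<in> (\<lambda>z. N +>\<^bsub>M\<^esub> z) ` H"
      if "C \<in> (\<lambda>z. N +>\<^bsub>M\<^esub> z) ` H" "D \<in> (\<lambda>z. N +>\<^bsub>M\<^esub> z) ` H" for C D
      using that H(3,4) by (auto simp: Q(3))
    show "r \<odot>\<^bsub>mod_quot M N\<^esub> C \<in> (\<lambda>z. N +>\<^bsub>M\<^esub> z) ` H"
      if "C \<in> (\<lambda>z. N +>\<^bsub>M\<^esub> z) ` H" "r \<in> carrier R" for C r
      using that H(3,7) by (auto simp: Q(4))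
  qed
qed

lemma submodule_mod_quot_vimage:
  assumes N: "submodule N R M" and H: "submodule H R (mod_quot M N)"
  shows "submodule {z \<in> carrier M. N +>\<^bsub>M\<^esub> z \<in> H} R M" "N \<subseteq> {z \<in> carrier M. N +>\<^bsub>M\<^esub> z \<in> H}"
proof -
  interpret Q: module R "mod_quot M N" by (rule module_mod_quot[OF N])
  note Q = mod_quot_simps[OF N] and H = Q.submodule_rules[OF H] and N' = submodule_rules[OF N]
  show sub: "N \<subseteq> {z \<in> carrier M. N +>\<^bsub>M\<^esub> z \<in> H}"
  proof
    fix x assume x: "x \<in> N"
    then have "N +>\<^bsub>M\<^esub> x = N" using mod_coset_eq_zero_iff[OF N N'(3)] by simp
    then show "x \<in> {z \<in> carrier M. N +>\<^bsub>M\<^esub> z \<in> H}" using H(2) N'(3)[OF x] unfolding Q(2) by simp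
  qed
  show "submodule {z \<in> carrier M. N +>\<^bsub>M\<^esub> z \<in> H} R M"
  proof (rule submoduleI')
    show "\<zero>\<^bsub>M\<^esub> \<in> {z \<in> carrier M. N +>\<^bsub>M\<^esub> z \<in> H}" using sub N'(2) by auto
    show "a \<oplus>\<^bsub>M\<^esub> b \<in> {z \<in> carrier M. N +>\<^bsub>M\<^esub> z \<in> H}"
      if "a \<in> {z \<in> carrier M. N +>\<^bsub>M\<^esub> z \<in> H}" "b \<in> {z \<in> carrier M. N +>\<^bsub>M\<^esub> z \<in> H}" for a b
      using that H(4)[of "N +>\<^bsub>M\<^esub> a" "N +>\<^bsub>M\<^esub> b"] by (simp add: Q(3))
    show "r \<odot>\<^bsub>M\<^esub> a \<in> {z \<in> carrier M. N +>\<^bsub>M\<^esub> z \<in> H}"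
      if "a \<in> {z \<in> carrier M. N +>\<^bsub>M\<^esub> z \<in> H}" "r \<in> carrier R" for a r
      using that H(7)[of "N +>\<^bsub>M\<^esub> a" r] by (simp add: Q(4))
  qed auto
qed

text \<open>Strict inclusions stay strict in the quotient because every member of the chain contains
  \<open>N\<close>.\<close>

lemma mod_length_quot_ge:
  assumes N: "submodule N R M"
    and H: "\<And>i. i \<le> k \<Longrightarrow> submodule (H i) R M" "\<And>i. i \<le> k \<Longrightarrow> N \<subseteq> H i" "\<And>i. i < k \<Longrightarrow> H i \<subset> H (Suc i)"
  shows "enat k \<le> mod_length R (mod_quot M N)"
proof -
  have "(\<lambda>z. N +>\<^bsub>M\<^esub> z) ` H i \<subset> (\<lambda>z. N +>\<^bsub>M\<^esub> z) ` H (Suc i)" if i: "i < k" for i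
  proof -
    obtain z where z: "z \<in> H (Suc i)" "z \<notin> H i" using H(3)[OF i] by auto
    have s: "submodule (H i) R M" "submodule (H (Suc i)) R M" using H(1) i by auto
    have zc: "z \<in> carrier M" using submodule_rules(3)[OF s(2) z(1)] .
    have "N +>\<^bsub>M\<^esub> z \<noteq> N +>\<^bsub>M\<^esub> y" if y: "y \<in> H i" for y
    proof
      assume eq: "N +>\<^bsub>M\<^esub> z = N +>\<^bsub>M\<^esub> y"
      have yc: "y \<in> carrier M" using submodule_rules(3)[OF s(1) y] .
      have "z \<ominus>\<^bsub>M\<^esub> y \<in> H i" using eq mod_coset_eq_iff[OF N zc yc] H(2)[of i] i by auto
      then have "(z \<ominus>\<^bsub>M\<^esub> y) \<oplus>\<^bsub>M\<^esub> y \<in> H i" using submodule_rules(4)[OF s(1)] y by auto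
      moreover have "(z \<ominus>\<^bsub>M\<^esub> y) \<oplus>\<^bsub>M\<^esub> y = z" using zc yc by (simp add: M.minus_eq M.a_assoc M.l_neg)
      ultimately show False using z by simp
    qed
    then have "N +>\<^bsub>M\<^esub> z \<notin> (\<lambda>z. N +>\<^bsub>M\<^esub> z) ` H i" by blast
    then show ?thesis using z H(3)[OF i] by auto
  qed
  then show ?thesis unfolding mod_length_def
    using submodule_mod_quot_image[OF N H(1)]
    by (intro Sup_upper CollectI exI[of _ k] exI[of _ "\<lambda>i. (\<lambda>z. N +>\<^bsub>M\<^esub> z) ` H i"]) auto
qed

end

text \<open>An infinite set of naturals has supremum \<infinity>, so a finite supremum is a maximum.
  \<open>P 0\<close> excludes the empty set, whose supremum is finite but not attained. Both lengths
  and Krull dimensions are read off in this way.\<close>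

lemma Sup_enat_attained:
  assumes "Sup {enat k | k. P k} = enat n" "P 0"
  shows "P n" "\<And>k. P k \<Longrightarrow> k \<le> n"
proof -
  let ?A = "{enat k | k. P k}"
  have ne: "?A \<noteq> {}" using assms(2) by auto
  have fin: "finite ?A"
  proof (rule ccontr)
    assume "infinite ?A"
    then have "Sup ?A = \<infinity>" using ne by (simp add: Sup_enat_def)
    then show False using assms(1) by simp
  qed
  have "Max ?A = enat n"
    using assms(1) unfolding Sup_enat_def if_not_P[OF ne] if_P[OF fin] .
  then have "enat n \<in> ?A" using Max_in[OF fin ne] by simp
  then show "P n" by auto
  fix k assume "P k"
  then have "enat k \<le> Sup ?A" by (intro Sup_upper) auto
  then show "k \<le> n" unfolding assms(1) by simp
qed

context plain_module
begin

text \<open>A finite length is attained, so the quotient has a chain with exactly \<open>n\<close>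
  strict steps, and the preimages of its members keep the steps strict.\<close>

lemma mod_length_quot_chain:
  assumes N: "submodule N R M" and len: "mod_length R (mod_quot M N) = enat n"
  obtains H where "\<And>i. i \<le> n \<Longrightarrow> submodule (H i) R M" "\<And>i. i \<le> n \<Longrightarrow> N \<subseteq> H i"
    "\<And>i. i < n \<Longrightarrow> H i \<subset> H (Suc i)"
proof -
  interpret Q: module R "mod_quot M N" by (rule module_mod_quot[OF N])
  define P where "P k \<longleftrightarrow> (\<exists>H. (\<forall>i\<le>k. submodule (H i) R (mod_quot M N)) \<and> (\<forall>i<k. H i \<subset> H (Suc i)))"
    for k :: nat
  have "{enat k | k H. (\<forall>i\<le>k. submodule (H i) R (mod_quot M N)) \<and> (\<forall>i<k. H i \<subset> H (Suc i))}
      = {enat k | k. P k}"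
    by (auto simp: P_def)
  then have "Sup {enat k | k. P k} = enat n" using len unfolding mod_length_def by simp
  moreover have "P 0" unfolding P_def using Q.carrier_is_submodule by auto
  ultimately have "P n" by (rule Sup_enat_attained)
  then obtain H where H: "\<And>i. i \<le> n \<Longrightarrow> submodule (H i) R (mod_quot M N)" "\<And>i. i < n \<Longrightarrow> H i \<subset> H (Suc i)"
    unfolding P_def by blast
  show ?thesis
  proof (rule that[of "\<lambda>i. {z \<in> carrier M. N +>\<^bsub>M\<^esub> z \<in> H i}"])
    fix i assume "i < n"
    then obtain C where C: "C \<in> H (Suc i)" "C \<notin> H i" "H i \<subseteq> H (Suc i)" using H(2) by blast
    have "C \<in> carrier (mod_quot M N)" using Q.submodule_rules(3)[OF H(1) C(1)] \<open>i < n\<close> by simp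
    then obtain z where "z \<in> carrier M" "C = N +>\<^bsub>M\<^esub> z" using mod_quot_simps(1)[OF N] by auto
    then show "{z \<in> carrier M. N +>\<^bsub>M\<^esub> z \<in> H i} \<subset> {z \<in> carrier M. N +>\<^bsub>M\<^esub> z \<in> H (Suc i)}"
      using C by blast
  qed (use submodule_mod_quot_vimage[OF N H(1)] in auto)
qed

end

section \<open>Free modules and free resolutions\<close>

lemma mod_homD:
  assumes "h \<in> mod_hom R M N"
  shows "x \<in> carrier M \<Longrightarrow> h x \<in> carrier N"
    and "x \<in> carrier M \<Longrightarrow> y \<in> carrier M \<Longrightarrow> h (x \<oplus>\<^bsub>M\<^esub> y) = h x \<oplus>\<^bsub>N\<^esub> h y"
    and "r \<in> carrier R \<Longrightarrow> x \<in> carrier M \<Longrightarrow> h (r \<odot>\<^bsub>M\<^esub> x) = r \<odot>\<^bsub>N\<^esub> h x"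
  using assms by (auto simp: mod_hom_def)

lemma mod_hom_zero:
  assumes "module R M" "module R N" "h \<in> mod_hom R M N"
  shows "h \<zero>\<^bsub>M\<^esub> = \<zero>\<^bsub>N\<^esub>"
proof -
  interpret M: module R M by fact
  interpret N: module R N by fact
  have "h \<zero>\<^bsub>M\<^esub> = \<zero>\<^bsub>R\<^esub> \<odot>\<^bsub>N\<^esub> h \<zero>\<^bsub>M\<^esub>"
    using mod_homD(3)[OF assms(3), of "\<zero>\<^bsub>R\<^esub>" "\<zero>\<^bsub>M\<^esub>"] by simp
  then show ?thesis using mod_homD(1)[OF assms(3), of "\<zero>\<^bsub>M\<^esub>"] by simp
qed

lemma mod_hom_kernel_submodule:
  assumes "module R M" "module R N" "h \<in> mod_hom R M N"
  shows "submodule {x \<in> carrier M. h x = \<zero>\<^bsub>N\<^esub>} R M"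
proof -
  interpret M: module R M by fact
  interpret N: module R N by fact
  show ?thesis
    using mod_homD[OF assms(3)] mod_hom_zero[OF assms] by (intro M.submoduleI') auto
qed

lemma mod_hom_image_submodule:
  assumes "module R M" "module R N" "h \<in> mod_hom R M N" "submodule H R M"
  shows "submodule (h ` H) R N"
proof -
  interpret M: module R M by fact
  interpret N: module R N by fact
  note h = mod_homD[OF assms(3)] and H = M.submodule_rules[OF assms(4)]
  show ?thesis
  proof (rule N.submoduleI')
    show "h ` H \<subseteq> carrier N" using h(1) H(1) by auto
    show "\<zero>\<^bsub>N\<^esub> \<in> h ` H" using mod_hom_zero[OF assms(1-3)] H(2) by (metis imageI)
    show "a \<oplus>\<^bsub>N\<^esub> b \<in> h ` H" if "a \<in> h ` H" "b \<in> h ` H" for a b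
      using that h(2) H(3,4) by (auto simp flip: h(2))
    show "r \<odot>\<^bsub>N\<^esub> a \<in> h ` H" if "a \<in> h ` H" "r \<in> carrier R" for a r
      using that H(3,7) by (auto simp flip: h(3))
  qed
qed

lemma direct_sum_simps [simp]:
  "carrier (direct_sum S M) = (\<Pi>\<^sub>E s\<in>S. carrier (M s))"
  "zero (direct_sum S M) = (\<lambda>s\<in>S. \<zero>\<^bsub>M s\<^esub>)"
  "u \<oplus>\<^bsub>direct_sum S M\<^esub> v = (\<lambda>s\<in>S. u s \<oplus>\<^bsub>M s\<^esub> v s)"
  "r \<odot>\<^bsub>direct_sum S M\<^esub> u = (\<lambda>s\<in>S. r \<odot>\<^bsub>M s\<^esub> u s)"
  by (auto simp: direct_sum_def)

lemma module_direct_sum: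
  assumes R: "cring R" and M: "\<And>s. s \<in> S \<Longrightarrow> module R (M s)"
  shows "module R (direct_sum S M)"
proof (rule moduleI[OF R])
  have g: "abelian_group (M s)" if "s \<in> S" for s using M[OF that] by (rule module.axioms)
  show "abelian_group (direct_sum S M)"
  proof (rule abelian_groupI)
    fix u assume u: "u \<in> carrier (direct_sum S M)"
    show "\<exists>v\<in>carrier (direct_sum S M). v \<oplus>\<^bsub>direct_sum S M\<^esub> u = \<zero>\<^bsub>direct_sum S M\<^esub>"
      using u by (intro bexI[of _ "\<lambda>s\<in>S. \<ominus>\<^bsub>M s\<^esub> u s"])
        (auto intro!: restrict_ext abelian_group.l_neg g abelian_group.a_inv_closed)
  next
    fix u assume u: "u \<in> carrier (direct_sum S M)"
    have "\<zero>\<^bsub>M s\<^esub> \<oplus>\<^bsub>M s\<^esub> u s = u s" if "s \<in> S" for s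
    proof -
      interpret abelian_group "M s" using g[OF that] .
      have "u s \<in> carrier (M s)" using PiE_mem[of u S "\<lambda>s. carrier (M s)" s] u that by simp
      then show ?thesis by simp
    qed
    then show "\<zero>\<^bsub>direct_sum S M\<^esub> \<oplus>\<^bsub>direct_sum S M\<^esub> u = u"
      using u by (auto simp: PiE_iff extensional_def restrict_def fun_eq_iff)
  next
    fix u v assume "u \<in> carrier (direct_sum S M)" "v \<in> carrier (direct_sum S M)"
    then show "u \<oplus>\<^bsub>direct_sum S M\<^esub> v = v \<oplus>\<^bsub>direct_sum S M\<^esub> u"
      by (auto intro!: restrict_ext abelian_monoid.a_comm abelian_group.axioms(1)[OF g])
  next
    fix u v w assume "u \<in> carrier (direct_sum S M)" "v \<in> carrier (direct_sum S M)" "w \<in> carrier (direct_sum S M)"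
    then show "u \<oplus>\<^bsub>direct_sum S M\<^esub> v \<oplus>\<^bsub>direct_sum S M\<^esub> w = u \<oplus>\<^bsub>direct_sum S M\<^esub> (v \<oplus>\<^bsub>direct_sum S M\<^esub> w)"
      by (auto intro!: restrict_ext abelian_monoid.a_assoc abelian_group.axioms(1)[OF g])
  qed (auto intro!: abelian_monoid.zero_closed abelian_monoid.a_closed abelian_group.axioms(1)[OF g])
next
  fix u assume u: "u \<in> carrier (direct_sum S M)"
  have "\<one>\<^bsub>R\<^esub> \<odot>\<^bsub>M s\<^esub> u s = u s" if "s \<in> S" for s
    using module.smult_one[OF M[OF that], of "u s"] u that by auto
  then show "\<one>\<^bsub>R\<^esub> \<odot>\<^bsub>direct_sum S M\<^esub> u = u"
    using u by (auto simp: PiE_iff extensional_def restrict_def fun_eq_iff)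
qed (auto intro!: restrict_ext module.smult_closed[OF M] module.smult_l_distr[OF M] module.smult_r_distr[OF M]
      module.smult_assoc1[OF M])

lemma finsum_direct_sum:
  assumes R: "cring R" and M: "\<And>s. s \<in> S \<Longrightarrow> module R (M s)"
    and u: "u \<in> A \<rightarrow> carrier (direct_sum S M)" and s: "s \<in> S"
  shows "finsum (direct_sum S M) u A s = finsum (M s) (\<lambda>a. u a s) A"
proof (rule finsum_hom[where h = "\<lambda>v. v s", OF _ _ _ _ u])
  show "abelian_group (direct_sum S M)" using module_direct_sum[OF R M] by (rule module.axioms)
  show "abelian_group (M s)" using M[OF s] by (rule module.axioms)
qed (use s in auto)

context cring
begin

lemma reg_module_simps [simp]:
  "carrier (reg_module R) = carrier R" "zero (reg_module R) = zero R"
  "add (reg_module R) = add R" "smult (reg_module R) = monoid.mult R"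
  by (auto simp: reg_module_def)

lemma module_reg_module: "module R (reg_module R)"
  by (rule moduleI[OF is_cring])
    (auto simp: l_distr r_distr m_assoc a_assoc a_comm a_lcomm intro!: abelian_groupI bexI[of _ "\<ominus> _"] l_neg)

lemma finsum_reg_module:
  assumes "u \<in> S \<rightarrow> carrier R"
  shows "finsum (reg_module R) u S = finsum R u S"
  using assms by (intro finsum_hom[where h = "\<lambda>x. x", OF _ abelian_group_axioms])
    (auto intro: module.axioms module_reg_module)

lemma submodule_reg_module: "submodule J R (reg_module R) \<longleftrightarrow> ideal J R"
proof -
  interpret M: module R "reg_module R" by (rule module_reg_module)
  show ?thesis
  proof
    assume "submodule J R (reg_module R)"
    note * = M.submodule_rules[OF this]
    show "ideal J R" using * by (intro idealI') auto
  next
    assume "ideal J R"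
    note * = ideal_rules[OF this]
    show "submodule J R (reg_module R)" using * by (intro M.submoduleI') auto
  qed
qed

lemma module_free_mod: "module R (free_mod R S)"
  unfolding free_mod_def by (rule module_direct_sum[OF is_cring module_reg_module])

lemma free_mod_simps [simp]:
  "carrier (free_mod R S) = (\<Pi>\<^sub>E s\<in>S. carrier R)"
  "zero (free_mod R S) = (\<lambda>s\<in>S. \<zero>)"
  "u \<oplus>\<^bsub>free_mod R S\<^esub> v = (\<lambda>s\<in>S. u s \<oplus> v s)"
  "r \<odot>\<^bsub>free_mod R S\<^esub> u = (\<lambda>s\<in>S. r \<otimes> u s)"
  by (auto simp: free_mod_def)

lemma finsum_free_mod:
  assumes "u \<in> A \<rightarrow> carrier (free_mod R S)" "s \<in> S"
  shows "finsum (free_mod R S) u A s = finsum R (\<lambda>a. u a s) A"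
proof -
  have "finsum (free_mod R S) u A s = finsum (reg_module R) (\<lambda>a. u a s) A"
    unfolding free_mod_def
    using assms by (intro finsum_direct_sum[OF is_cring module_reg_module]) (auto simp: free_mod_def)
  also have "\<dots> = finsum R (\<lambda>a. u a s) A"
    using assms by (intro finsum_reg_module) auto
  finally show ?thesis .
qed

lemma row_map_hom:
  assumes "module R M" "finite S" "g \<in> S \<rightarrow> carrier M"
  shows "row_map M S g \<in> mod_hom R (free_mod R S) M"
proof -
  interpret M: module R M by fact
  have c: "v s \<odot>\<^bsub>M\<^esub> g s \<in> carrier M" if "v \<in> carrier (free_mod R S)" "s \<in> S" for v s
    using assms that by auto
  show ?thesis unfolding mod_hom_def
  proof (intro CollectI conjI ballI)
    show "row_map M S g \<in> carrier (free_mod R S) \<rightarrow> carrier M"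
      unfolding row_map_def using c by (intro Pi_I M.finsum_closed) auto
  next
    fix u v assume uv: "u \<in> carrier (free_mod R S)" "v \<in> carrier (free_mod R S)"
    have "row_map M S g (u \<oplus>\<^bsub>free_mod R S\<^esub> v) = (\<Oplus>\<^bsub>M\<^esub>s\<in>S. u s \<odot>\<^bsub>M\<^esub> g s \<oplus>\<^bsub>M\<^esub> v s \<odot>\<^bsub>M\<^esub> g s)"
      unfolding row_map_def
    proof (intro M.finsum_cong' refl)
      fix s assume s: "s \<in> S"
      have "u s \<in> carrier R" "v s \<in> carrier R" "g s \<in> carrier M" using uv s assms(3) by auto
      then show "(u \<oplus>\<^bsub>free_mod R S\<^esub> v) s \<odot>\<^bsub>M\<^esub> g s = u s \<odot>\<^bsub>M\<^esub> g s \<oplus>\<^bsub>M\<^esub> v s \<odot>\<^bsub>M\<^esub> g s"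
        using s by (simp add: M.smult_l_distr)
    qed (use uv c in auto)
    also have "\<dots> = row_map M S g u \<oplus>\<^bsub>M\<^esub> row_map M S g v"
      unfolding row_map_def using c uv by (intro M.finsum_addf) auto
    finally show "row_map M S g (u \<oplus>\<^bsub>free_mod R S\<^esub> v) = row_map M S g u \<oplus>\<^bsub>M\<^esub> row_map M S g v" .
  next
    fix r v assume rv: "r \<in> carrier R" "v \<in> carrier (free_mod R S)"
    have "row_map M S g (r \<odot>\<^bsub>free_mod R S\<^esub> v) = (\<Oplus>\<^bsub>M\<^esub>s\<in>S. r \<odot>\<^bsub>M\<^esub> (v s \<odot>\<^bsub>M\<^esub> g s))"
      unfolding row_map_def
    proof (intro M.finsum_cong' refl)
      fix s assume s: "s \<in> S"
      have "v s \<in> carrier R" "g s \<in> carrier M" using rv s assms(3) by auto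
      then show "(r \<odot>\<^bsub>free_mod R S\<^esub> v) s \<odot>\<^bsub>M\<^esub> g s = r \<odot>\<^bsub>M\<^esub> (v s \<odot>\<^bsub>M\<^esub> g s)"
        using s rv by (simp add: M.smult_assoc1)
    qed (use rv c in auto)
    also have "\<dots> = r \<odot>\<^bsub>M\<^esub> row_map M S g v"
      unfolding row_map_def using c rv assms(2) by (intro M.finsum_smult_ldistr[symmetric]) auto
    finally show "row_map M S g (r \<odot>\<^bsub>free_mod R S\<^esub> v) = r \<odot>\<^bsub>M\<^esub> row_map M S g v" .
  qed
qed

definition unit_vec :: "'i set \<Rightarrow> 'i \<Rightarrow> 'i \<Rightarrow> 'a" where
  "unit_vec S t = (\<lambda>s\<in>S. if t = s then \<one> else \<zero>)"

lemma unit_vec_closed: "unit_vec S t \<in> carrier (free_mod R S)"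
  by (auto simp: unit_vec_def)

lemma row_map_unit_vec:
  assumes "module R M" "finite S" "g \<in> S \<rightarrow> carrier M" "t \<in> S"
  shows "row_map M S g (unit_vec S t) = g t"
proof -
  interpret M: module R M by fact
  have "row_map M S g (unit_vec S t) = (\<Oplus>\<^bsub>M\<^esub>s\<in>S. if t = s then g s else \<zero>\<^bsub>M\<^esub>)"
    unfolding row_map_def
  proof (intro M.finsum_cong' refl)
    fix s assume "s \<in> S"
    then have "g s \<in> carrier M" using assms by auto
    then show "unit_vec S t s \<odot>\<^bsub>M\<^esub> g s = (if t = s then g s else \<zero>\<^bsub>M\<^esub>)"
      using \<open>s \<in> S\<close> by (simp add: unit_vec_def)
  qed (use assms in auto)
  also have "\<dots> = g t" using assms by (intro M.finsum_singleton) auto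
  finally show ?thesis .
qed

lemma row_map_image:
  assumes "module R M" "finite S" "g \<in> S \<rightarrow> carrier M"
  shows "row_map M S g ` carrier (free_mod R S) = mod_span R M (g ` S)"
proof
  interpret M: module R M by fact
  have gS: "g ` S \<subseteq> carrier M" using assms by auto
  note sp = mod_span_submodule[OF assms(1) gS]
  show "row_map M S g ` carrier (free_mod R S) \<subseteq> mod_span R M (g ` S)"
  proof (rule image_subsetI)
    fix v assume v: "v \<in> carrier (free_mod R S)"
    show "row_map M S g v \<in> mod_span R M (g ` S)" unfolding row_map_def
      using v sp(2) M.submodule_rules(7)[OF sp(1)] by (intro M.submodule_finsum[OF sp(1)]) auto
  qed
  have "submodule (row_map M S g ` carrier (free_mod R S)) R M"
    using mod_hom_image_submodule[OF module_free_mod assms(1) row_map_hom[OF assms]]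
      module.carrier_is_submodule[OF module_free_mod] by blast
  moreover have "g ` S \<subseteq> row_map M S g ` carrier (free_mod R S)"
    using row_map_unit_vec[OF assms] unit_vec_closed by (metis image_subsetI imageI)
  ultimately show "mod_span R M (g ` S) \<subseteq> row_map M S g ` carrier (free_mod R S)"
    by (rule mod_span_least)
qed

text \<open>A matrix is the row of its columns, with values in a free module. Linearity and the
  description of the image are thus needed for \<open>row_map\<close> only.\<close>

lemma mat_map_row_map:
  assumes "finite S1" "\<And>s t. s \<in> S0 \<Longrightarrow> t \<in> S1 \<Longrightarrow> A s t \<in> carrier R" "v \<in> carrier (free_mod R S1)"
  shows "mat_map R S0 S1 A v = row_map (free_mod R S0) S1 (\<lambda>t. \<lambda>s\<in>S0. A s t) v"
proof -
  interpret F: module R "free_mod R S0" by (rule module_free_mod)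
  have c: "(\<lambda>t. v t \<odot>\<^bsub>free_mod R S0\<^esub> (\<lambda>s\<in>S0. A s t)) \<in> S1 \<rightarrow> carrier (free_mod R S0)"
  proof
    fix t assume t: "t \<in> S1"
    have "v t \<in> carrier R" using assms(3) t by auto
    then show "v t \<odot>\<^bsub>free_mod R S0\<^esub> (\<lambda>s\<in>S0. A s t) \<in> carrier (free_mod R S0)"
      using assms(2) t by auto
  qed
  have "row_map (free_mod R S0) S1 (\<lambda>t. \<lambda>s\<in>S0. A s t) v \<in> carrier (free_mod R S0)"
    unfolding row_map_def using c by (rule F.finsum_closed)
  moreover have "row_map (free_mod R S0) S1 (\<lambda>t. \<lambda>s\<in>S0. A s t) v s = mat_map R S0 S1 A v s"
    if s: "s \<in> S0" for s
  proof -
    have "row_map (free_mod R S0) S1 (\<lambda>t. \<lambda>s\<in>S0. A s t) v s =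
        (\<Oplus>t\<in>S1. (v t \<odot>\<^bsub>free_mod R S0\<^esub> (\<lambda>s\<in>S0. A s t)) s)"
      unfolding row_map_def by (rule finsum_free_mod[OF c s])
    also have "\<dots> = (\<Oplus>t\<in>S1. A s t \<otimes> v t)"
    proof (intro finsum_cong' refl)
      fix t assume t: "t \<in> S1"
      then have "A s t \<in> carrier R" "v t \<in> carrier R" using assms s by auto
      then show "(v t \<odot>\<^bsub>free_mod R S0\<^esub> (\<lambda>s\<in>S0. A s t)) s = A s t \<otimes> v t"
        using s by (simp add: m_comm)
    qed (use assms s in auto)
    finally show ?thesis using s by (simp add: mat_map_def)
  qed
  ultimately show ?thesis
    by (auto simp: mat_map_def PiE_iff extensional_def restrict_def fun_eq_iff)
qed

lemma mat_map_hom: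
  assumes "finite S1" "\<And>s t. s \<in> S0 \<Longrightarrow> t \<in> S1 \<Longrightarrow> A s t \<in> carrier R"
  shows "mat_map R S0 S1 A \<in> mod_hom R (free_mod R S1) (free_mod R S0)"
proof -
  interpret F1: module R "free_mod R S1" by (rule module_free_mod)
  let ?h = "row_map (free_mod R S0) S1 (\<lambda>t. \<lambda>s\<in>S0. A s t)"
  have h: "?h \<in> mod_hom R (free_mod R S1) (free_mod R S0)"
    using assms by (intro row_map_hom[OF module_free_mod]) auto
  have eq: "mat_map R S0 S1 A v = ?h v" if "v \<in> carrier (free_mod R S1)" for v
    using mat_map_row_map[of S1 S0 A, OF assms that] .
  show ?thesis unfolding mod_hom_def
  proof (intro CollectI conjI ballI Pi_I)
    fix u v assume uv: "u \<in> carrier (free_mod R S1)" "v \<in> carrier (free_mod R S1)"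
    show "mat_map R S0 S1 A (u \<oplus>\<^bsub>free_mod R S1\<^esub> v) = mat_map R S0 S1 A u \<oplus>\<^bsub>free_mod R S0\<^esub> mat_map R S0 S1 A v"
      unfolding eq[OF uv(1)] eq[OF uv(2)] eq[OF F1.a_closed[OF uv]] by (rule mod_homD(2)[OF h uv])
  next
    fix r v assume rv: "r \<in> carrier R" "v \<in> carrier (free_mod R S1)"
    show "mat_map R S0 S1 A (r \<odot>\<^bsub>free_mod R S1\<^esub> v) = r \<odot>\<^bsub>free_mod R S0\<^esub> mat_map R S0 S1 A v"
      unfolding eq[OF rv(2)] eq[OF F1.smult_closed[OF rv]] by (rule mod_homD(3)[OF h rv])
  next
    fix v assume v: "v \<in> carrier (free_mod R S1)"
    show "mat_map R S0 S1 A v \<in> carrier (free_mod R S0)"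
      unfolding eq[OF v] by (rule mod_homD(1)[OF h v])
  qed
qed

lemma mat_map_image:
  assumes "finite S1" "\<And>s t. s \<in> S0 \<Longrightarrow> t \<in> S1 \<Longrightarrow> A s t \<in> carrier R"
  shows "mat_map R S0 S1 A ` carrier (free_mod R S1) = mod_span R (free_mod R S0) ((\<lambda>t. \<lambda>s\<in>S0. A s t) ` S1)"
proof -
  have "mat_map R S0 S1 A ` carrier (free_mod R S1) =
      row_map (free_mod R S0) S1 (\<lambda>t. \<lambda>s\<in>S0. A s t) ` carrier (free_mod R S1)"
    using mat_map_row_map[OF assms] by (intro image_cong) auto
  also have "\<dots> = mod_span R (free_mod R S0) ((\<lambda>t. \<lambda>s\<in>S0. A s t) ` S1)"
    using assms by (intro row_map_image[OF module_free_mod]) auto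
  finally show ?thesis .
qed

end

section \<open>Finite generation of submodules of free modules and existence of free
  resolutions\<close>

context noetherian_cring
begin

text \<open>The vectors of \<open>H\<close> supported on the first \<open>j\<close> coordinates form
  a filtration \<open>T j\<close>. The last coordinates of the elements of \<open>T (Suc j)\<close>
  form an ideal; lifts of finitely many generators of it reduce \<open>T (Suc j)\<close> to
  \<open>T j\<close>.\<close>

lemma free_submodule_fin_gen:
  fixes p :: nat
  assumes H: "submodule H R (free_mod R {..<p})"
  shows "\<exists>G. finite G \<and> G \<subseteq> H \<and> mod_span R (free_mod R {..<p}) G = H"
proof -
  let ?F = "free_mod R {..<p}"
  interpret F: module R ?F by (rule module_free_mod)
  note H' = F.submodule_rules[OF H]
  define T where "T j = {h \<in> H. \<forall>i. j \<le> i \<and> i < p \<longrightarrow> h i = \<zero>}" for j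
  have T_step: "h \<in> T j" if "h j = \<zero>" "h \<in> T (Suc j)" for h j
  proof -
    have "h i = \<zero>" if "j \<le> i" "i < p" for i
      using \<open>h j = \<zero>\<close> \<open>h \<in> T (Suc j)\<close> that by (cases "i = j") (auto simp: T_def)
    then show ?thesis using \<open>h \<in> T (Suc j)\<close> by (simp add: T_def)
  qed
  have coord: "(\<lambda>h. h j) \<in> mod_hom R ?F (reg_module R)" if "j < p" for j
    using that by (auto simp: mod_hom_def)
  have T: "submodule (T j) R ?F" for j
    using H' by (intro F.submoduleI') (auto simp: T_def)
  have "\<exists>G. finite G \<and> G \<subseteq> H \<and> T j \<subseteq> mod_span R ?F G" if "j \<le> p" for j
    using that
  proof (induction j)
    case 0
    have "h = \<zero>\<^bsub>?F\<^esub>" if "h \<in> T 0" for h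
      using that H'(3)[of h] by (auto simp: T_def PiE_iff extensional_def restrict_def fun_eq_iff)
    moreover have "\<zero>\<^bsub>?F\<^esub> \<in> mod_span R ?F {}"
      using F.submodule_rules(2) mod_span_submodule(1)[OF module_free_mod] by blast
    ultimately show ?case by (intro exI[of _ "{}"]) (auto simp del: free_mod_simps)
  next
    case (Suc j)
    then obtain G where G: "finite G" "G \<subseteq> H" "T j \<subseteq> mod_span R ?F G" by auto
    have jp: "j < p" using Suc.prems by simp
    have "ideal ((\<lambda>h. h j) ` T (Suc j)) R"
      using mod_hom_image_submodule[OF module_free_mod module_reg_module coord[OF jp] T]
      by (simp add: submodule_reg_module)
    then obtain A where A: "A \<subseteq> carrier R" "finite A" "(\<lambda>h. h j) ` T (Suc j) = Idl A"
      using finetely_gen by blast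
    have "\<forall>a\<in>A. \<exists>h\<in>T (Suc j). h j = a"
      using genideal_self[OF A(1)] A(3) by (metis (no_types, lifting) image_iff subsetD)
    then obtain e where e: "\<And>a. a \<in> A \<Longrightarrow> e a \<in> T (Suc j)" "\<And>a. a \<in> A \<Longrightarrow> e a j = a" by metis
    have eH: "e ` A \<subseteq> H" using e(1) by (auto simp: T_def)
    have eF: "e ` A \<subseteq> carrier ?F" "G \<subseteq> carrier ?F" using eH G(2) H'(1) by auto
    note s1 = mod_span_submodule[OF module_free_mod eF(1)]
    have sub: "mod_span R ?F (e ` A) \<subseteq> T (Suc j)" using e(1) by (intro mod_span_least[OF T]) auto
    have "ideal ((\<lambda>h. h j) ` mod_span R ?F (e ` A)) R"
      using mod_hom_image_submodule[OF module_free_mod module_reg_module coord[OF jp] s1(1)]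
      by (simp add: submodule_reg_module)
    moreover have "A \<subseteq> (\<lambda>h. h j) ` mod_span R ?F (e ` A)"
    proof
      fix a assume a: "a \<in> A"
      then have "e a \<in> mod_span R ?F (e ` A)" using s1(2) by auto
      then show "a \<in> (\<lambda>h. h j) ` mod_span R ?F (e ` A)" 
        by (intro image_eqI[of _ _ "e a"]) (simp_all add: e(2)[OF a])
    qed
    ultimately have Ile: "Idl A \<subseteq> (\<lambda>h. h j) ` mod_span R ?F (e ` A)" by (rule genideal_minimal)
    have GA: "G \<union> e ` A \<subseteq> carrier ?F" using eF by auto
    note s2 = mod_span_submodule[OF module_free_mod GA]
    have le: "mod_span R ?F G \<subseteq> mod_span R ?F (G \<union> e ` A)"
      "mod_span R ?F (e ` A) \<subseteq> mod_span R ?F (G \<union> e ` A)"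
      using s2(2) by (auto intro!: mod_span_least[OF s2(1)])
    have "h \<in> mod_span R ?F (G \<union> e ` A)" if h: "h \<in> T (Suc j)" for h
    proof -
      have "h j \<in> Idl A" using h A(3) by auto
      then have "h j \<in> (\<lambda>h. h j) ` mod_span R ?F (e ` A)" using Ile by blast
      then obtain h' where h': "h' \<in> mod_span R ?F (e ` A)" "h' j = h j" by auto
      have h'T: "h' \<in> T (Suc j)" using h' sub by auto
      have c: "h \<in> carrier ?F" "h' \<in> carrier ?F" using h h'T F.submodule_rules(3)[OF T] by blast+
      let ?d = "(\<ominus> \<one>) \<odot>\<^bsub>?F\<^esub> h'"
      have d1: "?d \<oplus>\<^bsub>?F\<^esub> h \<in> T (Suc j)"
        by (intro F.submodule_rules(4)[OF T] F.submodule_rules(7)[OF T h'T] h) simp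
      have "(?d \<oplus>\<^bsub>?F\<^esub> h) j = \<zero>" 
      proof -
        have "h j \<in> carrier R" using c jp by auto
        then show ?thesis using jp h'(2) by (simp add: l_minus l_neg)
      qed
      then have "?d \<oplus>\<^bsub>?F\<^esub> h \<in> T j" using d1 by (rule T_step)
      then have "?d \<oplus>\<^bsub>?F\<^esub> h \<in> mod_span R ?F (G \<union> e ` A)" using G(3) le(1) by blast
      moreover have "?d \<in> mod_span R ?F (G \<union> e ` A)"
        using h'(1) le(2) by (intro F.submodule_rules(7)[OF s2(1)]) auto
      ultimately show ?thesis using F.submodule_add_cancel[OF s2(1)] c(1) by blast
    qed
    then show ?case using G A eH by (intro exI[of _ "G \<union> e ` A"]) auto
  qed
  from this[OF order_refl] obtain G where G: "finite G" "G \<subseteq> H" "T p \<subseteq> mod_span R ?F G" by blast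
  have "T p = H" by (auto simp: T_def)
  then show ?thesis using G mod_span_least[OF H G(2)] by blast
qed

lemma free_submodule_matrix:
  fixes p :: nat
  assumes H: "submodule H R (free_mod R {..<p})"
  shows "\<exists>q A. (\<forall>s<p. \<forall>t<q. A s t \<in> carrier R) \<and>
    mat_map R {..<p} {..<q::nat} A ` carrier (free_mod R {..<q}) = H"
proof -
  interpret F: module R "free_mod R {..<p}" by (rule module_free_mod)
  obtain G where G: "finite G" "G \<subseteq> H" "mod_span R (free_mod R {..<p}) G = H"
    using free_submodule_fin_gen[OF H] by blast
  obtain q e where e: "G = e ` {i::nat. i < q}"
    using finite_imp_nat_seg_image_inj_on[OF G(1)] by blast
  have ec: "e t \<in> carrier (free_mod R {..<p})" if "t < q" for t
    using that e G(2) F.submodule_rules(3)[OF H] by auto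
  have res: "(\<lambda>s\<in>{..<p}. e t s) = e t" if "t < q" for t
    using ec[OF that] by (auto simp: PiE_iff extensional_def restrict_def fun_eq_iff)
  have ent: "e t s \<in> carrier R" if "s < p" "t < q" for s t using ec[OF that(2)] that(1) by auto
  have "mat_map R {..<p} {..<q} (\<lambda>s t. e t s) ` carrier (free_mod R {..<q}) =
      mod_span R (free_mod R {..<p}) ((\<lambda>t. \<lambda>s\<in>{..<p}. e t s) ` {..<q})"
    using ent by (intro mat_map_image) auto
  also have "(\<lambda>t. \<lambda>s\<in>{..<p}. e t s) ` {..<q} = G" unfolding e using res by force
  finally show ?thesis using G(3) ent by (intro exI[of _ q] exI[of _ "\<lambda>s t. e t s"]) auto
qed

text \<open>\<open>Ext\<close> evaluates a resolution picked by \<open>SOME\<close>, which is known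
  to be one only after existence is shown. Each matrix lists finitely many generators of the kernel
  of its predecessor.\<close>

lemma free_resolution_exists:
  assumes N: "module R N" and g: "g \<in> {..<p::nat} \<rightarrow> carrier N" "mod_span R N (g ` {..<p}) = carrier N"
  shows "\<exists>F. free_resolution R N F"
proof -
  define ker where "ker p q A = {v \<in> carrier (free_mod R {..<q::nat}).
     mat_map R {..<p::nat} {..<q} A v = \<zero>\<^bsub>free_mod R {..<p}\<^esub>}" for p q and A :: "nat \<Rightarrow> nat \<Rightarrow> 'a"
  \<comment> \<open>A state \<open>(a, q, A)\<close> is a matrix with \<open>a\<close> rows and
    \<open>q\<close> columns. \<open>P\<close> ties the first one to the kernel of
    \<open>row_map N\<close>, and \<open>S\<close> makes each matrix map onto the kernel of the one
    before; dependent choice strings them together.\<close>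
  define P where "P n x = (case x of (a, q, A) \<Rightarrow> (\<forall>s<a. \<forall>t<q. A s t \<in> carrier R) \<and> (n = 0 \<longrightarrow> a = p \<and>
     mat_map R {..<a} {..<q} A ` carrier (free_mod R {..<q}) =
       {v \<in> carrier (free_mod R {..<p}). row_map N {..<p} g v = \<zero>\<^bsub>N\<^esub>}))"
    for n :: nat and x :: "nat \<times> nat \<times> (nat \<Rightarrow> nat \<Rightarrow> 'a)"
  define S where "S n x y = (case (x, y) of ((a, q, A), (a', q', A')) \<Rightarrow> a' = q \<and>
     mat_map R {..<a'} {..<q'} A' ` carrier (free_mod R {..<q'}) = ker a q A)"
    for n :: nat and x y :: "nat \<times> nat \<times> (nat \<Rightarrow> nat \<Rightarrow> 'a)"
  have "submodule {v \<in> carrier (free_mod R {..<p}). row_map N {..<p} g v = \<zero>\<^bsub>N\<^esub>} R (free_mod R {..<p})"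
    using g by (intro mod_hom_kernel_submodule[OF module_free_mod N] row_map_hom[OF N]) auto
  from free_submodule_matrix[OF this]
  obtain q A where qA: "\<forall>s<p. \<forall>t<q. A s t \<in> carrier R"
    "mat_map R {..<p} {..<q::nat} A ` carrier (free_mod R {..<q}) =
      {v \<in> carrier (free_mod R {..<p}). row_map N {..<p} g v = \<zero>\<^bsub>N\<^esub>}" by blast
  have start: "\<exists>x. P 0 x" using qA by (intro exI[of _ "(p, q, A)"]) (simp add: P_def)
  have step: "\<exists>y. P (Suc n) y \<and> S n x y" if x: "P n x" for x n
  proof -
    obtain a q A where xq: "x = (a, q, A)" by (cases x)
    have A: "\<And>s t. s < a \<Longrightarrow> t < q \<Longrightarrow> A s t \<in> carrier R" using x by (auto simp: P_def xq)
    have "submodule (ker a q A) R (free_mod R {..<q})" unfolding ker_def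
      using A by (intro mod_hom_kernel_submodule[OF module_free_mod module_free_mod] mat_map_hom) auto
    from free_submodule_matrix[OF this]
    obtain q' A' where "\<forall>s<q. \<forall>t<q'. A' s t \<in> carrier R"
      "mat_map R {..<q} {..<q'::nat} A' ` carrier (free_mod R {..<q'}) = ker a q A" by blast
    then show ?thesis by (intro exI[of _ "(q, q', A')"]) (simp add: P_def S_def xq)
  qed
  obtain x where x: "\<And>n. P n (x n)" "\<And>n. S n (x n) (x (Suc n))"
    using dependent_nat_choice[of P S, OF start step] by blast
  define b where "b n = fst (x n)" for n
  define D where "D n = snd (snd (x n))" for n
  have b1: "fst (snd (x n)) = b (Suc n)" for n
    using x(2)[of n] by (auto simp: S_def b_def split: prod.splits)
  have xn: "x n = (b n, b (Suc n), D n)" for n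
    using b1[of n] by (auto simp: b_def D_def prod_eq_iff)
  have P: "\<forall>s<b n. \<forall>t<b (Suc n). D n s t \<in> carrier R" for n
    using x(1)[of n] unfolding xn by (simp add: P_def)
  have P0: "b 0 = p" "mat_map R {..<p} {..<b 1} (D 0) ` carrier (free_mod R {..<b 1}) =
       {v \<in> carrier (free_mod R {..<p}). row_map N {..<p} g v = \<zero>\<^bsub>N\<^esub>}"
    using x(1)[of 0] unfolding xn by (auto simp: P_def)
  have S: "mat_map R {..<b (Suc n)} {..<b (Suc (Suc n))} (D (Suc n)) ` carrier (free_mod R {..<b (Suc (Suc n))})
      = ker (b n) (b (Suc n)) (D n)" for n
    using x(2)[of n] unfolding xn by (simp add: S_def)
  have "row_map N {..<p} g ` carrier (free_mod R {..<p}) = carrier N"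
    using row_map_image[OF N finite_lessThan g(1)] g(2) by simp
  then have "free_presentation R N {..<b 0} {..<b 1} (D 0) g"
    unfolding free_presentation_def using P[of 0] P0 g by (auto simp del: free_mod_simps)
  then have "free_resolution R N (b, D, g)"
    using P S by (simp add: ker_def del: free_mod_simps)
  then show ?thesis by blast
qed

end

section \<open>The first Ext module of the residue field\<close>

text \<open>Interchange of the two summations. For the matrices of a resolution it turns the
  vanishing of the product of \<open>D 0\<close> and \<open>D 1\<close> into the vanishing of two
  successive coboundaries, and an equation in the first free module into one between values of a
  cochain.\<close>

lemma (in module) finsum_smult_swap:
  assumes "finite A" "finite B"
    and "\<And>s t. s \<in> A \<Longrightarrow> t \<in> B \<Longrightarrow> c s t \<in> carrier R" "a \<in> B \<rightarrow> carrier R" "u \<in> A \<rightarrow> carrier M"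
  shows "(\<Oplus>\<^bsub>M\<^esub>t\<in>B. a t \<odot>\<^bsub>M\<^esub> (\<Oplus>\<^bsub>M\<^esub>s\<in>A. c s t \<odot>\<^bsub>M\<^esub> u s)) = (\<Oplus>\<^bsub>M\<^esub>s\<in>A. (\<Oplus>t\<in>B. c s t \<otimes> a t) \<odot>\<^bsub>M\<^esub> u s)"
  using assms(2-4)
proof (induction B)
  case empty
  have "(\<Oplus>\<^bsub>M\<^esub>s\<in>A. \<zero> \<odot>\<^bsub>M\<^esub> u s) = (\<Oplus>\<^bsub>M\<^esub>s\<in>A. \<zero>\<^bsub>M\<^esub>)"
    using assms(5) by (intro M.finsum_cong' refl) (auto simp: Pi_iff)
  then show ?case by simp
next
  case (insert t B)
  have u: "u s \<in> carrier M" if "s \<in> A" for s using assms(5) that by auto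
  have c: "c s t \<in> carrier R" "\<And>t'. t' \<in> B \<Longrightarrow> c s t' \<in> carrier R" if "s \<in> A" for s using insert that by auto
  have a: "a t \<in> carrier R" "a \<in> B \<rightarrow> carrier R" "\<And>t'. t' \<in> B \<Longrightarrow> a t' \<in> carrier R" using insert by auto
  have q: "(\<Oplus>t\<in>B. c s t \<otimes> a t) \<in> carrier R" if "s \<in> A" for s
    using c[OF that] a by (intro R.finsum_closed) auto
  have i: "(\<Oplus>\<^bsub>M\<^esub>s\<in>A. c s t' \<odot>\<^bsub>M\<^esub> u s) \<in> carrier M" if "t' \<in> insert t B" for t'
    using insert that u by (intro M.finsum_closed) auto
  have "(\<Oplus>\<^bsub>M\<^esub>t\<in>insert t B. a t \<odot>\<^bsub>M\<^esub> (\<Oplus>\<^bsub>M\<^esub>s\<in>A. c s t \<odot>\<^bsub>M\<^esub> u s)) =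
     a t \<odot>\<^bsub>M\<^esub> (\<Oplus>\<^bsub>M\<^esub>s\<in>A. c s t \<odot>\<^bsub>M\<^esub> u s) \<oplus>\<^bsub>M\<^esub> (\<Oplus>\<^bsub>M\<^esub>s\<in>A. (\<Oplus>t\<in>B. c s t \<otimes> a t) \<odot>\<^bsub>M\<^esub> u s)"
    using insert i a by (subst M.finsum_insert) auto
  also have "a t \<odot>\<^bsub>M\<^esub> (\<Oplus>\<^bsub>M\<^esub>s\<in>A. c s t \<odot>\<^bsub>M\<^esub> u s) = (\<Oplus>\<^bsub>M\<^esub>s\<in>A. a t \<odot>\<^bsub>M\<^esub> (c s t \<odot>\<^bsub>M\<^esub> u s))"
    using a c u assms(1) by (intro finsum_smult_ldistr) auto
  also have "\<dots> \<oplus>\<^bsub>M\<^esub> (\<Oplus>\<^bsub>M\<^esub>s\<in>A. (\<Oplus>t\<in>B. c s t \<otimes> a t) \<odot>\<^bsub>M\<^esub> u s) =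
     (\<Oplus>\<^bsub>M\<^esub>s\<in>A. a t \<odot>\<^bsub>M\<^esub> (c s t \<odot>\<^bsub>M\<^esub> u s) \<oplus>\<^bsub>M\<^esub> (\<Oplus>t\<in>B. c s t \<otimes> a t) \<odot>\<^bsub>M\<^esub> u s)"
    using a c u q by (intro M.finsum_addf[symmetric]) auto
  also have "\<dots> = (\<Oplus>\<^bsub>M\<^esub>s\<in>A. (\<Oplus>t\<in>insert t B. c s t \<otimes> a t) \<odot>\<^bsub>M\<^esub> u s)"
  proof (intro M.finsum_cong' refl)
    fix s assume s: "s \<in> A"
    have "(\<Oplus>t\<in>insert t B. c s t \<otimes> a t) = c s t \<otimes> a t \<oplus> (\<Oplus>t\<in>B. c s t \<otimes> a t)"
      using insert(1,2) c[OF s] a by (intro R.finsum_insert) auto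
    then show "a t \<odot>\<^bsub>M\<^esub> (c s t \<odot>\<^bsub>M\<^esub> u s) \<oplus>\<^bsub>M\<^esub> (\<Oplus>t\<in>B. c s t \<otimes> a t) \<odot>\<^bsub>M\<^esub> u s =
      (\<Oplus>t\<in>insert t B. c s t \<otimes> a t) \<odot>\<^bsub>M\<^esub> u s"
      using c(1)[OF s] a(1) u[OF s] q[OF s] by (simp add: smult_l_distr smult_assoc1 R.m_comm)
  next
    show "(\<lambda>s. (\<Oplus>t\<in>insert t B. c s t \<otimes> a t) \<odot>\<^bsub>M\<^esub> u s) \<in> A \<rightarrow> carrier M"
      using insert c a u by (intro Pi_I smult_closed R.finsum_closed) auto
  qed
  finally show ?case .
qed

lemma coboundary_hom:
  assumes M: "module R M" and D: "\<And>s t. s \<in> A \<Longrightarrow> t \<in> B \<Longrightarrow> D s t \<in> carrier R" and "finite A"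
  shows "(\<lambda>u. \<lambda>t\<in>B. \<Oplus>\<^bsub>M\<^esub>s\<in>A. D s t \<odot>\<^bsub>M\<^esub> u s) \<in> mod_hom R (direct_sum A (\<lambda>_. M)) (direct_sum B (\<lambda>_. M))"
proof -
  interpret M: module R M by fact
  have c: "D s t \<odot>\<^bsub>M\<^esub> u s \<in> carrier M" if "u \<in> carrier (direct_sum A (\<lambda>_. M))" "s \<in> A" "t \<in> B" for s t u
    using D that by auto
  show ?thesis unfolding mod_hom_def
  proof (intro CollectI conjI ballI)
    show "(\<lambda>u. \<lambda>t\<in>B. \<Oplus>\<^bsub>M\<^esub>s\<in>A. D s t \<odot>\<^bsub>M\<^esub> u s) \<in> carrier (direct_sum A (\<lambda>_. M)) \<rightarrow> carrier (direct_sum B (\<lambda>_. M))"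
      using c by (auto intro!: M.finsum_closed)
  next
    fix u v assume uv: "u \<in> carrier (direct_sum A (\<lambda>_. M))" "v \<in> carrier (direct_sum A (\<lambda>_. M))"
    have "(\<Oplus>\<^bsub>M\<^esub>s\<in>A. D s t \<odot>\<^bsub>M\<^esub> (u \<oplus>\<^bsub>direct_sum A (\<lambda>_. M)\<^esub> v) s) =
      (\<Oplus>\<^bsub>M\<^esub>s\<in>A. D s t \<odot>\<^bsub>M\<^esub> u s) \<oplus>\<^bsub>M\<^esub> (\<Oplus>\<^bsub>M\<^esub>s\<in>A. D s t \<odot>\<^bsub>M\<^esub> v s)" if t: "t \<in> B" for t
    proof -
      have "(\<Oplus>\<^bsub>M\<^esub>s\<in>A. D s t \<odot>\<^bsub>M\<^esub> (u \<oplus>\<^bsub>direct_sum A (\<lambda>_. M)\<^esub> v) s) =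
        (\<Oplus>\<^bsub>M\<^esub>s\<in>A. D s t \<odot>\<^bsub>M\<^esub> u s \<oplus>\<^bsub>M\<^esub> D s t \<odot>\<^bsub>M\<^esub> v s)"
      proof (intro M.finsum_cong' refl)
        fix s assume s: "s \<in> A"
        have "u s \<in> carrier M" "v s \<in> carrier M" using uv s by auto
        then show "D s t \<odot>\<^bsub>M\<^esub> (u \<oplus>\<^bsub>direct_sum A (\<lambda>_. M)\<^esub> v) s = D s t \<odot>\<^bsub>M\<^esub> u s \<oplus>\<^bsub>M\<^esub> D s t \<odot>\<^bsub>M\<^esub> v s"
          using s t D by (simp add: M.smult_r_distr)
      qed (use uv c t in auto)
      then show ?thesis using c[OF uv(1) _ t] c[OF uv(2) _ t] by (subst M.finsum_addf[symmetric]) auto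
    qed
    then show "(\<lambda>t\<in>B. \<Oplus>\<^bsub>M\<^esub>s\<in>A. D s t \<odot>\<^bsub>M\<^esub> (u \<oplus>\<^bsub>direct_sum A (\<lambda>_. M)\<^esub> v) s) =
      (\<lambda>t\<in>B. \<Oplus>\<^bsub>M\<^esub>s\<in>A. D s t \<odot>\<^bsub>M\<^esub> u s) \<oplus>\<^bsub>direct_sum B (\<lambda>_. M)\<^esub> (\<lambda>t\<in>B. \<Oplus>\<^bsub>M\<^esub>s\<in>A. D s t \<odot>\<^bsub>M\<^esub> v s)"
      by (auto intro!: restrict_ext simp del: direct_sum_simps(3) simp add: direct_sum_simps(3)[of B])
  next
    fix r u assume ru: "r \<in> carrier R" "u \<in> carrier (direct_sum A (\<lambda>_. M))"
    have "(\<Oplus>\<^bsub>M\<^esub>s\<in>A. D s t \<odot>\<^bsub>M\<^esub> (r \<odot>\<^bsub>direct_sum A (\<lambda>_. M)\<^esub> u) s) =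
      r \<odot>\<^bsub>M\<^esub> (\<Oplus>\<^bsub>M\<^esub>s\<in>A. D s t \<odot>\<^bsub>M\<^esub> u s)" if t: "t \<in> B" for t
    proof -
      have "(\<Oplus>\<^bsub>M\<^esub>s\<in>A. D s t \<odot>\<^bsub>M\<^esub> (r \<odot>\<^bsub>direct_sum A (\<lambda>_. M)\<^esub> u) s) =
        (\<Oplus>\<^bsub>M\<^esub>s\<in>A. r \<odot>\<^bsub>M\<^esub> (D s t \<odot>\<^bsub>M\<^esub> u s))"
      proof (intro M.finsum_cong' refl)
        fix s assume s: "s \<in> A"
        have "u s \<in> carrier M" "D s t \<in> carrier R" using ru s t D by auto
        then show "D s t \<odot>\<^bsub>M\<^esub> (r \<odot>\<^bsub>direct_sum A (\<lambda>_. M)\<^esub> u) s = r \<odot>\<^bsub>M\<^esub> (D s t \<odot>\<^bsub>M\<^esub> u s)"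
          using s t ru(1) by (simp add: M.smult_assoc1[symmetric] M.R.m_comm)
      qed (use ru c t in auto)
      then show ?thesis using c[OF ru(2) _ t] ru(1) assms(3) by (subst M.finsum_smult_ldistr) auto
    qed
    then show "(\<lambda>t\<in>B. \<Oplus>\<^bsub>M\<^esub>s\<in>A. D s t \<odot>\<^bsub>M\<^esub> (r \<odot>\<^bsub>direct_sum A (\<lambda>_. M)\<^esub> u) s) =
      r \<odot>\<^bsub>direct_sum B (\<lambda>_. M)\<^esub> (\<lambda>t\<in>B. \<Oplus>\<^bsub>M\<^esub>s\<in>A. D s t \<odot>\<^bsub>M\<^esub> u s)"
      by (auto intro!: restrict_ext simp del: direct_sum_simps(4) simp add: direct_sum_simps(4)[of B])
  qed
qed


context noetherian_cring
begin

text \<open>For a submodule \<open>K\<close> of a module \<open>W\<close> without \<open>\<mm>\<close>-torsion, an element \<open>z\<close> of \<open>(K : \<mm>) / K\<close> yields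
  the class in \<open>Ext\<^sup>1(R / \<mm>, K)\<close> of the extension to a resolution of \<open>\<mm> \<rightarrow> K\<close>, \<open>y \<mapsto> y z\<close>.
  This is injective.\<close>

lemma socle_length_le_Ext1:
  fixes W :: "('a, 'w) module"
  assumes W: "module R W" and K: "submodule K R W" and mm: "ideal \<mm> R"
    and nosoc: "\<And>z. z \<in> carrier W \<Longrightarrow> (\<And>y. y \<in> \<mm> \<Longrightarrow> y \<odot>\<^bsub>W\<^esub> z = \<zero>\<^bsub>W\<^esub>) \<Longrightarrow> z = \<zero>\<^bsub>W\<^esub>"
    and len: "mod_length R (Ext R 1 (mod_quot (reg_module R) \<mm>) (restrict_mod W K)) = 1"
    and z: "z \<in> carrier W" "\<And>y. y \<in> \<mm> \<Longrightarrow> y \<odot>\<^bsub>W\<^esub> z \<in> K" "z \<notin> K"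
    and z': "z' \<in> carrier W" "\<And>y. y \<in> \<mm> \<Longrightarrow> y \<odot>\<^bsub>W\<^esub> z' \<in> K"
  shows "\<exists>r\<in>carrier R. z' \<ominus>\<^bsub>W\<^esub> r \<odot>\<^bsub>W\<^esub> z \<in> K"
proof -
  interpret W: module R W by fact
  note K' = W.submodule_rules[OF K] and mm' = ideal_rules[OF mm]
  interpret P: plain_module R "reg_module R" unfolding plain_module_def by (rule module_reg_module)
  have mms: "submodule \<mm> R (reg_module R)" using mm by (simp add: submodule_reg_module)
  define k where "k = mod_quot (reg_module R) \<mm>"
  define cls where "cls a = \<mm> +>\<^bsub>reg_module R\<^esub> a" for a
  have k: "module R k" unfolding k_def by (rule P.module_mod_quot[OF mms])
  interpret k: module R k by (rule k)
  note ks = P.mod_quot_simps[OF mms, folded k_def cls_def, simplified]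
  have cls0: "cls a = \<zero>\<^bsub>k\<^esub> \<longleftrightarrow> a \<in> \<mm>" if "a \<in> carrier R" for a
    using P.mod_coset_eq_zero_iff[OF mms, of a] that ks(2) by (simp add: cls_def)
  have clsc: "cls a \<in> carrier k" if "a \<in> carrier R" for a using ks(1) that by simp
  have cls_sum: "cls (\<Oplus>s\<in>S. a s) = (\<Oplus>\<^bsub>k\<^esub>s\<in>S. cls (a s))" if "a \<in> S \<rightarrow> carrier R" for a and S :: "nat set"
    using that clsc ks(3) by (intro finsum_hom[OF abelian_group_axioms k.abelian_group_axioms]) auto
  have "\<exists>F. free_resolution R k F"
  proof (rule free_resolution_exists[OF k, of "\<lambda>_. cls \<one>" 1])
    show "(\<lambda>_. cls \<one>) \<in> {..<1} \<rightarrow> carrier k" using clsc by auto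
    then have g: "(\<lambda>_. cls \<one>) ` {..<1::nat} \<subseteq> carrier k" by auto
    note sp = mod_span_submodule[OF k g]
    have "carrier k \<subseteq> mod_span R k ((\<lambda>_. cls \<one>) ` {..<1::nat})"
    proof
      fix C assume "C \<in> carrier k"
      then obtain a where a: "a \<in> carrier R" "C = cls a" using ks(1) by auto
      have "C = a \<odot>\<^bsub>k\<^esub> cls \<one>" using a ks(4)[of a \<one>] by simp
      then show "C \<in> mod_span R k ((\<lambda>_. cls \<one>) ` {..<1::nat})"
        using sp(2) k.submodule_rules(7)[OF sp(1)] a(1) by (auto simp: lessThan_Suc)
    qed
    then show "mod_span R k ((\<lambda>_. cls \<one>) ` {..<1::nat}) = carrier k"
      using k.submodule_rules(1)[OF sp(1)] by auto
  qed
  then have "free_resolution R k (SOME F. free_resolution R k F)" by (rule someI_ex)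
  then obtain b D g where F: "free_resolution R k (b, D, g)" "(SOME F. free_resolution R k F) = (b, D, g)"
    by (metis prod_cases3)
  have pres: "free_presentation R k {..<b 0} {..<b 1} (D 0) g" using F(1) by simp
  have Dc: "D i s t \<in> carrier R" if "s < b i" "t < b (Suc i)" for i s t using F(1) that by auto
  have gc: "g s \<in> carrier k" if "s < b 0" for s using pres that by (auto simp: free_presentation_def)
  have "\<exists>a\<in>carrier R. g s = cls a" if "s < b 0" for s using gc[OF that] ks(1) by auto
  \<comment> \<open>The chosen resolution may start with a free module of any rank, so the
    augmentation onto the residue field is lifted to \<open>R\<close> coordinate by
    coordinate.\<close>
  then obtain \<gamma> where \<gamma>: "\<And>s. s < b 0 \<Longrightarrow> \<gamma> s \<in> carrier R" "\<And>s. s < b 0 \<Longrightarrow> g s = cls (\<gamma> s)" by metis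
  have row: "row_map k {..<b 0} g v = cls (\<Oplus>s\<in>{..<b 0}. v s \<otimes> \<gamma> s)" if v: "v \<in> carrier (free_mod R {..<b 0})" for v
  proof -
    have vc: "v s \<in> carrier R" if "s < b 0" for s using v that by auto
    have "cls (\<Oplus>s\<in>{..<b 0}. v s \<otimes> \<gamma> s) = (\<Oplus>\<^bsub>k\<^esub>s\<in>{..<b 0}. cls (v s \<otimes> \<gamma> s))"
      using vc \<gamma>(1) by (intro cls_sum) auto
    also have "\<dots> = row_map k {..<b 0} g v" unfolding row_map_def
    proof (intro k.finsum_cong' refl)
      fix s assume "s \<in> {..<b 0}"
      then show "cls (v s \<otimes> \<gamma> s) = v s \<odot>\<^bsub>k\<^esub> g s" using vc \<gamma> ks(4) by simp
    qed (use vc gc in auto)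
    finally show ?thesis by simp
  qed
  have ker0: "mat_map R {..<b 0} {..<b 1} (D 0) ` carrier (free_mod R {..<b 1}) =
      {v \<in> carrier (free_mod R {..<b 0}). row_map k {..<b 0} g v = \<zero>\<^bsub>k\<^esub>}"
    using pres unfolding free_presentation_def by blast
  have ker1: "mat_map R {..<b 1} {..<b 2} (D 1) ` carrier (free_mod R {..<b 2}) =
      {v \<in> carrier (free_mod R {..<b 1}). mat_map R {..<b 0} {..<b 1} (D 0) v = \<zero>\<^bsub>free_mod R {..<b 0}\<^esub>}"
    using F(1) by (simp add: numeral_2_eq_2 del: free_mod_simps)
  have col: "(\<lambda>s\<in>{..<b i}. D i s t) \<in> mat_map R {..<b i} {..<b (Suc i)} (D i) ` carrier (free_mod R {..<b (Suc i)})"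
    if t: "t < b (Suc i)" for i t
  proof -
    have "(\<lambda>t. \<lambda>s\<in>{..<b i}. D i s t) ` {..<b (Suc i)} \<subseteq> carrier (free_mod R {..<b i})"
      using Dc by (intro image_subsetI) (simp add: restrict_PiE_iff)
    from mod_span_submodule(2)[OF module_free_mod this] show ?thesis
      using t Dc by (subst mat_map_image) auto
  qed
  \<comment> \<open>The image in \<open>R\<close> of the \<open>t\<close>-th basis vector of the
    second free module under the lifted augmentation. It lies in \<open>\<mm>\<close> because the
    composite to the residue field vanishes.\<close>
  define c where "c t = (\<Oplus>s\<in>{..<b 0}. D 0 s t \<otimes> \<gamma> s)" for t
  have cc: "c t \<in> carrier R" if "t < b 1" for t unfolding c_def using Dc[of _ 0 t] \<gamma>(1) that
    by (intro finsum_closed) auto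
  have cm: "c t \<in> \<mm>" if t: "t < b 1" for t
  proof -
    let ?v = "\<lambda>s\<in>{..<b 0}. D 0 s t"
    have v: "?v \<in> carrier (free_mod R {..<b 0})" "row_map k {..<b 0} g ?v = \<zero>\<^bsub>k\<^esub>"
      using col[of t 0] t ker0 by auto
    have "(\<Oplus>s\<in>{..<b 0}. ?v s \<otimes> \<gamma> s) = c t" unfolding c_def
      using Dc[of _ 0 t] \<gamma>(1) t by (intro finsum_cong') auto
    then show ?thesis using row[OF v(1)] v(2) cls0[OF cc[OF t]] by simp
  qed
  have DD: "(\<Oplus>t\<in>{..<b 1}. D 0 s t \<otimes> D 1 t t') = \<zero>" if s: "s < b 0" "t' < b 2" for s t'
  proof -
    let ?v = "\<lambda>t\<in>{..<b 1}. D 1 t t'"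
    have "mat_map R {..<b 0} {..<b 1} (D 0) ?v = \<zero>\<^bsub>free_mod R {..<b 0}\<^esub>"
      using col[of t' 1] s(2) ker1 by (auto simp: numeral_2_eq_2)
    then have "(\<Oplus>t\<in>{..<b 1}. D 0 s t \<otimes> ?v t) = \<zero>"
      using s(1) by (auto simp: mat_map_def fun_eq_iff restrict_def split: if_splits)
    moreover have "(\<Oplus>t\<in>{..<b 1}. D 0 s t \<otimes> ?v t) = (\<Oplus>t\<in>{..<b 1}. D 0 s t \<otimes> D 1 t t')"
      using Dc[of s 0] Dc[of _ 1 t'] s by (intro finsum_cong') (auto simp: numeral_2_eq_2)
    ultimately show ?thesis by simp
  qed
  define KM where "KM = restrict_mod W K"
  have KM: "module R KM" unfolding KM_def by (rule module_restrict_mod[OF W K])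
  define C where "C i = direct_sum {..<b i} (\<lambda>_. KM)" for i
  have C: "module R (C i)" for i unfolding C_def by (rule module_direct_sum[OF is_cring KM])
  interpret C1: module R "C 1" by (rule C)
  define d where "d i u = (\<lambda>t\<in>{..<b (Suc i)}. \<Oplus>\<^bsub>KM\<^esub>s\<in>{..<b i}. D i s t \<odot>\<^bsub>KM\<^esub> u s)" for i u
  have dh: "d i \<in> mod_hom R (C i) (C (Suc i))" for i
    unfolding d_def[abs_def] C_def using Dc by (intro coboundary_hom[OF KM]) auto
  have Cc: "u s \<in> K" if "u \<in> carrier (C i)" "s < b i" for u i s using that by (auto simp: C_def KM_def)
  \<comment> \<open>The coboundary with values in \<open>W\<close>, which extends \<open>d\<close>.
    A cocycle in \<open>K\<close> may become a coboundary over \<open>W\<close> only, and this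
    difference detects the elements of \<open>(K : \<mm>)\<close> outside \<open>K\<close>.\<close>
  define dW where "dW i u t = (\<Oplus>\<^bsub>W\<^esub>s\<in>{..<b i}. D i s t \<odot>\<^bsub>W\<^esub> u s)" for i u t
  have ddW: "d i u t = dW i u t" if "u \<in> carrier (C i)" "t < b (Suc i)" for i u t
  proof -
    have "finsum (restrict_mod W K) (\<lambda>s. D i s t \<odot>\<^bsub>W\<^esub> u s) {..<b i} = finsum W (\<lambda>s. D i s t \<odot>\<^bsub>W\<^esub> u s) {..<b i}"
      using Dc Cc[OF that(1)] that(2) K'(7) by (intro finsum_restrict_mod[OF W K]) auto
    then show ?thesis using that(2) by (simp add: d_def dW_def KM_def)
  qed
  have dWdW: "(\<Oplus>\<^bsub>W\<^esub>t\<in>{..<b 1}. D 1 t t' \<odot>\<^bsub>W\<^esub> dW 0 u t) = \<zero>\<^bsub>W\<^esub>"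
    if u: "u \<in> {..<b 0} \<rightarrow> carrier W" and t': "t' < b 2" for u t'
  proof -
    have "(\<Oplus>\<^bsub>W\<^esub>t\<in>{..<b 1}. D 1 t t' \<odot>\<^bsub>W\<^esub> dW 0 u t) =
        (\<Oplus>\<^bsub>W\<^esub>s\<in>{..<b 0}. (\<Oplus>t\<in>{..<b 1}. D 0 s t \<otimes> D 1 t t') \<odot>\<^bsub>W\<^esub> u s)"
      unfolding dW_def using Dc[of _ 0] Dc[of _ 1 t'] t' u
      by (intro W.finsum_smult_swap) (auto simp: numeral_2_eq_2)
    also have "\<dots> = (\<Oplus>\<^bsub>W\<^esub>s\<in>{..<b 0}. \<zero>\<^bsub>W\<^esub>)"
      using DD[OF _ t'] u by (intro W.finsum_cong' refl) (auto simp: Pi_iff)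
    finally show ?thesis by simp
  qed
  define Z where "Z = {u \<in> carrier (C 1). d 1 u = \<zero>\<^bsub>C 2\<^esub>}"
  define B where "B = d 0 ` carrier (C 0)"
  have Ext: "Ext R 1 k KM = mod_quot (restrict_mod (C 1) Z) B"
    unfolding Ext_def F(2) Ext_of_res_def Z_def B_def C_def d_def[abs_def]
    by (simp add: Let_def numeral_2_eq_2)
  have Zs: "submodule Z R (C 1)" unfolding Z_def using mod_hom_kernel_submodule[OF C C dh[of 1]]
    by (simp add: numeral_2_eq_2)
  have Bs: "submodule B R (C 1)" unfolding B_def
    using mod_hom_image_submodule[OF C C dh[of 0] module.carrier_is_submodule[OF C]] by simp
  have ZI: "u \<in> Z" if u: "u \<in> carrier (C 1)" "\<And>t'. t' < b 2 \<Longrightarrow> (\<Oplus>\<^bsub>W\<^esub>t\<in>{..<b 1}. D 1 t t' \<odot>\<^bsub>W\<^esub> u t) = \<zero>\<^bsub>W\<^esub>" for u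
  proof -
    have "d 1 u t' = \<zero>\<^bsub>W\<^esub>" if "t' < b 2" for t'
      using ddW[OF u(1)] u(2) that by (simp add: dW_def numeral_2_eq_2)
    moreover have "d 1 u \<in> extensional {..<b 2}" by (simp add: d_def numeral_2_eq_2)
    ultimately have "d 1 u = (\<lambda>t'\<in>{..<b 2}. \<zero>\<^bsub>W\<^esub>)"
      by (auto simp: extensional_def fun_eq_iff restrict_def)
    then show ?thesis using u(1) by (simp add: Z_def C_def KM_def)
  qed
  have BZ: "B \<subseteq> Z"
  proof
    fix \<beta> assume "\<beta> \<in> B"
    then obtain w where w: "w \<in> carrier (C 0)" "\<beta> = d 0 w" by (auto simp: B_def)
    have wc: "w s \<in> carrier W" if "s < b 0" for s using Cc[OF w(1) that] K'(3) by blast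
    show "\<beta> \<in> Z"
    proof (rule ZI)
      show \<beta>: "\<beta> \<in> carrier (C 1)" using mod_homD(1)[OF dh[of 0] w(1)] w(2) by simp
      fix t' assume t': "t' < b 2"
      have "(\<Oplus>\<^bsub>W\<^esub>t\<in>{..<b 1}. D 1 t t' \<odot>\<^bsub>W\<^esub> \<beta> t) = (\<Oplus>\<^bsub>W\<^esub>t\<in>{..<b 1}. D 1 t t' \<odot>\<^bsub>W\<^esub> dW 0 w t)"
      proof (intro W.finsum_cong' refl)
        fix t assume "t \<in> {..<b 1}"
        then show "D 1 t t' \<odot>\<^bsub>W\<^esub> \<beta> t = D 1 t t' \<odot>\<^bsub>W\<^esub> dW 0 w t" using ddW[OF w(1)] w(2) by simp
      qed (use wc Dc[of _ 0] Dc[of _ 1 t'] t' in \<open>auto simp: dW_def numeral_2_eq_2 intro!: W.smult_closed W.finsum_closed\<close>)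
      also have "\<dots> = \<zero>\<^bsub>W\<^esub>" using wc t' by (intro dWdW) auto
      finally show "(\<Oplus>\<^bsub>W\<^esub>t\<in>{..<b 1}. D 1 t t' \<odot>\<^bsub>W\<^esub> \<beta> t) = \<zero>\<^bsub>W\<^esub>" .
    qed
  qed
  \<comment> \<open>Over \<open>W\<close> this cochain is the coboundary of the family
    \<open>\<gamma> s y\<close>, by \<open>cdW\<close>, hence a cocycle. If
    \<open>\<mm> y \<subseteq> K\<close>, its values are in \<open>K\<close>, because every
    \<open>c t\<close> lies in \<open>\<mm>\<close>.\<close>
  define \<zeta> where "\<zeta> y = (\<lambda>t\<in>{..<b 1}. c t \<odot>\<^bsub>W\<^esub> y)" for y
  have smult_sum: "(\<Oplus>s\<in>S. a s) \<odot>\<^bsub>W\<^esub> y = (\<Oplus>\<^bsub>W\<^esub>s\<in>S. a s \<odot>\<^bsub>W\<^esub> y)"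
    if "a \<in> S \<rightarrow> carrier R" "y \<in> carrier W" for a y and S :: "nat set"
    using that by (intro finsum_hom[OF abelian_group_axioms W.abelian_group_axioms]) (auto simp: W.smult_l_distr)
  have cdW: "dW 0 (\<lambda>s. \<gamma> s \<odot>\<^bsub>W\<^esub> y) t = c t \<odot>\<^bsub>W\<^esub> y" if "y \<in> carrier W" "t < b 1" for y t
  proof -
    have "c t \<odot>\<^bsub>W\<^esub> y = (\<Oplus>\<^bsub>W\<^esub>s\<in>{..<b 0}. (D 0 s t \<otimes> \<gamma> s) \<odot>\<^bsub>W\<^esub> y)"
      unfolding c_def using Dc[of _ 0 t] \<gamma>(1) that by (intro smult_sum) auto
    also have "\<dots> = dW 0 (\<lambda>s. \<gamma> s \<odot>\<^bsub>W\<^esub> y) t" unfolding dW_def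
      using Dc[of _ 0 t] \<gamma>(1) that by (intro W.finsum_cong' refl) (auto simp: W.smult_assoc1)
    finally show ?thesis by simp
  qed
  have \<zeta>Z: "\<zeta> y \<in> Z" if y: "y \<in> carrier W" "\<And>x. x \<in> \<mm> \<Longrightarrow> x \<odot>\<^bsub>W\<^esub> y \<in> K" for y
  proof (rule ZI)
    show "\<zeta> y \<in> carrier (C 1)" using y(2) cm by (auto simp: \<zeta>_def C_def KM_def)
    fix t' assume t': "t' < b 2"
    have "(\<Oplus>\<^bsub>W\<^esub>t\<in>{..<b 1}. D 1 t t' \<odot>\<^bsub>W\<^esub> \<zeta> y t) =
        (\<Oplus>\<^bsub>W\<^esub>t\<in>{..<b 1}. D 1 t t' \<odot>\<^bsub>W\<^esub> dW 0 (\<lambda>s. \<gamma> s \<odot>\<^bsub>W\<^esub> y) t)"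
      using cdW[OF y(1)] cc y(1) Dc[of _ 1 t'] t'
      by (intro W.finsum_cong' refl) (auto simp: \<zeta>_def numeral_2_eq_2)
    also have "\<dots> = \<zero>\<^bsub>W\<^esub>" using t' \<gamma>(1) y(1) by (intro dWdW) auto
    finally show "(\<Oplus>\<^bsub>W\<^esub>t\<in>{..<b 1}. D 1 t t' \<odot>\<^bsub>W\<^esub> \<zeta> y t) = \<zero>\<^bsub>W\<^esub>" .
  qed
  have "cls \<one> \<in> row_map k {..<b 0} g ` carrier (free_mod R {..<b 0})"
    using pres clsc[OF one_closed] unfolding free_presentation_def by blast
  \<comment> \<open>No basis vector need map to the class of one, so a vector \<open>r\<close> that
    does is chosen. Its lifted value \<open>e\<close> is congruent to one modulo
    \<open>\<mm>\<close>, which is all that is used about it.\<close>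
  then obtain r where r: "r \<in> carrier (free_mod R {..<b 0})" "cls \<one> = row_map k {..<b 0} g r" by auto
  have rc: "r s \<in> carrier R" if "s < b 0" for s using r(1) that by auto
  define e where "e = (\<Oplus>s\<in>{..<b 0}. r s \<otimes> \<gamma> s)"
  have ec: "e \<in> carrier R" unfolding e_def using rc \<gamma>(1) by (intro finsum_closed) auto
  have "cls \<one> = cls e" using r row[OF r(1)] e_def by simp
  moreover have "a_inv (reg_module R) e = \<ominus> e" using P.smult_l_minus[of \<one> e] ec by (simp add: l_minus)
  ultimately have e1: "\<one> \<ominus> e \<in> \<mm>"
    using P.mod_coset_eq_iff[OF mms, of \<one> e] ec by (simp add: cls_def a_minus_def)
  define \<rho> where "\<rho> u = (\<Oplus>\<^bsub>W\<^esub>s\<in>{..<b 0}. r s \<odot>\<^bsub>W\<^esub> u s)" for u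
  have \<rho>c: "\<rho> u \<in> carrier W" if "u \<in> {..<b 0} \<rightarrow> carrier W" for u
    unfolding \<rho>_def using rc that by (intro W.finsum_closed) auto
  \<comment> \<open>Up to \<open>\<mm>\<close>-torsion, evaluation at \<open>r\<close> depends on a
    cochain only through its coboundary: for \<open>y\<close> in \<open>\<mm>\<close> the vector
    \<open>y r\<close> maps to zero in the residue field, so by exactness it is a combination of
    columns of \<open>D 0\<close>.\<close>
  have \<rho>: "\<exists>a. a \<in> {..<b 1} \<rightarrow> carrier R \<and>
      (\<forall>u\<in>{..<b 0} \<rightarrow> carrier W. y \<odot>\<^bsub>W\<^esub> \<rho> u = (\<Oplus>\<^bsub>W\<^esub>t\<in>{..<b 1}. a t \<odot>\<^bsub>W\<^esub> dW 0 u t))" if y: "y \<in> \<mm>" for y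
  proof -
    have yc: "y \<in> carrier R" using mm'(3)[OF y] .
    let ?v = "y \<odot>\<^bsub>free_mod R {..<b 0}\<^esub> r"
    have vF: "?v \<in> carrier (free_mod R {..<b 0})" using yc rc by auto
    have "(\<Oplus>s\<in>{..<b 0}. ?v s \<otimes> \<gamma> s) = (\<Oplus>s\<in>{..<b 0}. y \<otimes> (r s \<otimes> \<gamma> s))"
      using yc rc \<gamma>(1) by (intro finsum_cong') (auto simp: m_assoc)
    also have "\<dots> = y \<otimes> e" unfolding e_def
      using yc rc \<gamma>(1) by (intro finsum_rdistr[symmetric]) auto
    finally have "row_map k {..<b 0} g ?v = \<zero>\<^bsub>k\<^esub>"
      unfolding row[OF vF] using cls0[of "y \<otimes> e"] mm'(8)[OF y ec] yc ec by simp
    then have "?v \<in> mat_map R {..<b 0} {..<b 1} (D 0) ` carrier (free_mod R {..<b 1})"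
      unfolding ker0 using vF by blast
    then obtain a where a: "a \<in> carrier (free_mod R {..<b 1})" "?v = mat_map R {..<b 0} {..<b 1} (D 0) a" by blast
    have ac: "a \<in> {..<b 1} \<rightarrow> carrier R" using a(1) by auto
    have eq: "y \<otimes> r s = (\<Oplus>t\<in>{..<b 1}. D 0 s t \<otimes> a t)" if "s < b 0" for s
      using fun_cong[OF a(2), of s] that by (simp add: mat_map_def)
    have "y \<odot>\<^bsub>W\<^esub> \<rho> u = (\<Oplus>\<^bsub>W\<^esub>t\<in>{..<b 1}. a t \<odot>\<^bsub>W\<^esub> dW 0 u t)" if u: "u \<in> {..<b 0} \<rightarrow> carrier W" for u
    proof -
      have "y \<odot>\<^bsub>W\<^esub> \<rho> u = (\<Oplus>\<^bsub>W\<^esub>s\<in>{..<b 0}. y \<odot>\<^bsub>W\<^esub> (r s \<odot>\<^bsub>W\<^esub> u s))"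
        unfolding \<rho>_def using yc rc u by (intro W.finsum_smult_ldistr) auto
      also have "\<dots> = (\<Oplus>\<^bsub>W\<^esub>s\<in>{..<b 0}. (\<Oplus>t\<in>{..<b 1}. D 0 s t \<otimes> a t) \<odot>\<^bsub>W\<^esub> u s)"
      proof (intro W.finsum_cong' refl)
        fix s assume s: "s \<in> {..<b 0}"
        have us: "u s \<in> carrier W" "r s \<in> carrier R" using u rc s by auto
        show "y \<odot>\<^bsub>W\<^esub> (r s \<odot>\<^bsub>W\<^esub> u s) = (\<Oplus>t\<in>{..<b 1}. D 0 s t \<otimes> a t) \<odot>\<^bsub>W\<^esub> u s"
          using eq[of s] s W.smult_assoc1[OF yc us(2,1)] by simp
      qed (use ac u Dc[of _ 0] in \<open>auto intro!: W.smult_closed finsum_closed\<close>)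
      also have "\<dots> = (\<Oplus>\<^bsub>W\<^esub>t\<in>{..<b 1}. a t \<odot>\<^bsub>W\<^esub> dW 0 u t)"
        unfolding dW_def using ac u Dc[of _ 0] by (intro W.finsum_smult_swap[symmetric]) auto
      finally show ?thesis .
    qed
    then show ?thesis using ac by blast
  qed
  \<comment> \<open>If the cocycle of \<open>y\<close> is the coboundary of a cochain
    \<open>w\<close> in \<open>K\<close>, then \<open>e y\<close> and \<open>\<rho> w\<close> differ
    by an element killed by \<open>\<mm>\<close>, so they agree by \<open>nosoc\<close> and
    \<open>e y\<close> is in \<open>K\<close>. The rest \<open>(1 - e) y\<close> is in
    \<open>K\<close> because \<open>1 - e\<close> lies in \<open>\<mm>\<close>.\<close>
  have inj: "y \<in> K" if w: "w \<in> carrier (C 0)" and y: "y \<in> carrier W" "\<And>x. x \<in> \<mm> \<Longrightarrow> x \<odot>\<^bsub>W\<^esub> y \<in> K"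
    and eq: "\<And>t. t < b 1 \<Longrightarrow> c t \<odot>\<^bsub>W\<^esub> y = d 0 w t" for w y
  proof -
    let ?u = "\<lambda>s. \<gamma> s \<odot>\<^bsub>W\<^esub> y"
    have u: "?u \<in> {..<b 0} \<rightarrow> carrier W" using \<gamma>(1) y(1) by auto
    have wK: "w s \<in> K" if "s < b 0" for s using Cc[OF w that] .
    have wc: "w \<in> {..<b 0} \<rightarrow> carrier W" using wK K'(3) by auto
    have same: "dW 0 ?u t = dW 0 w t" if "t < b 1" for t
      using cdW[OF y(1) that] eq[OF that] ddW[OF w] that by simp
    have "\<rho> ?u \<ominus>\<^bsub>W\<^esub> \<rho> w = \<zero>\<^bsub>W\<^esub>"
    proof (rule nosoc)
      show "\<rho> ?u \<ominus>\<^bsub>W\<^esub> \<rho> w \<in> carrier W" using \<rho>c[OF u] \<rho>c[OF wc] by simp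
      fix x assume x: "x \<in> \<mm>"
      obtain a where a: "a \<in> {..<b 1} \<rightarrow> carrier R"
        "\<forall>u\<in>{..<b 0} \<rightarrow> carrier W. x \<odot>\<^bsub>W\<^esub> \<rho> u = (\<Oplus>\<^bsub>W\<^esub>t\<in>{..<b 1}. a t \<odot>\<^bsub>W\<^esub> dW 0 u t)"
        using \<rho>[OF x] by blast
      have dc: "dW 0 w t \<in> carrier W" if "t < b 1" for t
        unfolding dW_def using wc Dc[of _ 0 t] that by (intro W.finsum_closed) auto
      have "(\<Oplus>\<^bsub>W\<^esub>t\<in>{..<b 1}. a t \<odot>\<^bsub>W\<^esub> dW 0 ?u t) = (\<Oplus>\<^bsub>W\<^esub>t\<in>{..<b 1}. a t \<odot>\<^bsub>W\<^esub> dW 0 w t)"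
        using same a(1) dc by (intro W.finsum_cong' refl) auto
      then have "x \<odot>\<^bsub>W\<^esub> \<rho> ?u = x \<odot>\<^bsub>W\<^esub> \<rho> w" using a(2) u wc by metis
      then show "x \<odot>\<^bsub>W\<^esub> (\<rho> ?u \<ominus>\<^bsub>W\<^esub> \<rho> w) = \<zero>\<^bsub>W\<^esub>"
        using mm'(3)[OF x] \<rho>c[OF u] \<rho>c[OF wc]
        by (simp add: W.minus_eq W.smult_r_distr W.smult_r_minus W.M.r_neg)
    qed
    then have "\<ominus>\<^bsub>W\<^esub> (\<ominus>\<^bsub>W\<^esub> \<rho> w) = \<rho> ?u" using \<rho>c[OF u] \<rho>c[OF wc]
      by (intro W.M.minus_equality) (simp_all add: W.minus_eq)
    then have "\<rho> ?u = \<rho> w" using \<rho>c[OF wc] by simp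
    moreover have "\<rho> w \<in> K" unfolding \<rho>_def using wK rc K'(7) by (intro W.submodule_finsum[OF K]) auto
    moreover have "\<rho> ?u = e \<odot>\<^bsub>W\<^esub> y"
    proof -
      have "e \<odot>\<^bsub>W\<^esub> y = (\<Oplus>\<^bsub>W\<^esub>s\<in>{..<b 0}. (r s \<otimes> \<gamma> s) \<odot>\<^bsub>W\<^esub> y)"
        unfolding e_def using rc \<gamma>(1) y(1) by (intro smult_sum) auto
      also have "\<dots> = \<rho> ?u" unfolding \<rho>_def
        using rc \<gamma>(1) y(1) by (intro W.finsum_cong' refl) (auto simp: W.smult_assoc1)
      finally show ?thesis by simp
    qed
    ultimately have "e \<odot>\<^bsub>W\<^esub> y \<in> K" by simp
    moreover have "(\<one> \<ominus> e) \<odot>\<^bsub>W\<^esub> y \<in> K" using y(2)[OF e1] .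
    ultimately have "e \<odot>\<^bsub>W\<^esub> y \<oplus>\<^bsub>W\<^esub> (\<one> \<ominus> e) \<odot>\<^bsub>W\<^esub> y \<in> K" by (rule K'(4))
    moreover have "e \<odot>\<^bsub>W\<^esub> y \<oplus>\<^bsub>W\<^esub> (\<one> \<ominus> e) \<odot>\<^bsub>W\<^esub> y = (e \<oplus> (\<one> \<ominus> e)) \<odot>\<^bsub>W\<^esub> y"
      using ec y(1) by (simp add: W.smult_l_distr)
    moreover have "e \<oplus> (\<one> \<ominus> e) = \<one>" using ec one_closed by algebra
    ultimately show ?thesis using y(1) by simp
  qed
  define ZM where "ZM = restrict_mod (C 1) Z"
  have ZM: "module R ZM" unfolding ZM_def by (rule module_restrict_mod[OF C Zs])
  interpret ZM: plain_module R ZM unfolding plain_module_def by (rule ZM)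
  have BZM: "submodule B R ZM" unfolding ZM_def using submodule_restrict_mod[OF C Zs BZ] Bs by simp
  \<comment> \<open>Adjoining the cocycles of \<open>z\<close> and \<open>z'\<close> to the
    coboundaries gives \<open>B \<subset> H1 \<subseteq> H2\<close>. The first step is strict by
    \<open>inj\<close>, so length one of \<open>Ext\<close> leaves no room for a second strict
    step.\<close>
  define H1 where "H1 = {a \<oplus>\<^bsub>ZM\<^esub> r \<odot>\<^bsub>ZM\<^esub> \<zeta> z | a r. a \<in> B \<and> r \<in> carrier R}"
  define H2 where "H2 = {a \<oplus>\<^bsub>ZM\<^esub> r \<odot>\<^bsub>ZM\<^esub> \<zeta> z' | a r. a \<in> H1 \<and> r \<in> carrier R}"
  have \<zeta>c: "\<zeta> z \<in> carrier ZM" "\<zeta> z' \<in> carrier ZM" using \<zeta>Z z z' by (auto simp: ZM_def)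
  note H1 = ZM.submodule_add_multiples[OF BZM \<zeta>c(1), folded H1_def]
  note H2 = ZM.submodule_add_multiples[OF H1(1) \<zeta>c(2), folded H2_def]
  have "\<zeta> z \<notin> B"
  proof
    assume "\<zeta> z \<in> B"
    then obtain w where w: "w \<in> carrier (C 0)" "\<zeta> z = d 0 w" by (auto simp: B_def)
    have "c t \<odot>\<^bsub>W\<^esub> z = d 0 w t" if "t < b 1" for t using fun_cong[OF w(2), of t] that by (simp add: \<zeta>_def)
    then show False using inj[OF w(1) z(1,2)] z(3) by blast
  qed
  have "\<not> H1 \<subset> H2"
  proof
    assume H12: "H1 \<subset> H2"
    let ?H = "\<lambda>i::nat. if i = 0 then B else if i = 1 then H1 else H2"
    have "enat 2 \<le> mod_length R (mod_quot ZM B)"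
    proof (rule ZM.mod_length_quot_ge[OF BZM, of _ ?H])
      show "submodule (?H i) R ZM" for i using BZM H1 H2 by simp
      show "B \<subseteq> ?H i" for i using H1 H2 by auto
      show "?H i \<subset> ?H (Suc i)" if "i < 2" for i
        using that H12 H1(2,3) \<open>\<zeta> z \<notin> B\<close> by (auto simp: less_2_cases_iff)
    qed
    moreover have "mod_length R (mod_quot ZM B) = 1"
      using len Ext by (simp add: ZM_def KM_def k_def)
    ultimately show False by (simp add: one_enat_def)
  qed
  then have "\<zeta> z' \<in> H1" using H2 by blast
  then obtain \<beta> q where \<beta>: "\<beta> \<in> B" "q \<in> carrier R" "\<zeta> z' = \<beta> \<oplus>\<^bsub>ZM\<^esub> q \<odot>\<^bsub>ZM\<^esub> \<zeta> z" by (auto simp: H1_def)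
  obtain w where w: "w \<in> carrier (C 0)" "\<beta> = d 0 w" using \<beta>(1) by (auto simp: B_def)
  have "z' \<ominus>\<^bsub>W\<^esub> q \<odot>\<^bsub>W\<^esub> z \<in> K"
  proof (rule inj[OF w(1)])
    show "z' \<ominus>\<^bsub>W\<^esub> q \<odot>\<^bsub>W\<^esub> z \<in> carrier W" using z z' \<beta>(2) by simp
    have smul: "a \<odot>\<^bsub>W\<^esub> (z' \<ominus>\<^bsub>W\<^esub> q \<odot>\<^bsub>W\<^esub> z) = a \<odot>\<^bsub>W\<^esub> z' \<ominus>\<^bsub>W\<^esub> q \<odot>\<^bsub>W\<^esub> (a \<odot>\<^bsub>W\<^esub> z)" if "a \<in> carrier R" for a
      using z(1) z'(1) \<beta>(2) that
      by (simp add: W.minus_eq W.smult_r_distr W.smult_r_minus m_comm flip: W.smult_assoc1)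
    show "x \<odot>\<^bsub>W\<^esub> (z' \<ominus>\<^bsub>W\<^esub> q \<odot>\<^bsub>W\<^esub> z) \<in> K" if "x \<in> \<mm>" for x
      using smul[OF mm'(3)[OF that]] K'(6)[OF z'(2)[OF that] K'(7)[OF z(2)[OF that] \<beta>(2)]] by simp
    fix t assume t: "t < b 1"
    have dc: "d 0 w t \<in> carrier W" using mod_homD(1)[OF dh[of 0] w(1)] t Cc[of "d 0 w" 1 t] K'(3) by auto
    have "c t \<odot>\<^bsub>W\<^esub> z' = d 0 w t \<oplus>\<^bsub>W\<^esub> q \<odot>\<^bsub>W\<^esub> (c t \<odot>\<^bsub>W\<^esub> z)"
      using fun_cong[OF \<beta>(3), of t] t w(2) by (simp add: \<zeta>_def ZM_def C_def KM_def)
    then show "c t \<odot>\<^bsub>W\<^esub> (z' \<ominus>\<^bsub>W\<^esub> q \<odot>\<^bsub>W\<^esub> z) = d 0 w t"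
      unfolding smul[OF cc[OF t]] using dc cc[OF t] z(1) \<beta>(2) by (simp add: W.minus_eq W.M.a_assoc W.M.r_neg)
  qed
  then show ?thesis using \<beta>(2) by blast
qed

end

section \<open>The presentation matrix\<close>

lemma finite_blocks: "finite (blocks n L)"
proof -
  have "blocks n L \<subseteq> (\<Union>k\<in>{1..n}. {k} \<times> {1..L k})" by (auto simp: blocks_def)
  then show ?thesis by (rule finite_subset) auto
qed

lemma finite_pres_cols: "finite (pres_cols n L l q)"
  by (auto simp: pres_cols_def finite_blocks)

lemma finite_pres_rows: "finite (pres_rows n L)"
  by (auto simp: pres_rows_def finite_blocks)

lemma (in abelian_monoid) finsum_times:
  assumes "finite B" "finite S" "\<And>p j. p \<in> B \<Longrightarrow> j \<in> S \<Longrightarrow> h p j \<in> carrier G"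
  shows "(\<Oplus>x\<in>B \<times> S. h (fst x) (snd x)) = (\<Oplus>p\<in>B. \<Oplus>j\<in>S. h p j)"
  using assms(1,3)
proof (induction B)
  case (insert p B)
  have "(\<Oplus>x\<in>insert p B \<times> S. h (fst x) (snd x)) = (\<Oplus>x\<in>Pair p ` S \<union> B \<times> S. h (fst x) (snd x))"
    by (intro arg_cong[where f = "finsum G _"]) auto
  also have "\<dots> = (\<Oplus>x\<in>Pair p ` S. h (fst x) (snd x)) \<oplus> (\<Oplus>x\<in>B \<times> S. h (fst x) (snd x))"
    using insert assms(2) by (intro finsum_Un_disjoint) auto
  also have "(\<Oplus>x\<in>Pair p ` S. h (fst x) (snd x)) = (\<Oplus>j\<in>S. h p j)"
    using insert by (subst finsum_reindex) (auto simp: inj_on_def)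
  also have "(\<Oplus>x\<in>B \<times> S. h (fst x) (snd x)) = (\<Oplus>p\<in>B. \<Oplus>j\<in>S. h p j)" using insert by auto
  also have "(\<Oplus>j\<in>S. h p j) \<oplus> (\<Oplus>p\<in>B. \<Oplus>j\<in>S. h p j) = (\<Oplus>p\<in>insert p B. \<Oplus>j\<in>S. h p j)"
    using insert by (intro finsum_insert[symmetric]) auto
  finally show ?case .
qed simp

lemma (in abelian_monoid) finsum_single:
  assumes "finite B" "p \<in> B" "h p \<in> carrier G" "\<And>p'. p' \<in> B \<Longrightarrow> p' \<noteq> p \<Longrightarrow> h p' = \<zero>"
  shows "(\<Oplus>p'\<in>B. h p') = h p"
proof -
  have "(\<Oplus>p'\<in>B. h p') = (\<Oplus>p'\<in>B. if p = p' then h p' else \<zero>)"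
    using assms by (intro finsum_cong') auto
  also have "\<dots> = (\<Oplus>p'\<in>B. if p = p' then h p else \<zero>)" using assms by (intro finsum_cong') auto
  also have "\<dots> = h p" using assms finsum_singleton[of p B "\<lambda>_. h p"] by auto
  finally show ?thesis .
qed

context cring
begin

lemma ideal_first_pow_ideal:
  assumes "X \<in> {1..l} \<rightarrow> carrier R"
  shows "first_pow R X k \<in> {1..l} \<rightarrow> carrier R" "ideal (first_pow_ideal R l X k) R"
    and "j \<in> {1..l} \<Longrightarrow> first_pow R X k j \<in> first_pow_ideal R l X k"
proof -
  show *: "first_pow R X k \<in> {1..l} \<rightarrow> carrier R"
    using assms by (auto simp: first_pow_def Pi_iff)
  show "ideal (first_pow_ideal R l X k) R" unfolding first_pow_ideal_def
    using * by (intro genideal_ideal) auto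
  show "j \<in> {1..l} \<Longrightarrow> first_pow R X k j \<in> first_pow_ideal R l X k" unfolding first_pow_ideal_def
    using genideal_self[OF funcset_image[OF *]] by blast
qed

lemma finsum_pres_cols:
  assumes h: "\<And>p j. p \<in> blocks n L \<Longrightarrow> j \<in> {1..l} \<Longrightarrow> h (Inl (p, j)) \<in> carrier R"
    "\<And>s. s \<in> {1..q} \<Longrightarrow> h (Inr s) \<in> carrier R"
  shows "(\<Oplus>x\<in>pres_cols n L l q. h x) =
    (\<Oplus>p\<in>blocks n L. \<Oplus>j\<in>{1..l}. h (Inl (p, j))) \<oplus> (\<Oplus>s\<in>{1..q}. h (Inr s))"
proof -
  have "(\<Oplus>x\<in>pres_cols n L l q. h x) =
    (\<Oplus>x\<in>Inl ` (blocks n L \<times> {1..l}). h x) \<oplus> (\<Oplus>x\<in>Inr ` {1..q}. h x)"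
    unfolding pres_cols_def using h by (intro finsum_Un_disjoint) (auto simp: finite_blocks)
  also have "(\<Oplus>x\<in>Inl ` (blocks n L \<times> {1..l}). h x) = (\<Oplus>x\<in>blocks n L \<times> {1..l}. h (Inl (fst x, snd x)))"
    using h by (subst finsum_reindex) (auto simp: inj_on_def case_prod_unfold)
  also have "\<dots> = (\<Oplus>p\<in>blocks n L. \<Oplus>j\<in>{1..l}. h (Inl (p, j)))"
    using h by (intro finsum_times) (auto simp: finite_blocks)
  also have "(\<Oplus>x\<in>Inr ` {1..q}. h x) = (\<Oplus>s\<in>{1..q}. h (Inr s))"
    using h by (subst finsum_reindex) auto
  finally show ?thesis .
qed

text \<open>The defining equations match on explicit pairs; these forms also apply to a block index
  that has not been split.\<close>

lemma pres_M_None: "pres_M R X A c None (Inl (p, j)) = A (fst p) (snd p) j"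
  and pres_M_Some: "pres_M R X A c (Some p) (Inl (p', j)) = (if p = p' then first_pow R X (fst p) j else \<zero>)"
  and pres_M_Inr: "pres_M R X A c (Some p) (Inr s) = \<zero>"
  by (cases p; cases p'; simp)+

lemma mat_map_pres_M:
  assumes X: "X \<in> {1..l} \<rightarrow> carrier R"
    and A: "\<And>k i j. (k, i) \<in> blocks n L \<Longrightarrow> j \<in> {1..l} \<Longrightarrow> A k i j \<in> carrier R"
    and c: "\<And>s. s \<in> {1..q} \<Longrightarrow> c s \<in> carrier R"
    and w: "w \<in> carrier (free_mod R (pres_cols n L l q))"
  shows "mat_map R (pres_rows n L) (pres_cols n L l q) (pres_M R X A c) w None =
      (\<Oplus>p\<in>blocks n L. \<Oplus>j\<in>{1..l}. w (Inl (p, j)) \<otimes> A (fst p) (snd p) j) \<oplus> (\<Oplus>s\<in>{1..q}. w (Inr s) \<otimes> c s)"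
    and "p \<in> blocks n L \<Longrightarrow> mat_map R (pres_rows n L) (pres_cols n L l q) (pres_M R X A c) w (Some p) =
      (\<Oplus>j\<in>{1..l}. w (Inl (p, j)) \<otimes> first_pow R X (fst p) j)"
proof -
  have wc: "w (Inl (p, j)) \<in> carrier R" if "p \<in> blocks n L" "j \<in> {1..l}" for p j
    using w that by (auto simp: pres_cols_def PiE_iff)
  have wc2: "w (Inr s) \<in> carrier R" if "s \<in> {1..q}" for s
    using w that by (auto simp: pres_cols_def PiE_iff)
  have A': "A (fst p) (snd p) j \<in> carrier R" if "p \<in> blocks n L" "j \<in> {1..l}" for p j
    using A[of "fst p" "snd p" j] that by simp
  have Y: "first_pow R X k j \<in> carrier R" if "j \<in> {1..l}" for k j
    using Pi_mem[OF ideal_first_pow_ideal(1)[OF X] that] .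
  have "mat_map R (pres_rows n L) (pres_cols n L l q) (pres_M R X A c) w None =
     (\<Oplus>x\<in>pres_cols n L l q. pres_M R X A c None x \<otimes> w x)"
    by (simp add: mat_map_def pres_rows_def)
  also have "\<dots> = (\<Oplus>p\<in>blocks n L. \<Oplus>j\<in>{1..l}. A (fst p) (snd p) j \<otimes> w (Inl (p, j))) \<oplus> (\<Oplus>s\<in>{1..q}. c s \<otimes> w (Inr s))"
    using A' wc wc2 c by (subst finsum_pres_cols) (auto simp: pres_M_None)
  also have "(\<Oplus>p\<in>blocks n L. \<Oplus>j\<in>{1..l}. A (fst p) (snd p) j \<otimes> w (Inl (p, j))) =
     (\<Oplus>p\<in>blocks n L. \<Oplus>j\<in>{1..l}. w (Inl (p, j)) \<otimes> A (fst p) (snd p) j)"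
    using A' wc by (intro finsum_cong' refl m_comm) (auto intro!: finsum_closed)
  also have "(\<Oplus>s\<in>{1..q}. c s \<otimes> w (Inr s)) = (\<Oplus>s\<in>{1..q}. w (Inr s) \<otimes> c s)"
    using c wc2 by (intro finsum_cong' refl m_comm) auto
  finally show "mat_map R (pres_rows n L) (pres_cols n L l q) (pres_M R X A c) w None =
      (\<Oplus>p\<in>blocks n L. \<Oplus>j\<in>{1..l}. w (Inl (p, j)) \<otimes> A (fst p) (snd p) j) \<oplus> (\<Oplus>s\<in>{1..q}. w (Inr s) \<otimes> c s)" .
  assume p: "p \<in> blocks n L"
  have "mat_map R (pres_rows n L) (pres_cols n L l q) (pres_M R X A c) w (Some p) =
     (\<Oplus>x\<in>pres_cols n L l q. pres_M R X A c (Some p) x \<otimes> w x)"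
    using p by (simp add: mat_map_def pres_rows_def)
  also have "\<dots> = (\<Oplus>p'\<in>blocks n L. \<Oplus>j\<in>{1..l}. pres_M R X A c (Some p) (Inl (p', j)) \<otimes> w (Inl (p', j)))
      \<oplus> (\<Oplus>s\<in>{1..q}. pres_M R X A c (Some p) (Inr s) \<otimes> w (Inr s))"
    using Y wc wc2 by (intro finsum_pres_cols) (simp_all add: pres_M_Some pres_M_Inr)
  also have "(\<Oplus>s\<in>{1..q}. pres_M R X A c (Some p) (Inr s) \<otimes> w (Inr s)) = (\<Oplus>s\<in>{1..q}. \<zero>)"
    using wc2 by (intro finsum_cong' refl) (simp_all add: pres_M_Inr)
  also have "(\<Oplus>p'\<in>blocks n L. \<Oplus>j\<in>{1..l}. pres_M R X A c (Some p) (Inl (p', j)) \<otimes> w (Inl (p', j))) =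
      (\<Oplus>j\<in>{1..l}. pres_M R X A c (Some p) (Inl (p, j)) \<otimes> w (Inl (p, j)))"
  proof (rule finsum_single[OF finite_blocks p])
    show "(\<Oplus>j\<in>{1..l}. pres_M R X A c (Some p) (Inl (p, j)) \<otimes> w (Inl (p, j))) \<in> carrier R"
      using Y wc[OF p] by (intro finsum_closed) (auto simp: pres_M_Some)
    fix p' assume "p' \<in> blocks n L" "p' \<noteq> p"
    then have "(\<Oplus>j\<in>{1..l}. pres_M R X A c (Some p) (Inl (p', j)) \<otimes> w (Inl (p', j))) = (\<Oplus>j\<in>{1..l}. \<zero>)"
      using wc[of p'] by (intro finsum_cong' refl) (auto simp: pres_M_Some)
    then show "(\<Oplus>j\<in>{1..l}. pres_M R X A c (Some p) (Inl (p', j)) \<otimes> w (Inl (p', j))) = \<zero>" by simp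
  qed
  also have "(\<Oplus>j\<in>{1..l}. pres_M R X A c (Some p) (Inl (p, j)) \<otimes> w (Inl (p, j))) =
      (\<Oplus>j\<in>{1..l}. w (Inl (p, j)) \<otimes> first_pow R X (fst p) j)"
    using Y wc[OF p] by (intro finsum_cong' refl) (auto simp: pres_M_Some m_comm)
  also have "\<dots> \<oplus> (\<Oplus>s\<in>{1..q}. \<zero>) = \<dots>" using Y wc[OF p] by (simp add: Pi_iff)
  finally show "mat_map R (pres_rows n L) (pres_cols n L l q) (pres_M R X A c) w (Some p) =
      (\<Oplus>j\<in>{1..l}. w (Inl (p, j)) \<otimes> first_pow R X (fst p) j)" .
qed

end

lemma finsum_pres_rows:
  assumes "abelian_group M" "\<And>p. p \<in> pres_rows n L \<Longrightarrow> h p \<in> carrier M"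
  shows "(\<Oplus>\<^bsub>M\<^esub>p\<in>pres_rows n L. h p) = h None \<oplus>\<^bsub>M\<^esub> (\<Oplus>\<^bsub>M\<^esub>p\<in>blocks n L. h (Some p))"
proof -
  interpret M: abelian_group M by fact
  have "(\<Oplus>\<^bsub>M\<^esub>p\<in>pres_rows n L. h p) = h None \<oplus>\<^bsub>M\<^esub> (\<Oplus>\<^bsub>M\<^esub>p\<in>Some ` blocks n L. h p)"
    unfolding pres_rows_def using assms(2) by (intro M.finsum_insert) (auto simp: pres_rows_def finite_blocks)
  also have "(\<Oplus>\<^bsub>M\<^esub>p\<in>Some ` blocks n L. h p) = (\<Oplus>\<^bsub>M\<^esub>p\<in>blocks n L. h (Some p))"
    using assms(2) by (intro M.finsum_reindex) (auto simp: pres_rows_def)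
  finally show ?thesis .
qed

section \<open>Relative generators and exactness of the presentation, as linear algebra over a local
  ring\<close>

context noetherian_cring
begin

text \<open>The number \<open>q\<close> is chosen minimal, so no unit occurs in a relation modulo \<open>B\<close>.\<close>

lemma minimal_relative_generators:
  assumes a: "ideal \<aa> R" and B: "ideal B R" "B \<subseteq> \<aa>" and units: "carrier R - M \<subseteq> Units R"
  obtains q :: nat and c where "\<And>s. s \<in> {1..q} \<Longrightarrow> c s \<in> \<aa>" "\<aa> = B <+>\<^bsub>R\<^esub> Idl (c ` {1..q})"
    "\<And>w. w \<in> {1..q} \<rightarrow> carrier R \<Longrightarrow> (\<Oplus>s\<in>{1..q}. w s \<otimes> c s) \<in> B \<Longrightarrow> \<forall>s\<in>{1..q}. w s \<in> M"
proof -
  note B' = ideal_rules[OF B(1)] and a' = ideal_rules[OF a]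
  define P where "P S \<longleftrightarrow> S \<subseteq> \<aa> \<and> finite S \<and> \<aa> \<subseteq> B <+>\<^bsub>R\<^esub> Idl S" for S
  obtain S0 where "S0 \<subseteq> carrier R" "finite S0" "\<aa> = Idl S0" using finetely_gen[OF a] by blast
  moreover have "Idl S0 \<subseteq> B <+>\<^bsub>R\<^esub> Idl S0"
  proof
    fix t assume t: "t \<in> Idl S0"
    then have "t = \<zero> \<oplus> t" using a'(3) \<open>\<aa> = Idl S0\<close> by simp
    then show "t \<in> B <+>\<^bsub>R\<^esub> Idl S0" using t B'(2) unfolding set_add_def' by blast
  qed
  ultimately have "P S0" unfolding P_def using genideal_self[of S0] by auto
  then obtain S where S: "P S" "\<And>S'. P S' \<Longrightarrow> card S \<le> card S'"
    using ex_has_least_nat[of P S0 card] by blast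
  have SP: "S \<subseteq> \<aa>" "finite S" "\<aa> \<subseteq> B <+>\<^bsub>R\<^esub> Idl S" using S(1) by (auto simp: P_def)
  have Sc: "S \<subseteq> carrier R" using SP(1) a'(1) by auto
  obtain c where c: "bij_betw c {1..card S} S"
    using ex_bij_betw_nat_finite_1[OF SP(2)] by blast
  have cS: "c ` {1..card S} = S" using c by (simp add: bij_betw_def)
  show ?thesis
  proof (rule that[of "card S" c])
    show "c s \<in> \<aa>" if "s \<in> {1..card S}" for s using that cS SP(1) by auto
    have "Idl S \<subseteq> \<aa>" using SP(1) by (rule genideal_minimal[OF a])
    then have "B <+>\<^bsub>R\<^esub> Idl S \<subseteq> \<aa>" using B(2) a'(4) unfolding set_add_def' by blast
    then show "\<aa> = B <+>\<^bsub>R\<^esub> Idl (c ` {1..card S})" using SP(3) cS by auto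
  next
    fix w assume w: "w \<in> {1..card S} \<rightarrow> carrier R" "(\<Oplus>s\<in>{1..card S}. w s \<otimes> c s) \<in> B"
    show "\<forall>s\<in>{1..card S}. w s \<in> M"
    proof (rule ccontr)
      assume "\<not> ?thesis"
      then obtain s0 where s0: "s0 \<in> {1..card S}" "w s0 \<notin> M" by auto
      then have u: "w s0 \<in> Units R" using units w(1) by auto
      let ?S' = "S - {c s0}"
      have "c ` ({1..card S} - {s0}) = c ` {1..card S} - c ` {s0}"
        using c s0(1) by (intro inj_on_image_set_diff[of _ "{1..card S}"]) (auto simp: bij_betw_def)
      then have c': "c ` ({1..card S} - {s0}) = ?S'" unfolding cS by simp
      have S'c: "?S' \<subseteq> carrier R" using Sc by auto
      have i': "ideal (B <+>\<^bsub>R\<^esub> Idl ?S') R" by (rule add_ideals[OF B(1) genideal_ideal[OF S'c]])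
      have sub: "B \<subseteq> B <+>\<^bsub>R\<^esub> Idl ?S'" "Idl ?S' \<subseteq> B <+>\<^bsub>R\<^esub> Idl ?S'"
      proof -
        note g = ideal_rules[OF genideal_ideal[OF S'c]]
        show "B \<subseteq> B <+>\<^bsub>R\<^esub> Idl ?S'"
        proof
          fix t assume "t \<in> B"
          then have "t = t \<oplus> \<zero>" using B'(3) by simp
          then show "t \<in> B <+>\<^bsub>R\<^esub> Idl ?S'" using \<open>t \<in> B\<close> g(2) unfolding set_add_def' by blast
        qed
        show "Idl ?S' \<subseteq> B <+>\<^bsub>R\<^esub> Idl ?S'"
        proof
          fix t assume "t \<in> Idl ?S'"
          then have "t = \<zero> \<oplus> t" using g(3) by simp
          then show "t \<in> B <+>\<^bsub>R\<^esub> Idl ?S'" using \<open>t \<in> Idl ?S'\<close> B'(2) unfolding set_add_def' by blast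
        qed
      qed
      have cc: "c s \<in> carrier R" "w s \<in> carrier R" if "s \<in> {1..card S}" for s
        using that cS Sc w(1) by auto
      have "(\<Oplus>s\<in>{1..card S}. w s \<otimes> c s) = w s0 \<otimes> c s0 \<oplus> (\<Oplus>s\<in>{1..card S} - {s0}. w s \<otimes> c s)"
      proof -
        have "{1..card S} = insert s0 ({1..card S} - {s0})" using s0 by auto
        then have "(\<Oplus>s\<in>{1..card S}. w s \<otimes> c s) = (\<Oplus>s\<in>insert s0 ({1..card S} - {s0}). w s \<otimes> c s)"
          by simp
        also have "\<dots> = w s0 \<otimes> c s0 \<oplus> (\<Oplus>s\<in>{1..card S} - {s0}. w s \<otimes> c s)"
          using cc s0 by (intro finsum_insert) auto
        finally show ?thesis .
      qed
      moreover have rest: "(\<Oplus>s\<in>{1..card S} - {s0}. w s \<otimes> c s) \<in> B <+>\<^bsub>R\<^esub> Idl ?S'"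
      proof (rule ideal_finsum[OF i'])
        fix s assume s: "s \<in> {1..card S} - {s0}"
        then have "c s \<in> ?S'" using c' by blast
        then have "c s \<in> B <+>\<^bsub>R\<^esub> Idl ?S'" using sub(2) genideal_self[OF S'c] by blast
        then show "w s \<otimes> c s \<in> B <+>\<^bsub>R\<^esub> Idl ?S'" using ideal_rules(7)[OF i'] cc(2)[of s] s by auto
      qed
      ultimately have "(\<Oplus>s\<in>{1..card S} - {s0}. w s \<otimes> c s) \<oplus> w s0 \<otimes> c s0 \<in> B <+>\<^bsub>R\<^esub> Idl ?S'"
        using w(2) sub(1) cc[OF s0(1)] ideal_rules(3)[OF i' rest] by (auto simp: a_comm)
      then have "w s0 \<otimes> c s0 \<in> B <+>\<^bsub>R\<^esub> Idl ?S'"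
        using ideal_add_cancel[OF i' rest] cc[OF s0(1)] by auto
      then have "inv (w s0) \<otimes> (w s0 \<otimes> c s0) \<in> B <+>\<^bsub>R\<^esub> Idl ?S'"
        using ideal_rules(7)[OF i'] u by auto
      then have c0: "c s0 \<in> B <+>\<^bsub>R\<^esub> Idl ?S'"
        using u cc[OF s0(1)] by (simp add: m_assoc[symmetric])
      have "S \<subseteq> B <+>\<^bsub>R\<^esub> Idl ?S'"
        using c0 sub(2) genideal_self[OF S'c] by blast
      then have "Idl S \<subseteq> B <+>\<^bsub>R\<^esub> Idl ?S'" by (rule genideal_minimal[OF i'])
      then have "B <+>\<^bsub>R\<^esub> Idl S \<subseteq> B <+>\<^bsub>R\<^esub> Idl ?S'"
        using sub(1) ideal_rules(4)[OF i'] unfolding set_add_def'[of R B "Idl S"] by blast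
      then have "P ?S'" using SP by (auto simp: P_def)
      moreover have "card ?S' < card S" using s0 cS SP(2) by (intro psubset_card_mono) auto
      ultimately show False using S(2) by fastforce
    qed
  qed
qed

end

lemma (in abelian_group) minus_add_eq_zero_iff:
  assumes "a \<in> carrier G" "b \<in> carrier G"
  shows "\<ominus> a \<oplus> b = \<zero> \<longleftrightarrow> b = a"
proof
  assume "\<ominus> a \<oplus> b = \<zero>"
  then have "\<ominus> b = \<ominus> a" using assms by (intro minus_equality) auto
  then show "b = a" using assms minus_minus[of a] minus_minus[of b] by simp
qed (use assms in \<open>simp add: l_neg\<close>)

context noetherian_cring
begin

text \<open>The ring theory of \<open>K\<close> is abstracted away: \<open>e\<close> stands for the
  unit element, with annihilator \<open>\<aa>\<close>; \<open>indep\<close> records the direct sum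
  decomposition modulo \<open>e\<close>, and \<open>koszul\<close> the regularity of the parameters.
  What remains is that the columns generate all relations and that kernel vectors of both maps have
  their entries in \<open>M\<close>.\<close>

lemma minimal_presentation:
  fixes KM :: "('a, 'w) module" and A :: "nat \<Rightarrow> nat \<Rightarrow> nat \<Rightarrow> 'a" and n l :: nat
  assumes KM: "module R KM" and e: "e \<in> carrier KM"
    and f: "\<And>p. p \<in> blocks n L \<Longrightarrow> f (fst p) (snd p) \<in> carrier KM"
    and N: "N None = \<ominus>\<^bsub>KM\<^esub> e" "\<And>p. N (Some p) = f (fst p) (snd p)"
    and gen: "mod_span R KM (N ` pres_rows n L) = carrier KM"
    and \<aa>: "ideal \<aa> R" "\<aa> \<subseteq> M" "\<And>t. t \<in> carrier R \<Longrightarrow> t \<odot>\<^bsub>KM\<^esub> e = \<zero>\<^bsub>KM\<^esub> \<longleftrightarrow> t \<in> \<aa>"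
    and M: "ideal M R" "max_ideal R = M" "carrier R - M \<subseteq> Units R"
    and X: "X \<in> {1..l} \<rightarrow> carrier R" "\<And>k. k \<in> {1..n} \<Longrightarrow> first_pow_ideal R l X k \<subseteq> M"
    and A: "\<And>p j. p \<in> blocks n L \<Longrightarrow> j \<in> {1..l} \<Longrightarrow> A (fst p) (snd p) j \<in> M"
    and rel: "\<And>p j. p \<in> blocks n L \<Longrightarrow> j \<in> {1..l} \<Longrightarrow>
      first_pow R X (fst p) j \<odot>\<^bsub>KM\<^esub> f (fst p) (snd p) = A (fst p) (snd p) j \<odot>\<^bsub>KM\<^esub> e"
    and indep: "\<And>t t0. t \<in> blocks n L \<rightarrow> carrier R \<Longrightarrow> t0 \<in> carrier R \<Longrightarrow>
      (\<Oplus>\<^bsub>KM\<^esub>p\<in>blocks n L. t p \<odot>\<^bsub>KM\<^esub> f (fst p) (snd p)) = t0 \<odot>\<^bsub>KM\<^esub> e \<Longrightarrow>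
      \<forall>p\<in>blocks n L. t p \<in> first_pow_ideal R l X (fst p)"
    and koszul: "\<And>k w a. k \<in> {1..n} \<Longrightarrow> w \<in> {1..l} \<rightarrow> carrier R \<Longrightarrow> a \<in> {1..l} \<rightarrow> carrier R \<Longrightarrow>
      (\<Oplus>j\<in>{1..l}. w j \<otimes> first_pow R X k j) = \<zero> \<Longrightarrow>
      (\<forall>j\<in>{1..l}. w j \<in> M) \<and> (\<Oplus>j\<in>{1..l}. w j \<otimes> a j) \<in> I2 R l a (first_pow R X k)"
  shows "\<exists>q c. minimal_free_presentation R KM (pres_rows n L) (pres_cols n L l q) (pres_M R X A c) N \<and>
    (\<forall>s\<in>{1..q}. c s \<in> M) \<and>
    \<aa> = ideal_sum R (blocks n L) (\<lambda>(i, j). I2 R l (A i j) (first_pow R X i)) <+>\<^bsub>R\<^esub> genideal R (c ` {1..q})"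
proof -
  interpret K: module R KM by fact
  note M' = ideal_rules[OF M(1)] and a' = ideal_rules[OF \<aa>(1)]
  let ?B = "blocks n L" and ?S0 = "pres_rows n L"
  define Y where "Y k j = first_pow R X k j" for k j
  have Yf: "Y k = first_pow R X k" for k by (rule ext) (simp add: Y_def)
  have Yc: "Y k j \<in> carrier R" if "j \<in> {1..l}" for k j
    using Pi_mem[OF ideal_first_pow_ideal(1)[OF X(1)] that] by (simp add: Y_def)
  have Yfun: "Y k \<in> {1..l} \<rightarrow> carrier R" for k using Yc by blast
  have Ac: "A (fst p) (snd p) j \<in> carrier R" if "p \<in> ?B" "j \<in> {1..l}" for p j using A[OF that] M' by blast
  have Afun: "A (fst p) (snd p) \<in> {1..l} \<rightarrow> carrier R" if "p \<in> ?B" for p using Ac[OF that] by blast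
  have kn: "fst p \<in> {1..n}" if "p \<in> ?B" for p using that by (auto simp: blocks_def)
  define I where "I p = I2 R l (A (fst p) (snd p)) (Y (fst p))" for p
  have iI: "ideal (I p) R" if "p \<in> ?B" for p unfolding I_def by (rule ideal_I2(1)[OF Afun[OF that] Yfun])
  define B where "B = ideal_sum R ?B I"
  have UI: "(\<Union>p\<in>?B. I p) \<subseteq> carrier R" using ideal_rules(1)[OF iI] by blast
  have B: "ideal B R" unfolding B_def ideal_sum_def by (rule genideal_ideal[OF UI])
  note B' = ideal_rules[OF B]
  have IB: "I p \<subseteq> B" if "p \<in> ?B" for p unfolding B_def ideal_sum_def using genideal_self[OF UI] that by blast
  have BI: "(\<lambda>(i, j). I2 R l (A i j) (first_pow R X i)) = I" by (auto simp: I_def Yf)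
  \<comment> \<open>Since \<open>Y_i f = A_i e\<close>, both products in the minor take
    \<open>e\<close> to \<open>Y_i Y_j f\<close>, so the minor annihilates \<open>e\<close>.\<close>
  have minor: "A (fst p) (snd p) i \<otimes> Y (fst p) j \<ominus> A (fst p) (snd p) j \<otimes> Y (fst p) i \<in> \<aa>"
    if p: "p \<in> ?B" and ij: "i \<in> {1..l}" "j \<in> {1..l}" for p i j
  proof -
    let ?f = "f (fst p) (snd p)"
    note c = Ac[OF p ij(1)] Ac[OF p ij(2)] Yc[OF ij(1), of "fst p"] Yc[OF ij(2), of "fst p"] f[OF p]
    have 1: "(A (fst p) (snd p) i \<otimes> Y (fst p) j) \<odot>\<^bsub>KM\<^esub> e = (Y (fst p) j \<otimes> Y (fst p) i) \<odot>\<^bsub>KM\<^esub> ?f"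
      if ij: "i \<in> {1..l}" "j \<in> {1..l}" for i j
    proof -
      note c = Ac[OF p ij(1)] Yc[OF ij(1), of "fst p"] Yc[OF ij(2), of "fst p"] f[OF p]
      have "(A (fst p) (snd p) i \<otimes> Y (fst p) j) \<odot>\<^bsub>KM\<^esub> e = Y (fst p) j \<odot>\<^bsub>KM\<^esub> (A (fst p) (snd p) i \<odot>\<^bsub>KM\<^esub> e)"
        using c e by (simp add: m_comm K.smult_assoc1)
      also have "\<dots> = (Y (fst p) j \<otimes> Y (fst p) i) \<odot>\<^bsub>KM\<^esub> ?f"
        using rel[OF p ij(1)] c by (simp add: Yf K.smult_assoc1)
      finally show ?thesis .
    qed
    have "(A (fst p) (snd p) i \<otimes> Y (fst p) j \<ominus> A (fst p) (snd p) j \<otimes> Y (fst p) i) \<odot>\<^bsub>KM\<^esub> e = \<zero>\<^bsub>KM\<^esub>"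
      using c e 1[OF ij] 1[OF ij(2,1)] by (simp add: minus_eq K.smult_l_distr K.smult_l_minus m_comm K.M.r_neg)
    then show ?thesis using \<aa>(3) c by simp
  qed
  have "I p \<subseteq> \<aa>" if p: "p \<in> ?B" for p
    unfolding I_def I2_def using minor[OF p] by (intro genideal_minimal[OF \<aa>(1)]) auto
  then have Ba: "B \<subseteq> \<aa>" unfolding B_def ideal_sum_def by (intro genideal_minimal[OF \<aa>(1)]) auto
  obtain q :: nat and c where c: "\<And>s. s \<in> {1..q} \<Longrightarrow> c s \<in> \<aa>" "\<aa> = B <+>\<^bsub>R\<^esub> Idl (c ` {1..q})"
    "\<And>w. w \<in> {1..q} \<rightarrow> carrier R \<Longrightarrow> (\<Oplus>s\<in>{1..q}. w s \<otimes> c s) \<in> B \<Longrightarrow> \<forall>s\<in>{1..q}. w s \<in> M"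
    using minimal_relative_generators[OF \<aa>(1) B Ba M(3)] by blast
  have cc: "c s \<in> carrier R" if "s \<in> {1..q}" for s using a'(3) c(1)[OF that] .
  let ?S1 = "pres_cols n L l q" and ?M = "pres_M R X A c"
  have A3: "A k i j \<in> carrier R" if "(k, i) \<in> ?B" "j \<in> {1..l}" for k i j using Ac[OF that] by simp
  have mm: "mat_map R ?S0 ?S1 ?M w None =
      (\<Oplus>p\<in>?B. \<Oplus>j\<in>{1..l}. w (Inl (p, j)) \<otimes> A (fst p) (snd p) j) \<oplus> (\<Oplus>s\<in>{1..q}. w (Inr s) \<otimes> c s)"
    "\<And>p. p \<in> ?B \<Longrightarrow> mat_map R ?S0 ?S1 ?M w (Some p) =
      (\<Oplus>j\<in>{1..l}. w (Inl (p, j)) \<otimes> first_pow R X (fst p) j)" if w: "w \<in> carrier (free_mod R ?S1)" for w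
    using mat_map_pres_M[OF X(1) _ _ w, of A c] A3 cc by blast+
  have Mc: "?M s t \<in> carrier R" if "s \<in> ?S0" "t \<in> ?S1" for s t
  proof (cases t)
    case (Inl pj)
    obtain p j where pj: "pj = (p, j)" by (cases pj)
    have "p \<in> ?B" "j \<in> {1..l}" using that(2) Inl pj by (auto simp: pres_cols_def)
    then show ?thesis using Inl pj Ac Yc by (cases s) (auto simp: pres_M_None pres_M_Some Yf[symmetric])
  next
    case (Inr s')
    then have "s' \<in> {1..q}" using that(2) by (auto simp: pres_cols_def)
    then show ?thesis using Inr cc by (cases s) (auto simp: pres_M_Inr)
  qed
  have Nc: "N s \<in> carrier KM" if "s \<in> ?S0" for s
    using that e f N by (cases s) (auto simp: pres_rows_def)
  let ?F0 = "free_mod R ?S0" and ?F1 = "free_mod R ?S1"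
  interpret F0: module R ?F0 by (rule module_free_mod)
  \<comment> \<open>The sign of the first entry turns a kernel vector into an equation between a
    combination of the \<open>f\<close> and a multiple of \<open>e\<close>, the form in which
    \<open>indep\<close> applies.\<close>
  have rowe: "row_map KM ?S0 N v = \<zero>\<^bsub>KM\<^esub> \<longleftrightarrow> (\<Oplus>\<^bsub>KM\<^esub>p\<in>?B. v (Some p) \<odot>\<^bsub>KM\<^esub> f (fst p) (snd p)) = v None \<odot>\<^bsub>KM\<^esub> e"
    if v: "v \<in> carrier ?F0" for v
  proof -
    have vc: "v s \<in> carrier R" if "s \<in> ?S0" for s using v that by auto
    have n: "None \<in> ?S0" "\<And>p. p \<in> ?B \<Longrightarrow> Some p \<in> ?S0" by (auto simp: pres_rows_def)
    have "row_map KM ?S0 N v = v None \<odot>\<^bsub>KM\<^esub> N None \<oplus>\<^bsub>KM\<^esub> (\<Oplus>\<^bsub>KM\<^esub>p\<in>?B. v (Some p) \<odot>\<^bsub>KM\<^esub> N (Some p))"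
      unfolding row_map_def using vc Nc by (intro finsum_pres_rows K.abelian_group_axioms) auto
    then have eq: "row_map KM ?S0 N v = \<ominus>\<^bsub>KM\<^esub> (v None \<odot>\<^bsub>KM\<^esub> e) \<oplus>\<^bsub>KM\<^esub> (\<Oplus>\<^bsub>KM\<^esub>p\<in>?B. v (Some p) \<odot>\<^bsub>KM\<^esub> f (fst p) (snd p))"
      using N e vc[OF n(1)] by (simp add: K.smult_r_minus)
    have c1: "v None \<odot>\<^bsub>KM\<^esub> e \<in> carrier KM" using vc[OF n(1)] e by simp
    have c2: "(\<Oplus>\<^bsub>KM\<^esub>p\<in>?B. v (Some p) \<odot>\<^bsub>KM\<^esub> f (fst p) (snd p)) \<in> carrier KM"
      using vc[OF n(2)] f by (intro K.finsum_closed) auto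
    show ?thesis unfolding eq by (rule K.M.minus_add_eq_zero_iff[OF c1 c2])
  qed
  have ker_sub: "submodule {v \<in> carrier ?F0. row_map KM ?S0 N v = \<zero>\<^bsub>KM\<^esub>} R ?F0"
    using Nc by (intro mod_hom_kernel_submodule[OF module_free_mod KM] row_map_hom[OF KM finite_pres_rows]) auto
  define im where "im = mat_map R ?S0 ?S1 ?M ` carrier ?F1"
  have im_span: "im = mod_span R ?F0 ((\<lambda>t. \<lambda>s\<in>?S0. ?M s t) ` ?S1)"
    unfolding im_def using Mc by (intro mat_map_image[OF finite_pres_cols]) auto
  have colsF: "(\<lambda>t. \<lambda>s\<in>?S0. ?M s t) ` ?S1 \<subseteq> carrier ?F0"
    using Mc by (intro image_subsetI) (simp add: restrict_PiE_iff)
  note im = mod_span_submodule[OF module_free_mod colsF, folded im_span]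
  note im' = F0.submodule_rules[OF im(1)]
  have im_ker: "im \<subseteq> {v \<in> carrier ?F0. row_map KM ?S0 N v = \<zero>\<^bsub>KM\<^esub>}"
    unfolding im_span
  proof (rule mod_span_least[OF ker_sub], rule image_subsetI)
    fix t assume t: "t \<in> ?S1"
    let ?v = "\<lambda>s\<in>?S0. ?M s t"
    have v: "?v \<in> carrier ?F0" using colsF t by blast
    have n: "None \<in> ?S0" "\<And>p. p \<in> ?B \<Longrightarrow> Some p \<in> ?S0" by (auto simp: pres_rows_def)
    have sum_eq: "(\<Oplus>\<^bsub>KM\<^esub>p\<in>?B. ?v (Some p) \<odot>\<^bsub>KM\<^esub> f (fst p) (snd p)) =
        (\<Oplus>\<^bsub>KM\<^esub>p\<in>?B. ?M (Some p) t \<odot>\<^bsub>KM\<^esub> f (fst p) (snd p))"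
      using n Mc[OF n(2) t] f by (intro K.finsum_cong') auto
    have "(\<Oplus>\<^bsub>KM\<^esub>p\<in>?B. ?M (Some p) t \<odot>\<^bsub>KM\<^esub> f (fst p) (snd p)) = ?M None t \<odot>\<^bsub>KM\<^esub> e"
    proof (cases t)
      case (Inl pj)
      obtain p j where pj: "pj = (p, j)" by (cases pj)
      have p: "p \<in> ?B" "j \<in> {1..l}" using t Inl pj by (auto simp: pres_cols_def)
      have "(\<Oplus>\<^bsub>KM\<^esub>p'\<in>?B. ?M (Some p') t \<odot>\<^bsub>KM\<^esub> f (fst p') (snd p')) = ?M (Some p) t \<odot>\<^bsub>KM\<^esub> f (fst p) (snd p)"
        using Mc[OF n(2)[OF p(1)] t] f p Inl pj
        by (intro K.finsum_single[OF finite_blocks p(1)]) (auto simp: pres_M_Some)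
      then show ?thesis using rel[OF p] Inl pj by (simp add: pres_M_Some pres_M_None)
    next
      case (Inr s)
      then have s: "s \<in> {1..q}" using t by (auto simp: pres_cols_def)
      have "(\<Oplus>\<^bsub>KM\<^esub>p\<in>?B. ?M (Some p) t \<odot>\<^bsub>KM\<^esub> f (fst p) (snd p)) = (\<Oplus>\<^bsub>KM\<^esub>p\<in>?B. \<zero>\<^bsub>KM\<^esub>)"
        using f Inr by (intro K.finsum_cong' refl) (simp_all add: pres_M_Inr)
      then show ?thesis using \<aa>(3)[OF cc[OF s]] c(1)[OF s] Inr by simp
    qed
    then have "row_map KM ?S0 N ?v = \<zero>\<^bsub>KM\<^esub>" unfolding rowe[OF v] sum_eq using n by simp
    then show "?v \<in> {v \<in> carrier ?F0. row_map KM ?S0 N v = \<zero>\<^bsub>KM\<^esub>}" using v by blast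
  qed
  \<comment> \<open>Inclusion of the ring as the first coordinate. The ring elements sent into the
    image of the matrix form an ideal, so to obtain all of \<open>\<aa>\<close> it suffices to treat
    the \<open>c s\<close>, which come from columns, and the minors.\<close>
  define \<iota> where "\<iota> t = (\<lambda>s\<in>?S0. if s = None then t else \<zero>)" for t
  have \<iota>h: "\<iota> \<in> mod_hom R (reg_module R) ?F0"
    by (auto simp: mod_hom_def \<iota>_def intro!: restrict_ext)
  note \<iota> = mod_homD[OF \<iota>h, simplified reg_module_simps]
  have pre: "ideal {t \<in> carrier R. \<iota> t \<in> im} R"
  proof (rule idealI')
    show "\<zero> \<in> {t \<in> carrier R. \<iota> t \<in> im}"
      using mod_hom_zero[OF module_reg_module module_free_mod \<iota>h] im'(2) by (simp del: free_mod_simps)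
    show "a \<oplus> b \<in> {t \<in> carrier R. \<iota> t \<in> im}"
      if "a \<in> {t \<in> carrier R. \<iota> t \<in> im}" "b \<in> {t \<in> carrier R. \<iota> t \<in> im}" for a b
      using that \<iota>(2)[of a b] im'(4)[of "\<iota> a" "\<iota> b"] by (simp del: free_mod_simps)
    show "r \<otimes> a \<in> {t \<in> carrier R. \<iota> t \<in> im}"
      if "a \<in> {t \<in> carrier R. \<iota> t \<in> im}" "r \<in> carrier R" for a r
      using that \<iota>(3)[of r a] im'(7)[of "\<iota> a" r] by (simp del: free_mod_simps)
  qed blast
  have "c ` {1..q} \<subseteq> {t \<in> carrier R. \<iota> t \<in> im}"
  proof (rule image_subsetI)
    fix s assume s: "s \<in> {1..q}"
    have "(\<lambda>x\<in>?S0. ?M x (Inr s)) \<in> im" using im(2) s by (auto simp: pres_cols_def)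
    also have "(\<lambda>x\<in>?S0. ?M x (Inr s)) = \<iota> (c s)"
    proof (unfold \<iota>_def, rule restrict_ext)
      fix x show "?M x (Inr s) = (if x = None then c s else \<zero>)" by (cases x) (simp_all add: pres_M_Inr)
    qed
    finally show "c s \<in> {t \<in> carrier R. \<iota> t \<in> im}" using cc[OF s] by simp
  qed
  then have Cim: "Idl (c ` {1..q}) \<subseteq> {t \<in> carrier R. \<iota> t \<in> im}" by (rule genideal_minimal[OF pre])
  have "I p \<subseteq> {t \<in> carrier R. \<iota> t \<in> im}" if p: "p \<in> ?B" for p
    unfolding I_def I2_def
  proof (rule genideal_minimal[OF pre], safe)
    fix i j assume ij: "1 \<le> i" "i < j" "j \<le> (l::nat)"
    then have ij': "i \<in> {1..l}" "j \<in> {1..l}" by auto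
    let ?t = "A (fst p) (snd p) i \<otimes> Y (fst p) j \<ominus> A (fst p) (snd p) j \<otimes> Y (fst p) i"
    note cs = Ac[OF p ij'(1)] Ac[OF p ij'(2)] Yc[OF ij'(1), of "fst p"] Yc[OF ij'(2), of "fst p"]
    let ?col = "\<lambda>j. (\<lambda>x\<in>?S0. ?M x (Inl (p, j)))"
    have col: "?col i \<in> im" "?col j \<in> im" using im(2) ij' p by (auto simp: pres_cols_def)
    \<comment> \<open>The Koszul combination of two columns of one block: the entries in row
      \<open>Some p\<close> cancel, and the first row becomes the minor.\<close>
    let ?v = "(Y (fst p) j \<odot>\<^bsub>?F0\<^esub> ?col i) \<oplus>\<^bsub>?F0\<^esub> ((\<ominus> Y (fst p) i) \<odot>\<^bsub>?F0\<^esub> ?col j)"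
    have "?v \<in> im" using cs by (intro im'(4) im'(7) col) auto
    also have "?v = \<iota> ?t"
    proof -
      have "Y (fst p) j \<otimes> ?M x (Inl (p, i)) \<oplus> (\<ominus> Y (fst p) i) \<otimes> ?M x (Inl (p, j)) = (if x = None then ?t else \<zero>)"
        if x: "x \<in> ?S0" for x
      proof (cases x)
        case None
        have "Y (fst p) j \<otimes> A (fst p) (snd p) i \<oplus> (\<ominus> Y (fst p) i) \<otimes> A (fst p) (snd p) j = ?t"
          using cs by algebra
        then show ?thesis using None by (simp add: pres_M_None)
      next
        case (Some p')
        have "Y (fst p) j \<otimes> Y (fst p) i \<oplus> (\<ominus> Y (fst p) i) \<otimes> Y (fst p) j = \<zero>" using cs by algebra
        then show ?thesis using Some cs by (auto simp: pres_M_Some Yf[symmetric])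
      qed
      then show ?thesis by (auto simp: \<iota>_def intro!: restrict_ext)
    qed
    finally show "?t \<in> carrier R" "\<iota> ?t \<in> im" using cs by auto
  qed
  then have Bim: "B \<subseteq> {t \<in> carrier R. \<iota> t \<in> im}"
    unfolding B_def ideal_sum_def by (intro genideal_minimal[OF pre]) auto
  have aim: "\<aa> \<subseteq> {t \<in> carrier R. \<iota> t \<in> im}"
    unfolding c(2) using Bim Cim ideal_rules(4)[OF pre] unfolding set_add_def' by blast
  have vJ: "v (Some p) \<in> first_pow_ideal R l X (fst p)"
    if v: "v \<in> carrier ?F0" "row_map KM ?S0 N v = \<zero>\<^bsub>KM\<^esub>" and p: "p \<in> ?B" for v p
  proof -
    have vc: "v s \<in> carrier R" if "s \<in> ?S0" for s using v that by auto
    have "\<forall>p\<in>?B. v (Some p) \<in> first_pow_ideal R l X (fst p)"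
      using v(2) rowe[OF v(1)] vc by (intro indep[of _ "v None"]) (auto simp: pres_rows_def)
    then show ?thesis using p by blast
  qed
  have ker_im: "{v \<in> carrier ?F0. row_map KM ?S0 N v = \<zero>\<^bsub>KM\<^esub>} \<subseteq> im"
  proof safe
    fix v assume v: "v \<in> carrier ?F0" "row_map KM ?S0 N v = \<zero>\<^bsub>KM\<^esub>"
    have vc: "v s \<in> carrier R" if "s \<in> ?S0" for s using v that by auto
    have "\<exists>b. b \<in> {1..l} \<rightarrow> carrier R \<and> v (Some p) = (\<Oplus>j\<in>{1..l}. b j \<otimes> Y (fst p) j)" if p: "p \<in> ?B" for p
      using vJ[OF v p] mem_Idl_image[OF finite_atLeastAtMost Yfun[of "fst p"], of "v (Some p)"]
      by (simp add: first_pow_ideal_def Yf)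
    then obtain b where b: "\<And>p. p \<in> ?B \<Longrightarrow> b p \<in> {1..l} \<rightarrow> carrier R"
      "\<And>p. p \<in> ?B \<Longrightarrow> v (Some p) = (\<Oplus>j\<in>{1..l}. b p j \<otimes> Y (fst p) j)" by metis
    define w where "w = (\<lambda>x\<in>?S1. case x of Inl (p, j) \<Rightarrow> b p j | Inr s \<Rightarrow> \<zero>)"
    have w: "w \<in> carrier ?F1" using b(1) by (auto simp: w_def pres_cols_def Pi_iff split: sum.splits)
    have wb: "w (Inl (p, j)) = b p j" if "p \<in> ?B" "j \<in> {1..l}" for p j using that by (simp add: w_def pres_cols_def)
    let ?u = "mat_map R ?S0 ?S1 ?M w"
    have u: "?u \<in> im" unfolding im_def using w by blast
    then have uk: "?u \<in> carrier ?F0" "row_map KM ?S0 N ?u = \<zero>\<^bsub>KM\<^esub>" using im_ker by blast+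
    have uv: "?u (Some p) = v (Some p)" if p: "p \<in> ?B" for p
    proof -
      have "(\<Oplus>j\<in>{1..l}. w (Inl (p, j)) \<otimes> first_pow R X (fst p) j) = (\<Oplus>j\<in>{1..l}. b p j \<otimes> Y (fst p) j)"
        using wb[OF p] b(1)[OF p] Yc by (intro finsum_cong' refl) (auto simp: Yf)
      then show ?thesis using mm(2)[OF w p] b(2)[OF p] by simp
    qed
    \<comment> \<open>Subtracting a combination of block columns with the same entries below the
      first row leaves a kernel vector concentrated in the first row. Its entry annihilates
      \<open>e\<close> and so belongs to \<open>\<aa>\<close>.\<close>
    let ?d = "(\<ominus> \<one>) \<odot>\<^bsub>?F0\<^esub> ?u \<oplus>\<^bsub>?F0\<^esub> v"
    have d: "?d \<in> carrier ?F0" "row_map KM ?S0 N ?d = \<zero>\<^bsub>KM\<^esub>"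
    proof -
      have "?d \<in> {v \<in> carrier ?F0. row_map KM ?S0 N v = \<zero>\<^bsub>KM\<^esub>}"
        using uk v by (intro F0.submodule_rules(4)[OF ker_sub] F0.submodule_rules(7)[OF ker_sub]) auto
      then show "?d \<in> carrier ?F0" "row_map KM ?S0 N ?d = \<zero>\<^bsub>KM\<^esub>" by blast+
    qed
    have d0: "?d (Some p) = \<zero>" if p: "p \<in> ?B" for p
      using uv[OF p] vc[of "Some p"] p by (simp add: pres_rows_def l_minus l_neg)
    have dN: "?d None \<in> carrier R" using d(1) by (auto simp: pres_rows_def)
    have "(\<Oplus>\<^bsub>KM\<^esub>p\<in>?B. ?d (Some p) \<odot>\<^bsub>KM\<^esub> f (fst p) (snd p)) = (\<Oplus>\<^bsub>KM\<^esub>p\<in>?B. \<zero>\<^bsub>KM\<^esub>)"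
      using f d0 by (intro K.finsum_cong' refl) (auto simp del: free_mod_simps)
    then have "?d None \<odot>\<^bsub>KM\<^esub> e = \<zero>\<^bsub>KM\<^esub>" using rowe[OF d(1)] d(2) by simp
    then have "?d None \<in> \<aa>" using \<aa>(3)[OF dN] by simp
    then have "\<iota> (?d None) \<in> im" using aim by blast
    moreover have "\<iota> (?d None) = ?d"
    proof
      fix x show "\<iota> (?d None) x = ?d x"
      proof (cases "x \<in> ?S0")
        case True
        then show ?thesis using d0 by (cases x) (auto simp: \<iota>_def pres_rows_def simp del: free_mod_simps)
      next
        case False
        then show ?thesis by (simp add: \<iota>_def)
      qed
    qed
    ultimately have "?d \<in> im" by simp
    moreover have "(\<ominus> \<one>) \<odot>\<^bsub>?F0\<^esub> ?u \<in> im" using u by (intro im'(7)) auto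
    ultimately show "v \<in> im" using F0.submodule_add_cancel[OF im(1) _ v(1)] by blast
  qed
  have surj: "row_map KM ?S0 N ` carrier ?F0 = carrier KM"
    using row_map_image[OF KM finite_pres_rows, of N] Nc gen by auto
  have imE: "im = {v \<in> carrier ?F0. row_map KM ?S0 N v = \<zero>\<^bsub>KM\<^esub>}"
    using im_ker ker_im by (rule subset_antisym)
  have pres: "free_presentation R KM ?S0 ?S1 ?M N"
    unfolding free_presentation_def im_def[symmetric]
    by (intro conjI ballI finite_pres_rows finite_pres_cols Mc Nc surj imE)
  have min0: "v s \<in> M" if v: "v \<in> carrier ?F0" "row_map KM ?S0 N v = \<zero>\<^bsub>KM\<^esub>" and s: "s \<in> ?S0" for v s
  proof (cases s)
    case None
    \<comment> \<open>\<open>indep\<close> does not control the first coordinate. It is read off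
      from the image instead, as all entries in the first row of the matrix lie in
      \<open>M\<close>.\<close>
    have "v \<in> im" using ker_im v by blast
    then obtain w where w: "w \<in> carrier ?F1" "v = mat_map R ?S0 ?S1 ?M w" by (auto simp: im_def)
    have wc: "w t \<in> carrier R" if "t \<in> ?S1" for t using w(1) that by auto
    have "(\<Oplus>p\<in>?B. \<Oplus>j\<in>{1..l}. w (Inl (p, j)) \<otimes> A (fst p) (snd p) j) \<in> M"
      using A wc by (intro ideal_finsum[OF M(1)] M'(7)) (auto simp: pres_cols_def)
    moreover have "(\<Oplus>s\<in>{1..q}. w (Inr s) \<otimes> c s) \<in> M"
      using c(1) \<aa>(2) wc by (intro ideal_finsum[OF M(1)] M'(7)) (auto simp: pres_cols_def)
    ultimately show ?thesis unfolding None w(2) mm(1)[OF w(1)] by (rule M'(4))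
  next
    case (Some p)
    then have p: "p \<in> ?B" using s by (auto simp: pres_rows_def)
    then show ?thesis using vJ[OF v p] X(2)[OF kn[OF p]] Some by blast
  qed
  have min1: "w t \<in> M" if w: "w \<in> carrier ?F1" "mat_map R ?S0 ?S1 ?M w = \<zero>\<^bsub>?F0\<^esub>" and t: "t \<in> ?S1" for w t
  proof -
    have wc: "w t \<in> carrier R" if "t \<in> ?S1" for t using w(1) that by auto
    have k: "(\<forall>j\<in>{1..l}. w (Inl (p, j)) \<in> M) \<and> (\<Oplus>j\<in>{1..l}. w (Inl (p, j)) \<otimes> A (fst p) (snd p) j) \<in> I p"
      if p: "p \<in> ?B" for p
    proof -
      have "(\<Oplus>j\<in>{1..l}. w (Inl (p, j)) \<otimes> first_pow R X (fst p) j) = \<zero>"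
        using mm(2)[OF w(1) p] w(2) p by (simp add: pres_rows_def)
      then show ?thesis unfolding I_def Yf
        using wc p by (intro koszul[OF kn[OF p] _ Afun[OF p]]) (auto simp: pres_cols_def)
    qed
    \<comment> \<open>In each block the coefficients form a relation among the parameters, so by
      \<open>koszul\<close> the contribution to the first row lies in the ideal \<open>B\<close> of
      minors. What is left is a relation of the \<open>c s\<close> modulo \<open>B\<close>, to which
      the minimal choice of generators applies.\<close>
    have s1: "(\<Oplus>p\<in>?B. \<Oplus>j\<in>{1..l}. w (Inl (p, j)) \<otimes> A (fst p) (snd p) j) \<in> B"
      by (rule ideal_finsum[OF B]) (rule subsetD[OF IB], simp, rule conjunct2[OF k], simp)
    have s2c: "(\<Oplus>s\<in>{1..q}. w (Inr s) \<otimes> c s) \<in> carrier R"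
      using wc cc by (intro finsum_closed) (auto simp: pres_cols_def)
    have "(\<Oplus>p\<in>?B. \<Oplus>j\<in>{1..l}. w (Inl (p, j)) \<otimes> A (fst p) (snd p) j) \<oplus> (\<Oplus>s\<in>{1..q}. w (Inr s) \<otimes> c s) = \<zero>"
      using mm(1)[OF w(1)] w(2) by (simp add: pres_rows_def)
    then have "(\<Oplus>s\<in>{1..q}. w (Inr s) \<otimes> c s) \<in> B" using ideal_add_cancel[OF B s1 s2c] B'(2) by simp
    then have r: "\<forall>s\<in>{1..q}. w (Inr s) \<in> M" using wc by (intro c(3)) (auto simp: pres_cols_def)
    show ?thesis
    proof (cases t)
      case (Inl pj)
      then have "fst pj \<in> ?B" "snd pj \<in> {1..l}" using t by (auto simp: pres_cols_def)
      then show ?thesis using Inl k[of "fst pj"] by (metis prod.collapse)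
    next
      case (Inr s)
      then show ?thesis using t r by (auto simp: pres_cols_def)
    qed
  qed
  have "minimal_free_presentation R KM ?S0 ?S1 ?M N"
    unfolding minimal_free_presentation_def M(2) by (intro conjI ballI impI pres min0 min1)
  moreover have "\<forall>s\<in>{1..q}. c s \<in> M" using c(1) \<aa>(2) by auto
  moreover have "\<aa> = ideal_sum R ?B (\<lambda>(i, j). I2 R l (A i j) (first_pow R X i)) <+>\<^bsub>R\<^esub> genideal R (c ` {1..q})"
    unfolding BI using c(2) by (simp only: B_def)
  ultimately show ?thesis by blast
qed

end

section \<open>Uniserial modules, annihilators and integrality\<close>

text \<open>The hypothesis on \<open>z, z'\<close> says that the socle of \<open>K\<^sub>2 / K\<close>, as a module over \<open>R\<close> on which only
  \<open>x\<close> acts in a nontrivial way, has length at most one.  The submodules between \<open>K\<close> and \<open>K\<^sub>2\<close>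
  are then the \<open>E i = (K : x\<^sup>i)\<close>.\<close>

lemma (in module) uniserial_chain_length:
  assumes K: "submodule K R M" and K2: "submodule K2 R M" "K \<subseteq> K2"
    and x: "x \<in> carrier R" "\<And>z. z \<in> K2 \<Longrightarrow> (x [^] (s::nat)) \<odot>\<^bsub>M\<^esub> z \<in> K"
    and socle: "\<And>z z'. z \<in> K2 \<Longrightarrow> z' \<in> K2 \<Longrightarrow> x \<odot>\<^bsub>M\<^esub> z \<in> K \<Longrightarrow> x \<odot>\<^bsub>M\<^esub> z' \<in> K \<Longrightarrow> z \<notin> K \<Longrightarrow>
      \<exists>r\<in>carrier R. z' \<ominus>\<^bsub>M\<^esub> r \<odot>\<^bsub>M\<^esub> z \<in> K"
    and H: "\<And>i. i \<le> n \<Longrightarrow> submodule (H i) R M" "\<And>i. i \<le> n \<Longrightarrow> K \<subseteq> H i" "\<And>i. i \<le> n \<Longrightarrow> H i \<subseteq> K2"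
      "\<And>i. i < n \<Longrightarrow> H i \<subset> H (Suc i)"
  shows "n \<le> s"
proof -
  note K2' = submodule_rules[OF K2(1)] and K' = submodule_rules[OF K]
  define E where "E i = {z \<in> K2. (x [^] (i::nat)) \<odot>\<^bsub>M\<^esub> z \<in> K}" for i
  have pc: "x [^] i \<in> carrier R" for i :: nat using x(1) by simp
  have pow_add: "(x [^] i) \<odot>\<^bsub>M\<^esub> ((x [^] j) \<odot>\<^bsub>M\<^esub> z) = (x [^] (i + j)) \<odot>\<^bsub>M\<^esub> z" if "z \<in> carrier M" for i j :: nat and z
    using that x(1) by (simp add: R.nat_pow_mult[symmetric] smult_assoc1)
  have sub: "\<exists>i\<le>s. S = E i" if S: "submodule S R M" "K \<subseteq> S" "S \<subseteq> K2" for S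
  proof -
    note S' = submodule_rules[OF S(1)]
    let ?A = "{i. i \<le> s \<and> E i \<subseteq> S}"
    have "E 0 \<subseteq> S" using S(2) K2'(3) by (auto simp: E_def)
    then have ne: "0 \<in> ?A" by simp
    have fin: "finite ?A" by simp
    \<comment> \<open>The largest index with \<open>E i\<close> inside \<open>S\<close>; zero
      qualifies because \<open>E 0\<close> is \<open>K\<close>. The claim is
      \<open>S = E i\<close>.\<close>
    define i where "i = Max ?A"
    have i: "i \<le> s" "E i \<subseteq> S" using Max_in[OF fin] ne unfolding i_def by blast+
    have max: "\<not> E (Suc i) \<subseteq> S" if "i < s"
    proof
      assume "E (Suc i) \<subseteq> S"
      then have "Suc i \<in> ?A" using that by simp
      then show False using Max_ge[OF fin] unfolding i_def[symmetric] by fastforce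
    qed
    have "S \<subseteq> E i"
    proof (cases "i = s")
      case True
      then show ?thesis using S(3) x(2) by (auto simp: E_def)
    next
      case False
      show ?thesis
      proof (rule ccontr)
        assume "\<not> S \<subseteq> E i"
        then obtain z where z: "z \<in> S" "z \<notin> E i" by blast
        have zK: "z \<in> K2" "z \<in> carrier M" using z S K2' by auto
        define j where "j = (LEAST j::nat. (x [^] j) \<odot>\<^bsub>M\<^esub> z \<in> K)"
        have j: "(x [^] j) \<odot>\<^bsub>M\<^esub> z \<in> K" unfolding j_def using x(2)[OF zK(1)] by (rule LeastI)
        have jmin: "(x [^] j') \<odot>\<^bsub>M\<^esub> z \<notin> K" if "j' < j" for j' using that not_less_Least unfolding j_def by blast
        have ij: "i < j"
        proof (rule ccontr)
          assume "\<not> i < j"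
          then have "(x [^] i) \<odot>\<^bsub>M\<^esub> z = (x [^] (i - j)) \<odot>\<^bsub>M\<^esub> ((x [^] j) \<odot>\<^bsub>M\<^esub> z)" using pow_add[OF zK(2)] by simp
          also have "\<dots> \<in> K" using K'(7)[OF j pc] .
          finally show False using z(2) zK by (simp add: E_def)
        qed
        \<comment> \<open>The exponent makes \<open>x^i y\<close> equal to
          \<open>x^(j - 1) z\<close>, the last multiple outside \<open>K\<close>; it represents a
          nonzero socle element of the quotient by \<open>K\<close>.\<close>
        define y where "y = (x [^] (j - Suc i)) \<odot>\<^bsub>M\<^esub> z"
        have y: "y \<in> S" "y \<in> K2" "y \<in> carrier M" using z zK S'(7) K2'(7) pc by (auto simp: y_def)
        have y1: "(x [^] i) \<odot>\<^bsub>M\<^esub> y \<notin> K" using jmin[of "j - 1"] ij pow_add[OF zK(2), of i "j - Suc i"] by (simp add: y_def)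
        have y2: "x \<odot>\<^bsub>M\<^esub> ((x [^] i) \<odot>\<^bsub>M\<^esub> y) \<in> K"
          using j ij pow_add[OF zK(2), of i "j - Suc i"] pow_add[OF zK(2), of 1 "j - 1"] x(1) by (simp add: y_def)
        \<comment> \<open>Modulo \<open>K\<close>, the socle element \<open>x^i z'\<close> is a
          multiple, by \<open>r\<close>, of \<open>x^i y\<close>. Hence \<open>z' - r y\<close> lies
          in \<open>E i \<subseteq> S\<close>, and \<open>y\<close> lies in \<open>S\<close>. This
          contradicts the choice of \<open>i\<close>.\<close>
        have "E (Suc i) \<subseteq> S"
        proof
          fix z' assume "z' \<in> E (Suc i)"
          then have z': "z' \<in> K2" "z' \<in> carrier M" "(x [^] Suc i) \<odot>\<^bsub>M\<^esub> z' \<in> K" using K2' by (auto simp: E_def)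
          have "x \<odot>\<^bsub>M\<^esub> ((x [^] i) \<odot>\<^bsub>M\<^esub> z') \<in> K"
            using z'(3) pow_add[OF z'(2), of 1 i] x(1) by simp
          then obtain r where r: "r \<in> carrier R" "(x [^] i) \<odot>\<^bsub>M\<^esub> z' \<ominus>\<^bsub>M\<^esub> r \<odot>\<^bsub>M\<^esub> ((x [^] i) \<odot>\<^bsub>M\<^esub> y) \<in> K"
            using socle[OF _ _ y2 _ y1] y z' K2'(7) pc by blast
          let ?d = "z' \<ominus>\<^bsub>M\<^esub> r \<odot>\<^bsub>M\<^esub> y"
          have "(x [^] i) \<odot>\<^bsub>M\<^esub> ?d = (x [^] i) \<odot>\<^bsub>M\<^esub> z' \<ominus>\<^bsub>M\<^esub> r \<odot>\<^bsub>M\<^esub> ((x [^] i) \<odot>\<^bsub>M\<^esub> y)"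
            using z'(2) y(3) r(1) pc[of i] by (simp add: M.minus_eq smult_r_distr smult_r_minus R.m_comm flip: smult_assoc1)
          then have "?d \<in> E i" using r(2) z'(1) K2'(6) K2'(7)[OF y(2) r(1)] by (simp add: E_def)
          then have "?d \<in> S" using i(2) by blast
          then have "?d \<oplus>\<^bsub>M\<^esub> r \<odot>\<^bsub>M\<^esub> y \<in> S" using S'(4) S'(7)[OF y(1) r(1)] by blast
          moreover have "?d \<oplus>\<^bsub>M\<^esub> r \<odot>\<^bsub>M\<^esub> y = z'" using z'(2) y(3) r(1) by (simp add: M.minus_eq M.a_assoc M.l_neg)
          ultimately show "z' \<in> S" by simp
        qed
        then show False using max False i(1) by simp
      qed
    qed
    then show ?thesis using i by blast
  qed
  have "\<exists>i\<le>s. H j = E i" if "j \<le> n" for j using sub[OF H(1-3)[OF that]] .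
  then obtain g where g: "\<And>j. j \<le> n \<Longrightarrow> g j \<le> s" "\<And>j. j \<le> n \<Longrightarrow> H j = E (g j)" by metis
  have Hmono: "H i \<subset> H j" if "i < j" "j \<le> n" for i j
    using that
  proof (induction j)
    case (Suc j)
    then show ?case using H(4)[of j] by (cases "i = j") auto
  qed simp
  \<comment> \<open>The \<open>n + 1\<close> members of the strict chain are distinct and occur
    among the \<open>s + 1\<close> submodules \<open>E 0, ..., E s\<close>.\<close>
  have "inj_on g {..n}"
  proof (rule inj_onI)
    fix i j assume ij: "i \<in> {..n}" "j \<in> {..n}" "g i = g j"
    then have "H i = H j" using g(2) by simp
    then show "i = j" using Hmono[of i j] Hmono[of j i] ij by (metis atMost_iff linorder_neqE_nat psubsetE)
  qed
  then have "card {..n} \<le> card {..s}" using g(1) by (intro card_inj_on_le[of g]) auto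
  then show ?thesis by simp
qed

text \<open>The decomposition is a bijection on extensional families, so \<open>u\<close> and the
  zero family are restricted to \<open>S\<close> before injectivity is applied.\<close>

lemma internal_direct_sum_zero:
  assumes M: "module R M" and D: "internal_direct_sum R M S N"
    and u: "\<And>s. s \<in> S \<Longrightarrow> u s \<in> N s" "(\<Oplus>\<^bsub>M\<^esub>s\<in>S. u s) = \<zero>\<^bsub>M\<^esub>" and s: "s \<in> S"
  shows "u s = \<zero>\<^bsub>M\<^esub>"
proof -
  interpret M: module R M by fact
  have N: "submodule (N s) R M" if "s \<in> S" for s using D that by (auto simp: internal_direct_sum_def)
  have inj: "inj_on (\<lambda>u. \<Oplus>\<^bsub>M\<^esub>s\<in>S. u s) (\<Pi>\<^sub>E s\<in>S. N s)"
    using D by (auto simp: internal_direct_sum_def bij_betw_def)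
  have uc: "u s \<in> carrier M" if "s \<in> S" for s using u(1)[OF that] M.submodule_rules(3)[OF N[OF that]] by blast
  have "(\<Oplus>\<^bsub>M\<^esub>s\<in>S. restrict u S s) = (\<Oplus>\<^bsub>M\<^esub>s\<in>S. u s)" using uc by (intro M.finsum_cong') auto
  moreover have "(\<Oplus>\<^bsub>M\<^esub>s\<in>S. restrict (\<lambda>_. \<zero>\<^bsub>M\<^esub>) S s) = (\<Oplus>\<^bsub>M\<^esub>s\<in>S. \<zero>\<^bsub>M\<^esub>)" by (intro M.finsum_cong') auto
  ultimately have "(\<Oplus>\<^bsub>M\<^esub>s\<in>S. restrict u S s) = (\<Oplus>\<^bsub>M\<^esub>s\<in>S. restrict (\<lambda>_. \<zero>\<^bsub>M\<^esub>) S s)" using u(2) by simp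
  moreover have "restrict u S \<in> (\<Pi>\<^sub>E s\<in>S. N s)" using u(1) by (simp add: restrict_PiE_iff)
  moreover have "restrict (\<lambda>_. \<zero>\<^bsub>M\<^esub>) S \<in> (\<Pi>\<^sub>E s\<in>S. N s)" using M.submodule_rules(2)[OF N] by (simp add: restrict_PiE_iff)
  ultimately have "restrict u S = restrict (\<lambda>_. \<zero>\<^bsub>M\<^esub>) S" using inj_onD[OF inj] by blast
  then show ?thesis using s by (metis restrict_apply')
qed

text \<open>The isomorphism need not send \<open>y\<close> to the class of one. If \<open>r\<close>
  kills \<open>y\<close>, it kills the span of \<open>y\<close> and hence a preimage of the class of
  one; conversely, an \<open>r\<close> in \<open>I\<close> kills the whole quotient, including the
  image of \<open>y\<close>.\<close>

lemma (in cring) cyclic_mod_iso_annihilator: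
  assumes M: "module R M" and y: "y \<in> carrier M" and I: "ideal I R"
    and iso: "mod_iso R (restrict_mod M (mod_span R M {y})) (mod_quot (reg_module R) I)"
    and r: "r \<in> carrier R"
  shows "r \<odot>\<^bsub>M\<^esub> y = \<zero>\<^bsub>M\<^esub> \<longleftrightarrow> r \<in> I"
proof -
  interpret M: module R M by fact
  interpret P: plain_module R "reg_module R" unfolding plain_module_def by (rule module_reg_module)
  have Is: "submodule I R (reg_module R)" using I by (simp add: submodule_reg_module)
  note q = P.mod_quot_simps[OF Is, simplified]
  have "{y} \<subseteq> carrier M" using y by simp
  note sp = mod_span_submodule[OF M this]
  let ?N = "restrict_mod M (mod_span R M {y})" and ?k = "mod_quot (reg_module R) I"
  have N: "module R ?N" by (rule module_restrict_mod[OF M sp(1)])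
  have k: "module R ?k" by (rule P.module_mod_quot[OF Is])
  obtain h where h: "h \<in> mod_hom R ?N ?k" "bij_betw h (mod_span R M {y}) (carrier ?k)"
    using iso by (auto simp: mod_iso_def)
  have h0: "h \<zero>\<^bsub>M\<^esub> = I" using mod_hom_zero[OF N k h(1)] q(2) by simp
  have yS: "y \<in> mod_span R M {y}" using sp(2) by simp
  show ?thesis
  proof
    assume ry: "r \<odot>\<^bsub>M\<^esub> y = \<zero>\<^bsub>M\<^esub>"
    have "submodule {z \<in> carrier M. r \<odot>\<^bsub>M\<^esub> z = \<zero>\<^bsub>M\<^esub>} R M"
    proof (rule M.submoduleI')
      fix a t assume "a \<in> {z \<in> carrier M. r \<odot>\<^bsub>M\<^esub> z = \<zero>\<^bsub>M\<^esub>}" "t \<in> carrier R"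
      then show "t \<odot>\<^bsub>M\<^esub> a \<in> {z \<in> carrier M. r \<odot>\<^bsub>M\<^esub> z = \<zero>\<^bsub>M\<^esub>}"
        using r by (auto simp: m_comm[of r t] M.smult_assoc1 simp flip: M.smult_assoc1[of r t a])
    qed (use r in \<open>auto simp: M.smult_r_distr\<close>)
    then have le: "mod_span R M {y} \<subseteq> {z \<in> carrier M. r \<odot>\<^bsub>M\<^esub> z = \<zero>\<^bsub>M\<^esub>}"
      using y ry by (intro mod_span_least) auto
    have "I +>\<^bsub>reg_module R\<^esub> \<one> \<in> carrier ?k" using q(1) by blast
    then obtain z where z: "z \<in> mod_span R M {y}" "h z = I +>\<^bsub>reg_module R\<^esub> \<one>"
      using h(2) by (metis bij_betw_imp_surj_on imageE)
    have "I +>\<^bsub>reg_module R\<^esub> r = r \<odot>\<^bsub>?k\<^esub> h z" using z(2) q(4)[OF r one_closed] r by simp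
    also have "\<dots> = h (r \<odot>\<^bsub>M\<^esub> z)" using mod_homD(3)[OF h(1) r] z(1) by simp
    also have "\<dots> = I" using le z(1) h0 by auto
    finally show "r \<in> I" using P.mod_coset_eq_zero_iff[OF Is] r by simp
  next
    assume rI: "r \<in> I"
    have "h y \<in> carrier ?k" using mod_homD(1)[OF h(1)] yS by simp
    then obtain b where b: "b \<in> carrier R" "h y = I +>\<^bsub>reg_module R\<^esub> b" using q(1) by auto
    have "h (r \<odot>\<^bsub>M\<^esub> y) = I +>\<^bsub>reg_module R\<^esub> (r \<otimes> b)" using mod_homD(3)[OF h(1) r] yS b q(4)[OF r b(1)] by simp
    also have "\<dots> = I" using P.mod_coset_eq_zero_iff[OF Is, of "r \<otimes> b"] ideal_rules(8)[OF I rI b(1)] r b(1) by simp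
    finally have "h (r \<odot>\<^bsub>M\<^esub> y) = h \<zero>\<^bsub>M\<^esub>" using h0 by simp
    moreover have "r \<odot>\<^bsub>M\<^esub> y \<in> mod_span R M {y}" "\<zero>\<^bsub>M\<^esub> \<in> mod_span R M {y}"
      using M.submodule_rules(2,7)[OF sp(1)] yS r by auto
    ultimately show "r \<odot>\<^bsub>M\<^esub> y = \<zero>\<^bsub>M\<^esub>" using h(2) by (meson bij_betw_imp_inj_on inj_onD)
  qed
qed

lemma restrict_frac_module: "restrict_mod (frac_module Q \<phi> Y) K = frac_module Q \<phi> K"
  by (simp add: restrict_mod_def frac_module_def)

lemma frac_module_simps [simp]:
  "carrier (frac_module Q \<phi> K) = K" "zero (frac_module Q \<phi> K) = zero Q" "add (frac_module Q \<phi> K) = add Q"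
  "smult (frac_module Q \<phi> K) = (\<lambda>r z. \<phi> r \<otimes>\<^bsub>Q\<^esub> z)"
  by (auto simp: frac_module_def)

lemma module_frac_module:
  assumes "cring R" "cring Q" "\<phi> \<in> ring_hom R Q"
  shows "module R (frac_module Q \<phi> (carrier Q))"
proof -
  interpret Q: cring Q by fact
  have c: "\<phi> r \<in> carrier Q" if "r \<in> carrier R" for r using ring_hom_closed[OF assms(3) that] .
  show ?thesis
  proof (rule moduleI[OF assms(1)])
    show "abelian_group (frac_module Q \<phi> (carrier Q))"
      by (rule abelian_groupI)
        (auto simp: Q.a_assoc Q.a_comm Q.a_lcomm intro!: bexI[of _ "\<ominus>\<^bsub>Q\<^esub> _"] Q.l_neg)
  qed (auto simp: c Q.l_distr Q.r_distr Q.m_assoc ring_hom_add[OF assms(3)] ring_hom_mult[OF assms(3)]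
        ring_hom_one[OF assms(3)])
qed

text \<open>Multiplying an equation of integral dependence for \<open>f\<close> by \<open>y\<^sup>d\<close> gives \<open>a\<^sup>d \<in> (y)\<close> for \<open>a = y f\<close>.\<close>

lemma integral_multiple_in_prime:
  assumes R: "cring R" and Q: "cring Q" and \<phi>: "\<phi> \<in> ring_hom R Q" "inj_on \<phi> (carrier R)"
    and P: "primeideal P R" and f: "f \<in> integral_closure R Q \<phi>"
    and y: "y \<in> P" and a: "a \<in> carrier R" "\<phi> y \<otimes>\<^bsub>Q\<^esub> f = \<phi> a"
  shows "a \<in> P"
proof (rule ccontr)
  assume aP: "a \<notin> P"
  interpret R: cring R by fact
  interpret Q: cring Q by fact
  interpret \<phi>: ring_hom_cring R Q \<phi> using R Q \<phi>(1) by (simp add: ring_hom_cring_def ring_hom_cring_axioms_def)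
  note P' = R.ideal_rules[OF primeideal.axioms(1)[OF P]]
  have yc: "y \<in> carrier R" using P'(3)[OF y] .
  obtain d :: nat and c where fc: "f \<in> carrier Q" and c: "\<And>i. i < d \<Longrightarrow> c i \<in> carrier R"
    and eq: "f [^]\<^bsub>Q\<^esub> d \<oplus>\<^bsub>Q\<^esub> (\<Oplus>\<^bsub>Q\<^esub>i\<in>{..<d}. \<phi> (c i) \<otimes>\<^bsub>Q\<^esub> f [^]\<^bsub>Q\<^esub> i) = \<zero>\<^bsub>Q\<^esub>"
    using f by (auto simp: integral_closure_def)
  define s where "s = (\<Oplus>\<^bsub>R\<^esub>i\<in>{..<d}. c i \<otimes>\<^bsub>R\<^esub> (a [^]\<^bsub>R\<^esub> i \<otimes>\<^bsub>R\<^esub> y [^]\<^bsub>R\<^esub> (d - i)))"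
  have t: "c i \<otimes>\<^bsub>R\<^esub> (a [^]\<^bsub>R\<^esub> i \<otimes>\<^bsub>R\<^esub> y [^]\<^bsub>R\<^esub> (d - i)) \<in> P" if i: "i < d" for i
  proof -
    have "y [^]\<^bsub>R\<^esub> (d - i) = y [^]\<^bsub>R\<^esub> (d - Suc i) \<otimes>\<^bsub>R\<^esub> y" using i by (metis R.nat_pow_Suc Suc_diff_Suc)
    then have "y [^]\<^bsub>R\<^esub> (d - i) \<in> P" using P'(7)[OF y] yc by simp
    then show ?thesis using c[OF i] a(1) by (intro P'(7)) auto
  qed
  have sP: "s \<in> P" unfolding s_def using t by (intro R.ideal_finsum[OF primeideal.axioms(1)[OF P]]) auto
  have hp: "\<phi> (b [^]\<^bsub>R\<^esub> i) = \<phi> b [^]\<^bsub>Q\<^esub> i" if "b \<in> carrier R" for b and i :: nat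
    using that by (induction i) simp_all
  have pw: "\<phi> y [^]\<^bsub>Q\<^esub> (i::nat) \<otimes>\<^bsub>Q\<^esub> f [^]\<^bsub>Q\<^esub> i = \<phi> (a [^]\<^bsub>R\<^esub> i)" for i
    using a yc fc by (simp add: Q.nat_pow_distrib[symmetric] hp)
  have "\<phi> s = (\<Oplus>\<^bsub>Q\<^esub>i\<in>{..<d}. \<phi> (c i \<otimes>\<^bsub>R\<^esub> (a [^]\<^bsub>R\<^esub> i \<otimes>\<^bsub>R\<^esub> y [^]\<^bsub>R\<^esub> (d - i))))"
    unfolding s_def using c a(1) yc by (subst \<phi>.hom_finsum) (auto simp: comp_def)
  also have "\<dots> = (\<Oplus>\<^bsub>Q\<^esub>i\<in>{..<d}. \<phi> y [^]\<^bsub>Q\<^esub> d \<otimes>\<^bsub>Q\<^esub> (\<phi> (c i) \<otimes>\<^bsub>Q\<^esub> f [^]\<^bsub>Q\<^esub> i))"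
  proof (intro Q.finsum_cong' refl)
    fix i assume "i \<in> {..<d}"
    then have i: "i < d" by simp
    have sp: "\<phi> y [^]\<^bsub>Q\<^esub> d = \<phi> y [^]\<^bsub>Q\<^esub> (d - i) \<otimes>\<^bsub>Q\<^esub> \<phi> y [^]\<^bsub>Q\<^esub> i" using i yc by (simp add: Q.nat_pow_mult)
    have "\<phi> (c i \<otimes>\<^bsub>R\<^esub> (a [^]\<^bsub>R\<^esub> i \<otimes>\<^bsub>R\<^esub> y [^]\<^bsub>R\<^esub> (d - i))) = \<phi> (c i) \<otimes>\<^bsub>Q\<^esub> ((\<phi> y [^]\<^bsub>Q\<^esub> i \<otimes>\<^bsub>Q\<^esub> f [^]\<^bsub>Q\<^esub> i) \<otimes>\<^bsub>Q\<^esub> \<phi> y [^]\<^bsub>Q\<^esub> (d - i))"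
      using c[OF i] a(1) yc by (simp add: pw hp)
    also have "\<dots> = \<phi> y [^]\<^bsub>Q\<^esub> d \<otimes>\<^bsub>Q\<^esub> (\<phi> (c i) \<otimes>\<^bsub>Q\<^esub> f [^]\<^bsub>Q\<^esub> i)"
      unfolding sp using c[OF i] yc fc by (simp add: Q.m_ac)
    finally show "\<phi> (c i \<otimes>\<^bsub>R\<^esub> (a [^]\<^bsub>R\<^esub> i \<otimes>\<^bsub>R\<^esub> y [^]\<^bsub>R\<^esub> (d - i))) = \<phi> y [^]\<^bsub>Q\<^esub> d \<otimes>\<^bsub>Q\<^esub> (\<phi> (c i) \<otimes>\<^bsub>Q\<^esub> f [^]\<^bsub>Q\<^esub> i)" .
  qed (use c yc fc in auto)
  also have "\<dots> = \<phi> y [^]\<^bsub>Q\<^esub> d \<otimes>\<^bsub>Q\<^esub> (\<Oplus>\<^bsub>Q\<^esub>i\<in>{..<d}. \<phi> (c i) \<otimes>\<^bsub>Q\<^esub> f [^]\<^bsub>Q\<^esub> i)"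
    using c yc fc by (intro Q.finsum_rdistr[symmetric]) auto
  finally have s: "\<phi> s = \<phi> y [^]\<^bsub>Q\<^esub> d \<otimes>\<^bsub>Q\<^esub> (\<Oplus>\<^bsub>Q\<^esub>i\<in>{..<d}. \<phi> (c i) \<otimes>\<^bsub>Q\<^esub> f [^]\<^bsub>Q\<^esub> i)" .
  have fs: "(\<Oplus>\<^bsub>Q\<^esub>i\<in>{..<d}. \<phi> (c i) \<otimes>\<^bsub>Q\<^esub> f [^]\<^bsub>Q\<^esub> i) \<in> carrier Q" using c fc by (intro Q.finsum_closed) auto
  have sc: "s \<in> carrier R" using P'(3)[OF sP] .
  have "\<phi> (s \<oplus>\<^bsub>R\<^esub> a [^]\<^bsub>R\<^esub> d) = \<phi> y [^]\<^bsub>Q\<^esub> d \<otimes>\<^bsub>Q\<^esub> (f [^]\<^bsub>Q\<^esub> d \<oplus>\<^bsub>Q\<^esub> (\<Oplus>\<^bsub>Q\<^esub>i\<in>{..<d}. \<phi> (c i) \<otimes>\<^bsub>Q\<^esub> f [^]\<^bsub>Q\<^esub> i))"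
    using s sc a(1) yc fc fs by (simp add: pw[symmetric] Q.r_distr Q.a_comm)
  also have "\<dots> = \<phi> \<zero>\<^bsub>R\<^esub>" unfolding eq using yc by simp
  finally have "s \<oplus>\<^bsub>R\<^esub> a [^]\<^bsub>R\<^esub> d = \<zero>\<^bsub>R\<^esub>" using inj_onD[OF \<phi>(2)] sc a(1) by simp
  then have "a [^]\<^bsub>R\<^esub> d \<in> P"
    using R.ideal_add_cancel[OF primeideal.axioms(1)[OF P] sP, of "a [^]\<^bsub>R\<^esub> d"] P'(2) a(1) by simp
  \<comment> \<open>Exponent zero has to be covered as well: for \<open>d = 0\<close> the integral
    equation says that one is zero in \<open>Q\<close>, and the membership just obtained is that of
    one in \<open>P\<close>.\<close>
  moreover have "a [^]\<^bsub>R\<^esub> i \<notin> P" for i :: nat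
  proof (induction i)
    case 0 then show ?case using R.prime_compl_one[OF P] by simp
  next
    case (Suc i) then show ?case using primeideal.I_prime[OF P, of "a [^]\<^bsub>R\<^esub> i" a] a(1) aP by auto
  qed
  ultimately show False by blast
qed


section \<open>Local rings and the regularity of the parameters\<close>

lemma local_ring_max_ideal:
  assumes "local_ring R"
  shows "maximalideal (max_ideal R) R" "maximalideal J R \<Longrightarrow> J = max_ideal R"
proof -
  have ex: "\<exists>!M. maximalideal M R" using assms by (simp add: local_ring_def)
  show *: "maximalideal (max_ideal R) R" unfolding max_ideal_def by (rule theI'[OF ex])
  show "maximalideal J R \<Longrightarrow> J = max_ideal R" using ex * by blast
qed

context noetherian_cring
begin

lemma proper_ideal_le_max_ideal:
  assumes "local_ring R" "ideal J R" "J \<noteq> carrier R"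
  shows "J \<subseteq> max_ideal R"
proof -
  define \<S> where "\<S> = {I. ideal I R \<and> J \<subseteq> I \<and> I \<noteq> carrier R}"
  have "\<S> \<noteq> {}" using assms by (auto simp: \<S>_def)
  then obtain I where I: "I \<in> \<S>" "\<And>I'. I' \<in> \<S> \<Longrightarrow> I \<subseteq> I' \<Longrightarrow> I' = I"
    by (rule ideal_maximal_element) (auto simp: \<S>_def)
  have I': "ideal I R" "J \<subseteq> I" "I \<noteq> carrier R" using I(1) by (auto simp: \<S>_def)
  have "maximalideal I R"
  proof (rule maximalidealI[OF I'(1)])
    show "carrier R \<noteq> I" using I'(3) by simp
    fix I2 assume "ideal I2 R" "I \<subseteq> I2" "I2 \<subseteq> carrier R"
    then show "I2 = I \<or> I2 = carrier R" using I(2)[of I2] I'(2) by (auto simp: \<S>_def)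
  qed
  then show ?thesis using local_ring_max_ideal(2)[OF assms(1)] I'(2) by blast
qed

lemma local_ring_units:
  assumes "local_ring R"
  shows "carrier R - max_ideal R \<subseteq> Units R"
proof
  fix s assume s: "s \<in> carrier R - max_ideal R"
  then have "PIdl s = carrier R"
    using proper_ideal_le_max_ideal[OF assms cgenideal_ideal[of s]] cgenideal_self[of s] by blast
  then have "\<one> \<in> PIdl s" by simp
  then obtain r where "r \<in> carrier R" "\<one> = r \<otimes> s" by (auto simp: cgenideal_def)
  then show "s \<in> Units R" using s m_comm[of r s] by (auto simp: Units_def)
qed

lemma max_ideal_primeideal: "local_ring R \<Longrightarrow> primeideal (max_ideal R) R"
  using local_ring_max_ideal(1) maximalideal_prime by blast

lemma max_ideal_eqI:
  assumes "local_ring R" "ideal J R" "J \<noteq> carrier R" "carrier R - J \<subseteq> Units R"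
  shows "max_ideal R = J"
proof
  show "J \<subseteq> max_ideal R" by (rule proper_ideal_le_max_ideal[OF assms(1-3)])
  note M = primeideal.axioms(1)[OF max_ideal_primeideal[OF assms(1)]]
  have "max_ideal R \<noteq> carrier R" using primeideal.I_notcarr[OF max_ideal_primeideal[OF assms(1)]] by simp
  moreover have "\<one> \<in> max_ideal R" if "s \<in> max_ideal R" "s \<in> Units R" for s
    using ideal_rules(7)[OF M that(1), of "inv s"] that(2) by simp
  ultimately show "max_ideal R \<subseteq> J"
    using assms(4) ideal_rules(1)[OF M] ideal.one_imp_carrier[OF M] by blast
qed

text \<open>A finite Krull dimension is attained by a chain. Its top member can be replaced by the
  maximal ideal, which contains every proper ideal; with \<open>1 \<le> l\<close> there is a member
  below the top, and the last inclusion stays strict.\<close>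

lemma exists_prime_chain:
  assumes loc: "local_ring R" and dim: "krull_dim R = enat l" and l: "1 \<le> l"
  shows "\<exists>Q. prime_chain R l Q \<and> Q l = max_ideal R"
proof -
  have "{enat k | k P. (\<forall>i\<le>k. primeideal (P i) R) \<and> (\<forall>i<k. P i \<subset> P (Suc i))} = {enat k | k. \<exists>Q. prime_chain R k Q}"
    by (auto simp: prime_chain_def)
  then have "Sup {enat k | k. \<exists>Q. prime_chain R k Q} = enat l" using dim by (simp add: krull_dim_def)
  moreover have "\<exists>Q. prime_chain R 0 Q"
    using max_ideal_primeideal[OF loc] by (intro exI[of _ "\<lambda>_. max_ideal R"]) (simp add: prime_chain_def)
  ultimately have "\<exists>Q. prime_chain R l Q" by (rule Sup_enat_attained(1))
  then obtain Q where Q: "prime_chain R l Q" by blast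
  have "Q l \<subseteq> max_ideal R"
    using prime_chain_primeideal[OF Q order_refl] primeideal.I_notcarr
    by (intro proper_ideal_le_max_ideal[OF loc prime_chain_ideal[OF Q order_refl]]) blast
  moreover have "Q (l - 1) \<subset> Q l" using prime_chain_strict[OF Q, of "l - 1"] l by simp
  ultimately have last: "Q (l - 1) \<subset> max_ideal R" by blast
  have "prime_chain R l (Q(l := max_ideal R))"
    unfolding prime_chain_def
  proof (intro conjI allI impI)
    fix i assume "i \<le> l"
    then show "primeideal ((Q(l := max_ideal R)) i) R"
      using prime_chain_primeideal[OF Q] max_ideal_primeideal[OF loc] by simp
  next
    fix i assume i: "i < l"
    show "(Q(l := max_ideal R)) i \<subset> (Q(l := max_ideal R)) (Suc i)"
    proof (cases "Suc i = l")
      case True then show ?thesis using last by (simp add: True[symmetric])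
    next
      case False then show ?thesis using prime_chain_strict[OF Q i] i by simp
    qed
  qed
  then show ?thesis by (intro exI[of _ "Q(l := max_ideal R)"]) simp
qed

text \<open>Only the first parameter is replaced by a power, so the ideals generated by the later
  elements remain the same primes, and neither \<open>X j\<close> nor a power of it lies in the one
  that follows. A product in a prime then forces the other factor into it, which is the regularity
  that \<open>regular_sequence_relation\<close> requires.\<close>

lemma regular_parameters_first_pow_relation:
  assumes X: "X ` {1..l} \<subseteq> carrier R" "Idl (X ` {1..l}) = M" and Q: "prime_chain R l Q" "Q l = M"
    and local: "carrier R - M \<subseteq> Units R" and k: "1 \<le> k"
    and w: "w \<in> {1..l} \<rightarrow> carrier R" and a: "a \<in> {1..l} \<rightarrow> carrier R"
    and rel: "(\<Oplus>j\<in>{1..l}. w j \<otimes> first_pow R X k j) = \<zero>"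
  shows "(\<forall>j\<in>{1..l}. w j \<in> M) \<and> (\<Oplus>j\<in>{1..l}. w j \<otimes> a j) \<in> I2 R l a (first_pow R X k)"
proof -
  define Y where "Y j = first_pow R X k j" for j
  have Yf: "Y = first_pow R X k" by (rule ext) (simp add: Y_def)
  have Xf: "X \<in> {1..l} \<rightarrow> carrier R" using X(1) by blast
  have Y: "Y \<in> {1..l} \<rightarrow> carrier R" unfolding Yf by (rule ideal_first_pow_ideal(1)[OF Xf])
  note reg = regular_parameters_prime[OF X Q local]
  have tail: "Y ` {j<..l} = X ` {j<..l}" if "1 \<le> j" for j
    using that by (intro image_cong) (auto simp: Y_def first_pow_def)
  have "r \<in> Idl (Y ` {j<..l})" if j: "j \<in> {1..l}" and r: "r \<in> carrier R" "r \<otimes> Y j \<in> Idl (Y ` {j<..l})" for j r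
  proof -
    have p: "primeideal (Idl (X ` {j<..l})) R" "X j \<notin> Idl (X ` {j<..l})" using reg[of j] j by auto
    have Xj: "X j \<in> carrier R" using Xf j by blast
    have "Y j \<notin> Idl (X ` {j<..l})"
      using prime_pow_notin[OF p(1) Xj p(2)] p(2) by (auto simp: Y_def first_pow_def)
    moreover have "r \<otimes> Y j \<in> Idl (X ` {j<..l})" using r(2) tail[of j] j by simp
    moreover have "Y j \<in> carrier R" using Y j by blast
    ultimately show ?thesis using primeideal.I_prime[OF p(1) r(1)] tail[of j] j by auto
  qed
  note 1 = regular_sequence_relation[OF Y a this, of 0 w]
  have e: "{0<..l} = {1..l}" by auto
  have "(\<forall>j\<in>{1..l}. w j \<in> Idl (Y ` {1..l})) \<and> (\<Oplus>j\<in>{1..l}. w j \<otimes> a j) \<in> I2 R l a Y"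
    using 1 w rel unfolding e Yf by simp
  moreover have "Idl (Y ` {1..l}) \<subseteq> M"
  proof (rule genideal_minimal)
    show M: "ideal M R" using X(2) genideal_ideal[OF X(1)] by simp
    show "Y ` {1..l} \<subseteq> M"
    proof (rule image_subsetI)
      fix j assume j: "j \<in> {1..l}"
      have XM: "X j \<in> M" using genideal_self[OF X(1)] X(2) j by blast
      show "Y j \<in> M"
      proof (cases "j = 1")
        case True
        obtain k' where "k = Suc k'" using k by (cases k) auto
        then show ?thesis using True XM ideal_rules(3,7)[OF M] by (simp add: Y_def first_pow_def)
      next
        case False
        then show ?thesis using XM by (simp add: Y_def first_pow_def)
      qed
    qed
  qed
  ultimately show ?thesis unfolding Yf by blast
qed

end

text \<open>The image of \<open>Idl S\<close> under the surjection onto the quotient is already an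
  ideal, so it contains all that the cosets generate. The comparison of \<open>I k\<close> with
  \<open>J k\<close> rests on this.\<close>

lemma (in cring) coset_mem_Idl_iff:
  assumes \<aa>: "ideal \<aa> R" and S: "S \<subseteq> carrier R" and t: "t \<in> carrier R"
  shows "\<aa> +> t \<in> genideal (R Quot \<aa>) ((\<lambda>s. \<aa> +> s) ` S) \<longleftrightarrow> (\<exists>u\<in>Idl S. \<exists>\<alpha>\<in>\<aa>. t = u \<oplus> \<alpha>)"
proof -
  interpret q: ring_hom_cring R "R Quot \<aa>" "(+>) \<aa>" by (rule ideal.rcos_ring_hom_cring[OF \<aa> is_cring])
  note I = ideal_rules[OF genideal_ideal[OF S]] and a' = ideal_rules[OF \<aa>]
  have Sc: "(\<lambda>s. \<aa> +> s) ` S \<subseteq> carrier (R Quot \<aa>)" using S by auto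
  have pre: "ideal {r \<in> carrier R. \<aa> +> r \<in> genideal (R Quot \<aa>) ((\<lambda>s. \<aa> +> s) ` S)} R"
    using ring_hom_ring.ideal_vimage[OF ideal.rcos_ring_hom_ring[OF \<aa>] q.S.genideal_ideal[OF Sc]] .
  show ?thesis
  proof
    assume "\<aa> +> t \<in> genideal (R Quot \<aa>) ((\<lambda>s. \<aa> +> s) ` S)"
    moreover have "genideal (R Quot \<aa>) ((\<lambda>s. \<aa> +> s) ` S) \<subseteq> (\<lambda>s. \<aa> +> s) ` (Idl S)"
      using genideal_self[OF S]
      by (intro q.S.genideal_minimal ring_ideal_imp_quot_ideal[OF \<aa> genideal_ideal[OF S]]) auto
    ultimately obtain u where u: "u \<in> Idl S" "\<aa> +> t = \<aa> +> u" by blast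
    then have "t \<ominus> u \<in> \<aa>" using quotient_eq_iff_same_a_r_cos[OF \<aa> t, of u] I(3) by simp
    moreover have "t = u \<oplus> (t \<ominus> u)" using t I(3)[OF u(1)] by algebra
    ultimately show "\<exists>u\<in>Idl S. \<exists>\<alpha>\<in>\<aa>. t = u \<oplus> \<alpha>" using u(1) by blast
  next
    assume "\<exists>u\<in>Idl S. \<exists>\<alpha>\<in>\<aa>. t = u \<oplus> \<alpha>"
    then obtain u \<alpha> where u: "u \<in> Idl S" "\<alpha> \<in> \<aa>" "t = u \<oplus> \<alpha>" by blast
    have "t \<ominus> u = \<alpha>" unfolding u(3) using I(3)[OF u(1)] a'(3)[OF u(2)] by algebra
    then have "\<aa> +> t = \<aa> +> u" using quotient_eq_iff_same_a_r_cos[OF \<aa> t, of u] I(3)[OF u(1)] u(2) by simp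
    moreover have "Idl S \<subseteq> {r \<in> carrier R. \<aa> +> r \<in> genideal (R Quot \<aa>) ((\<lambda>s. \<aa> +> s) ` S)}"
      using q.S.genideal_self[OF Sc] S by (intro genideal_minimal[OF pre]) auto
    ultimately show "\<aa> +> t \<in> genideal (R Quot \<aa>) ((\<lambda>s. \<aa> +> s) ` S)" using u(1) by auto
  qed
qed

section \<open>The fractional canonical ideal\<close>

lemma a_inv_frac_module: "a_inv (frac_module Q \<phi> (carrier Q)) = a_inv Q"
  by (simp add: a_inv_def m_inv_def frac_module_def fun_eq_iff)

text \<open>Depth one provides a nonempty regular sequence. Its first entry is a nonzerodivisor
  because the submodule spanned by the empty initial segment is zero.\<close>

lemma (in cring) CM_dim_one_nonzerodivisor:
  assumes R: "CM_local_ring R" and dim: "krull_dim R = 1"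
  obtains y where "y \<in> max_ideal R" "y \<in> nonzerodivisors R"
proof -
  interpret P: module R "reg_module R" by (rule module_reg_module)
  have "depth R (reg_module R) = 1" using R dim by (simp add: CM_local_ring_def)
  have "\<exists>xs. set xs \<subseteq> max_ideal R \<and> regular_sequence R (reg_module R) xs \<and> xs \<noteq> []"
  proof (rule ccontr)
    assume "\<not> ?thesis"
    then have "depth R (reg_module R) \<le> 0" unfolding depth_def by (intro Sup_least) (auto simp: zero_enat_def)
    then show False using \<open>depth R (reg_module R) = 1\<close> by simp
  qed
  then obtain xs where xs: "set xs \<subseteq> max_ideal R" "regular_sequence R (reg_module R) xs" "xs \<noteq> []" by blast
  then obtain y ys where y: "xs = y # ys" by (cases xs) auto
  have e: "{s \<odot>\<^bsub>reg_module R\<^esub> z | s z. s \<in> set (take 0 xs) \<and> z \<in> carrier (reg_module R)} = {}" by simp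
  have z: "smult_span R (reg_module R) (set (take 0 xs)) = {\<zero>}"
    unfolding smult_span_def e
  proof
    have "submodule {\<zero>} R (reg_module R)" using zeroideal by (simp add: submodule_reg_module)
    then show "mod_span R (reg_module R) {} \<subseteq> {\<zero>}" by (rule mod_span_least) simp
    show "{\<zero>} \<subseteq> mod_span R (reg_module R) {}"
      using P.submodule_rules(2)[OF mod_span_submodule(1)[OF module_reg_module, of "{}"]] by simp
  qed
  have "0 < length xs" using y by simp
  then have "\<forall>z\<in>carrier R. y \<otimes> z = \<zero> \<longrightarrow> z = \<zero>"
    using xs(2) z y unfolding regular_sequence_def by force
  then have "y \<in> nonzerodivisors R" using xs(2) y by (auto simp: nonzerodivisors_def regular_sequence_def)
  then show ?thesis using that xs(1) y by auto
qed

text \<open>Depth one and type one make \<open>Ext\<close> in degree one, from the residue field to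
  \<open>K\<close>, a module of length one. The maximal ideal contains a nonzerodivisor, a unit of
  \<open>Q\<close>, so it kills no nonzero element of \<open>Q\<close>, and
  \<open>socle_length_le_Ext1\<close> applies with \<open>Q\<close> as the ambient module.\<close>

lemma (in noetherian_cring) canonical_socle:
  assumes R: "CM_local_ring R" "krull_dim R = 1" and Q: "total_fraction_ring R Q \<phi>"
    and K: "fractional_canonical_ideal R Q \<phi> K"
    and z: "z \<in> carrier Q" "\<And>y. y \<in> max_ideal R \<Longrightarrow> \<phi> y \<otimes>\<^bsub>Q\<^esub> z \<in> K" "z \<notin> K"
    and z': "z' \<in> carrier Q" "\<And>y. y \<in> max_ideal R \<Longrightarrow> \<phi> y \<otimes>\<^bsub>Q\<^esub> z' \<in> K"
  shows "\<exists>r\<in>carrier R. z' \<ominus>\<^bsub>Q\<^esub> \<phi> r \<otimes>\<^bsub>Q\<^esub> z \<in> K"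
proof -
  have loc: "local_ring R" and cq: "cring Q" and \<phi>: "\<phi> \<in> ring_hom R Q"
    using R Q by (auto simp: CM_local_ring_def total_fraction_ring_def)
  interpret Q: cring Q by fact
  let ?W = "frac_module Q \<phi> (carrier Q)"
  have W: "module R ?W" by (rule module_frac_module[OF is_cring cq \<phi>])
  have K1: "submodule K R ?W" "canonical_module R (frac_module Q \<phi> K)"
    using K by (auto simp: fractional_canonical_ideal_def)
  have "depth R (frac_module Q \<phi> K) = 1" "mod_type R (frac_module Q \<phi> K) = 1"
    using K1(2) R(2) by (auto simp: canonical_module_def)
  then have len: "mod_length R (Ext R 1 (mod_quot (reg_module R) (max_ideal R)) (restrict_mod ?W K)) = 1"
    by (simp add: mod_type_def restrict_frac_module one_enat_def)
  obtain y where y: "y \<in> max_ideal R" "y \<in> nonzerodivisors R" using CM_dim_one_nonzerodivisor[OF R] .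
  have u: "\<phi> y \<in> Units Q" using Q y(2) by (auto simp: total_fraction_ring_def)
  have "v = \<zero>\<^bsub>Q\<^esub>" if v: "v \<in> carrier Q" "\<phi> y \<otimes>\<^bsub>Q\<^esub> v = \<zero>\<^bsub>Q\<^esub>" for v
  proof -
    have "v = inv\<^bsub>Q\<^esub> \<phi> y \<otimes>\<^bsub>Q\<^esub> (\<phi> y \<otimes>\<^bsub>Q\<^esub> v)" using u Q.Units_closed[OF u] v(1) by (simp add: Q.m_assoc[symmetric])
    then show ?thesis using v(2) u by simp
  qed
  then have nosoc: "v = \<zero>\<^bsub>?W\<^esub>"
    if "v \<in> carrier ?W" "\<And>y. y \<in> max_ideal R \<Longrightarrow> y \<odot>\<^bsub>?W\<^esub> v = \<zero>\<^bsub>?W\<^esub>" for v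
    using that y(1) by simp
  have "\<exists>r\<in>carrier R. z' \<ominus>\<^bsub>?W\<^esub> r \<odot>\<^bsub>?W\<^esub> z \<in> K"
    using z z' by (intro socle_length_le_Ext1[OF W K1(1) primeideal.axioms(1)[OF max_ideal_primeideal[OF loc]] nosoc len]) auto
  then show ?thesis by (simp add: a_minus_def a_inv_frac_module)
qed

text \<open>Everything happens inside \<open>R[K]\<close>: it is an \<open>R\<close>-module
  containing all products of two elements of \<open>K\<close>, hence \<open>K^2\<close>; and the
  conductor is an ideal of \<open>R[K]\<close>, so it is stable under multiplication by
  \<open>K\<close>.\<close>

lemma (in cring) conductor_facts:
  assumes Q: "total_fraction_ring R Q \<phi>" and K: "submodule K R (frac_module Q \<phi> (carrier Q))"
    "\<phi> ` carrier R \<subseteq> K"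
  shows "K \<subseteq> frac_prod R Q \<phi> K K" "submodule (frac_prod R Q \<phi> K K) R (frac_module Q \<phi> (carrier Q))"
    and "r \<in> goto_conductor R Q \<phi> K \<Longrightarrow> z \<in> frac_prod R Q \<phi> K K \<Longrightarrow> \<phi> r \<otimes>\<^bsub>Q\<^esub> z \<in> \<phi> ` carrier R"
    and "r \<in> goto_conductor R Q \<phi> K \<Longrightarrow> f \<in> K \<Longrightarrow> \<exists>r'\<in>goto_conductor R Q \<phi> K. \<phi> r \<otimes>\<^bsub>Q\<^esub> f = \<phi> r'"
proof -
  have cq: "cring Q" and \<phi>: "\<phi> \<in> ring_hom R Q"
    using Q by (auto simp: total_fraction_ring_def)
  interpret Q: cring Q by fact
  let ?W = "frac_module Q \<phi> (carrier Q)"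
  have W: "module R ?W" by (rule module_frac_module[OF is_cring cq \<phi>])
  interpret W: module R ?W by (rule W)
  have \<phi>c: "\<phi> r \<in> carrier Q" if "r \<in> carrier R" for r using ring_hom_closed[OF \<phi> that] .
  have Kc: "K \<subseteq> carrier Q" using W.submodule_rules(1)[OF K(1)] by simp
  have H: "\<phi> ` carrier R \<union> K \<subseteq> carrier Q" using Kc \<phi>c by auto
  let ?G = "generate_ring Q (\<phi> ` carrier R \<union> K)"
  have Gc: "g \<in> carrier Q" if "g \<in> ?G" for g using Q.generate_ring_in_carrier[OF H that] .
  have KG: "K \<subseteq> ?G" and RG: "\<phi> ` carrier R \<subseteq> ?G" by (auto intro: generate_ring.incl)
  let ?P = "{y \<otimes>\<^bsub>Q\<^esub> z | y z. y \<in> K \<and> z \<in> K}"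
  have P: "?P \<subseteq> carrier ?W" using Kc by auto
  have K2: "frac_prod R Q \<phi> K K = mod_span R ?W ?P" by (simp add: frac_prod_def frac_span_def)
  note sp = mod_span_submodule[OF W P, folded K2]
  show "submodule (frac_prod R Q \<phi> K K) R ?W" by (rule sp(1))
  show "K \<subseteq> frac_prod R Q \<phi> K K"
  proof
    fix z assume z: "z \<in> K"
    have "\<one>\<^bsub>Q\<^esub> = \<phi> \<one>" using ring_hom_one[OF \<phi>] by simp
    then have "\<one>\<^bsub>Q\<^esub> \<in> K" using K(2) by auto
    moreover have "z = \<one>\<^bsub>Q\<^esub> \<otimes>\<^bsub>Q\<^esub> z" using z Kc by auto
    ultimately have "z \<in> ?P" using z by blast
    then show "z \<in> frac_prod R Q \<phi> K K" using sp(2) by blast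
  qed
  have "submodule ?G R ?W"
    using Gc Q.zero_in_generate RG by (intro W.submoduleI') (auto intro: generate_ring.intros)
  then have K2G: "frac_prod R Q \<phi> K K \<subseteq> ?G" unfolding K2
    using KG by (intro mod_span_least) (auto intro: generate_ring.eng_mult)
  have cond: "r \<in> goto_conductor R Q \<phi> K \<longleftrightarrow> r \<in> carrier R \<and> (\<forall>z\<in>?G. \<phi> r \<otimes>\<^bsub>Q\<^esub> z \<in> \<phi> ` carrier R)" for r
    using \<phi>c by (auto simp: goto_conductor_def colon_def)
  show "r \<in> goto_conductor R Q \<phi> K \<Longrightarrow> z \<in> frac_prod R Q \<phi> K K \<Longrightarrow> \<phi> r \<otimes>\<^bsub>Q\<^esub> z \<in> \<phi> ` carrier R"
    using cond K2G by blast
  assume r: "r \<in> goto_conductor R Q \<phi> K" and f: "f \<in> K"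
  have rc: "r \<in> carrier R" using r cond by blast
  obtain r' where r': "r' \<in> carrier R" "\<phi> r \<otimes>\<^bsub>Q\<^esub> f = \<phi> r'" using r f cond KG by blast
  have "\<phi> r' \<otimes>\<^bsub>Q\<^esub> z \<in> \<phi> ` carrier R" if z: "z \<in> ?G" for z
  proof -
    have "\<phi> r' \<otimes>\<^bsub>Q\<^esub> z = \<phi> r \<otimes>\<^bsub>Q\<^esub> (f \<otimes>\<^bsub>Q\<^esub> z)"
      unfolding r'(2)[symmetric] using \<phi>c[OF rc] f Kc Gc[OF z] by (auto simp: Q.m_assoc)
    moreover have "f \<otimes>\<^bsub>Q\<^esub> z \<in> ?G" using f KG z by (auto intro: generate_ring.eng_mult)
    ultimately show ?thesis using r cond by simp
  qed
  then show "\<exists>r'\<in>goto_conductor R Q \<phi> K. \<phi> r \<otimes>\<^bsub>Q\<^esub> f = \<phi> r'" using cond r' by blast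
qed

text \<open>This is the inequality \<open>n \<le> length (R / c)\<close>.  Only the socle of \<open>K\<^sup>2 / K\<close> is used, instead of the
  canonical duality between \<open>K\<^sup>2 / K\<close> and \<open>R / c\<close>.\<close>

lemma (in noetherian_cring) conductor_exponent_ge:
  fixes l :: nat
  assumes R: "CM_local_ring R" "krull_dim R = 1" and Q: "total_fraction_ring R Q \<phi>"
    and K: "fractional_canonical_ideal R Q \<phi> K" and Goto: "n_Goto R Q \<phi> K n"
    and x: "x ` {1..l} \<subseteq> carrier R" "genideal R (x ` {1..l}) = max_ideal R" "1 \<le> l"
    and c: "\<And>j. j \<in> {2..l} \<Longrightarrow> x j \<in> goto_conductor R Q \<phi> K"
      "x 1 [^]\<^bsub>R\<^esub> (s::nat) \<in> goto_conductor R Q \<phi> K"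
  shows "n \<le> s"
proof -
  have cq: "cring Q" and \<phi>: "\<phi> \<in> ring_hom R Q"
    using Q by (auto simp: total_fraction_ring_def)
  interpret Q: cring Q by fact
  let ?W = "frac_module Q \<phi> (carrier Q)" and ?K2 = "frac_prod R Q \<phi> K K"
  have W: "module R ?W" by (rule module_frac_module[OF is_cring cq \<phi>])
  interpret W: module R ?W by (rule W)
  have \<phi>c: "\<phi> r \<in> carrier Q" if "r \<in> carrier R" for r using ring_hom_closed[OF \<phi> that] .
  have K1: "submodule K R ?W" "\<phi> ` carrier R \<subseteq> K"
    using K by (auto simp: fractional_canonical_ideal_def)
  note cf = conductor_facts[OF Q K1]
  note K' = W.submodule_rules[OF K1(1)] and K2' = W.submodule_rules[OF cf(2)]
  let ?M = "restrict_mod ?W ?K2"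
  have M: "module R ?M" by (rule module_restrict_mod[OF W cf(2)])
  interpret M: plain_module R ?M unfolding plain_module_def by (rule M)
  have KM: "submodule K R ?M" using submodule_restrict_mod[OF W cf(2,1)] K1(1) by simp
  have "mod_length R (mod_quot ?M K) = enat n"
    using Goto by (simp add: n_Goto_def Let_def restrict_frac_module)
  from M.mod_length_quot_chain[OF KM this] obtain H where
    H: "\<And>i. i \<le> n \<Longrightarrow> submodule (H i) R ?M" "\<And>i. i \<le> n \<Longrightarrow> K \<subseteq> H i" "\<And>i. i < n \<Longrightarrow> H i \<subset> H (Suc i)" by blast
  have HK2: "H i \<subseteq> ?K2" if "i \<le> n" for i using M.submodule_rules(1)[OF H(1)[OF that]] by simp
  have HW: "submodule (H i) R ?W" if "i \<le> n" for i
    using H(1)[OF that] submodule_restrict_mod[OF W cf(2) HK2[OF that]] by simp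
  have "1 \<in> {1..l}" using x(3) by simp
  then have x1: "x 1 \<in> carrier R" using x(1) by blast
  show ?thesis
  proof (rule W.uniserial_chain_length[where H = H and n = n, OF K1(1) cf(2,1) x1 _ _ HW H(2) HK2 H(3)])
    fix z assume "z \<in> ?K2"
    then show "(x 1 [^] s) \<odot>\<^bsub>?W\<^esub> z \<in> K" using cf(3)[OF c(2)] K1(2) by auto
  next
    fix z z' assume z: "z \<in> ?K2" "x 1 \<odot>\<^bsub>?W\<^esub> z \<in> K" "z \<notin> K" and z': "z' \<in> ?K2" "x 1 \<odot>\<^bsub>?W\<^esub> z' \<in> K"
    \<comment> \<open>The generators \<open>x j\<close> with \<open>j \<ge> 2\<close> lie in the
      conductor and carry \<open>K^2\<close> into \<open>R \<subseteq> K\<close>. So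
      \<open>x 1\<close> alone decides whether the whole maximal ideal carries an element of
      \<open>K^2\<close> into \<open>K\<close>.\<close>
    have soc: "\<phi> y \<otimes>\<^bsub>Q\<^esub> v \<in> K" if v: "v \<in> ?K2" "x 1 \<odot>\<^bsub>?W\<^esub> v \<in> K" and y: "y \<in> max_ideal R" for v y
    proof -
      have vc: "v \<in> carrier Q" using K2'(3)[OF v(1)] by simp
      have "ideal {y \<in> carrier R. \<phi> y \<otimes>\<^bsub>Q\<^esub> v \<in> K} R"
      proof (rule idealI')
        show "\<zero> \<in> {y \<in> carrier R. \<phi> y \<otimes>\<^bsub>Q\<^esub> v \<in> K}"
          using W.smult_l_null[of v] vc K'(2) by simp
        show "a \<oplus> b \<in> {y \<in> carrier R. \<phi> y \<otimes>\<^bsub>Q\<^esub> v \<in> K}"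
          if "a \<in> {y \<in> carrier R. \<phi> y \<otimes>\<^bsub>Q\<^esub> v \<in> K}" "b \<in> {y \<in> carrier R. \<phi> y \<otimes>\<^bsub>Q\<^esub> v \<in> K}" for a b
          using that W.smult_l_distr[of a b v] vc K'(4)[of "\<phi> a \<otimes>\<^bsub>Q\<^esub> v" "\<phi> b \<otimes>\<^bsub>Q\<^esub> v"] by simp
        show "r \<otimes> a \<in> {y \<in> carrier R. \<phi> y \<otimes>\<^bsub>Q\<^esub> v \<in> K}"
          if "a \<in> {y \<in> carrier R. \<phi> y \<otimes>\<^bsub>Q\<^esub> v \<in> K}" "r \<in> carrier R" for a r
          using that W.smult_assoc1[of r a v] vc K'(7)[of "\<phi> a \<otimes>\<^bsub>Q\<^esub> v" r] by simp
      qed blast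
      moreover have "x ` {1..l} \<subseteq> {y \<in> carrier R. \<phi> y \<otimes>\<^bsub>Q\<^esub> v \<in> K}"
      proof (rule image_subsetI)
        fix j assume j: "j \<in> {1..l}"
        have "\<phi> (x j) \<otimes>\<^bsub>Q\<^esub> v \<in> K"
        proof (cases "j = 1")
          case True then show ?thesis using v(2) by simp
        next
          case False
          then have "j \<in> {2..l}" using j by auto
          then show ?thesis using cf(3)[OF c(1) v(1)] K1(2) by blast
        qed
        then show "x j \<in> {y \<in> carrier R. \<phi> y \<otimes>\<^bsub>Q\<^esub> v \<in> K}" using x(1) j by auto
      qed
      ultimately have "genideal R (x ` {1..l}) \<subseteq> {y \<in> carrier R. \<phi> y \<otimes>\<^bsub>Q\<^esub> v \<in> K}" by (rule genideal_minimal)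
      then show ?thesis using y x(2) by blast
    qed
    have "\<exists>r\<in>carrier R. z' \<ominus>\<^bsub>Q\<^esub> \<phi> r \<otimes>\<^bsub>Q\<^esub> z \<in> K"
      using K2'(3)[OF z(1)] K2'(3)[OF z'(1)] z(3) soc[OF z(1,2)] soc[OF z']
      by (intro canonical_socle[OF R Q K]) auto
    then show "\<exists>r\<in>carrier R. z' \<ominus>\<^bsub>?W\<^esub> r \<odot>\<^bsub>?W\<^esub> z \<in> K" by (simp add: a_minus_def a_inv_frac_module)
  qed auto
qed

section \<open>The minimal presentation of \<open>K\<close> over \<open>T\<close> and the resulting
  generators of \<aa>\<close>

theorem corollary8p4:
  fixes T :: "'a ring" and \<aa> :: "'a set" and n l :: nat
    and Q :: "'q ring" and \<phi> :: "'a set \<Rightarrow> 'q" and K :: "'q set"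
    and x :: "nat \<Rightarrow> 'a set" and X :: "nat \<Rightarrow> 'a"
    and L :: "nat \<Rightarrow> nat" and f :: "nat \<Rightarrow> nat \<Rightarrow> 'q"
  defines "\<nn> \<equiv> max_ideal T"
    and "R \<equiv> T Quot \<aa>"
    and "\<mm> \<equiv> (\<lambda>t. \<aa> +>\<^bsub>T\<^esub> t) ` max_ideal T"
    and "\<cc> \<equiv> goto_conductor (T Quot \<aa>) Q \<phi> K"
    and "KR \<equiv> mod_quot (frac_module Q \<phi> K) (\<phi> ` carrier (T Quot \<aa>))"
    and "I \<equiv> first_pow_ideal (T Quot \<aa>) l x"
    and "J \<equiv> first_pow_ideal T l X"
  assumes T: "regular_local_ring T" "krull_dim T = enat l" "l \<ge> 3"
    and \<aa>: "ideal \<aa> T" "\<aa> \<noteq> carrier T" "\<aa> \<subseteq> ideal_prod T \<nn> \<nn>"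
    and n: "n \<ge> 2"
    and R: "CM_local_ring R" "krull_dim R = 1" "\<not> gorenstein_local_ring R"
    and Q: "total_fraction_ring R Q \<phi>"
    and K: "fractional_canonical_ideal R Q \<phi> K"
    and Goto: "n_Goto R Q \<phi> K n"
    and emb: "emb_dim (R Quot \<cc>) = 1"
    and x: "minimal_generators R \<mm> l x" "\<cc> = I n"
    and L: "L n > 0" "enat (\<Sum>i=1..n. L i) = CM_type R - 1"
      "mod_iso R KR (direct_sum (blocks n L) (\<lambda>(i, j). mod_quot (reg_module R) (I i)))"
    and X: "\<forall>j\<in>{1..l}. X j \<in> \<nn> \<and> \<aa> +>\<^bsub>T\<^esub> X j = x j"
    and f: "\<forall>(i, j)\<in>blocks n L. f i j \<in> K"
      "K = frac_span R Q \<phi> (\<phi> ` carrier R \<union> (\<lambda>(i, j). f i j) ` blocks n L)"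
      "internal_direct_sum R KR (blocks n L)
         (\<lambda>(i, j). mod_span R KR {\<phi> ` carrier R +>\<^bsub>frac_module Q \<phi> K\<^esub> f i j})"
      "\<forall>(i, j)\<in>blocks n L. mod_iso R
         (restrict_mod KR (mod_span R KR {\<phi> ` carrier R +>\<^bsub>frac_module Q \<phi> K\<^esub> f i j}))
         (mod_quot (reg_module R) (I i))"
  shows "\<exists>(A :: nat \<Rightarrow> nat \<Rightarrow> nat \<Rightarrow> 'a) (q :: nat) (c :: nat \<Rightarrow> 'a).
    minimal_free_presentation T (frac_module Q (\<lambda>t. \<phi> (\<aa> +>\<^bsub>T\<^esub> t)) K)
      (pres_rows n L) (pres_cols n L l q) (pres_M T X A c) (pres_N Q f) \<and>
    (\<forall>i\<in>{1..L n}. \<forall>j\<in>{1..l}. A n i j \<in> J n) \<and>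
    (\<forall>k\<in>{1..<n}. \<forall>i\<in>{1..L k}. A k i 1 \<in> \<nn> \<and> (\<forall>j\<in>{2..l}. A k i j \<in> J n)) \<and>
    (\<forall>s\<in>{1..q}. c s \<in> \<nn>) \<and>
    \<aa> = ideal_sum T (blocks n L) (\<lambda>(i, j). I2 T l (A i j) (first_pow T X i))
          <+>\<^bsub>T\<^esub> genideal T (c ` {1..q})"
proof -
  have loc: "local_ring T" and "noetherian_ring T" using T(1) by (auto simp: regular_local_ring_def)
  interpret T: noetherian_cring T
    using \<open>local_ring T\<close> \<open>noetherian_ring T\<close> by (simp add: local_ring_def noetherian_cring_def)
  have locR: "local_ring R" and "noetherian_ring R" using R(1) by (auto simp: CM_local_ring_def)
  interpret R: noetherian_cring R
    using \<open>local_ring R\<close> \<open>noetherian_ring R\<close> by (simp add: local_ring_def noetherian_cring_def)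
  have Q': "cring Q" "\<phi> \<in> ring_hom R Q" "inj_on \<phi> (carrier R)"
    using Q by (auto simp: total_fraction_ring_def)
  interpret Q: cring Q by fact
  define \<pi> where "\<pi> t = \<aa> +>\<^bsub>T\<^esub> t" for t
  interpret \<pi>: ring_hom_cring T R \<pi>
    using ideal.rcos_ring_hom_cring[OF \<aa>(1) T.is_cring] by (simp add: \<pi>_def[abs_def] R_def)
  have carR: "carrier R = \<pi> ` carrier T" by (auto simp: R_def FactRing_def A_RCOSETS_def' \<pi>_def)
  have \<pi>_eq: "\<pi> t = \<pi> u \<longleftrightarrow> t \<ominus>\<^bsub>T\<^esub> u \<in> \<aa>" if "t \<in> carrier T" "u \<in> carrier T" for t u
    using T.quotient_eq_iff_same_a_r_cos[OF \<aa>(1) that] by (simp add: \<pi>_def)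
  have pn: "primeideal \<nn> T" unfolding \<nn>_def by (rule T.max_ideal_primeideal[OF loc])
  note idn = primeideal.axioms(1)[OF pn]
  note n' = T.ideal_rules[OF idn] and a' = T.ideal_rules[OF \<aa>(1)]
  have units: "carrier T - \<nn> \<subseteq> Units T" unfolding \<nn>_def by (rule T.local_ring_units[OF loc])
  have one_n: "\<one>\<^bsub>T\<^esub> \<notin> \<nn>" using T.prime_compl_one[OF pn] by blast
  have an: "\<aa> \<subseteq> \<nn>" unfolding \<nn>_def by (rule T.proper_ideal_le_max_ideal[OF loc \<aa>(1,2)])
  have mm: "\<mm> = \<pi> ` \<nn>" by (simp add: \<mm>_def \<pi>_def \<nn>_def)
  have \<pi>n: "t \<in> \<nn>" if t: "t \<in> carrier T" "\<pi> t \<in> \<mm>" for t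
  proof -
    obtain u where u: "u \<in> \<nn>" "\<pi> t = \<pi> u" using t(2) mm by auto
    then have "t \<ominus>\<^bsub>T\<^esub> u \<in> \<aa>" using \<pi>_eq[OF t(1) n'(3)[OF u(1)]] by simp
    then have "u \<oplus>\<^bsub>T\<^esub> (t \<ominus>\<^bsub>T\<^esub> u) \<in> \<nn>" using an by (intro n'(4)[OF u(1)]) auto
    moreover have "u \<oplus>\<^bsub>T\<^esub> (t \<ominus>\<^bsub>T\<^esub> u) = t" using t(1) n'(3)[OF u(1)] by algebra
    ultimately show ?thesis by simp
  qed
  have maxR: "max_ideal R = \<mm>"
  proof (rule R.max_ideal_eqI[OF locR])
    show "ideal \<mm> R"
      using T.ring_ideal_imp_quot_ideal[OF \<aa>(1) idn] by (simp add: mm R_def \<pi>_def[abs_def])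
    show "\<mm> \<noteq> carrier R" using \<pi>n[of "\<one>\<^bsub>T\<^esub>"] one_n by (metis R.one_closed T.one_closed \<pi>.hom_one)
    show "carrier R - \<mm> \<subseteq> Units R"
    proof
      fix r assume r: "r \<in> carrier R - \<mm>"
      then obtain t where t: "t \<in> carrier T" "r = \<pi> t" using carR by auto
      then have "t \<in> Units T" using r units mm by auto
      then have "\<pi> t \<otimes>\<^bsub>R\<^esub> \<pi> (inv\<^bsub>T\<^esub> t) = \<one>\<^bsub>R\<^esub>" "\<pi> (inv\<^bsub>T\<^esub> t) \<otimes>\<^bsub>R\<^esub> \<pi> t = \<one>\<^bsub>R\<^esub>"
        using t(1) by (simp_all flip: \<pi>.hom_mult)
      then show "r \<in> Units R" using t \<open>t \<in> Units T\<close>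
        unfolding Units_def[of R] by (intro CollectI conjI bexI[of _ "\<pi> (inv\<^bsub>T\<^esub> t)"]) auto
    qed
  qed
  have pm: "primeideal \<mm> R" using R.max_ideal_primeideal[OF locR] maxR by simp
  have l1: "1 \<le> l" using T(3) by simp
  have Xn: "X j \<in> \<nn>" and \<pi>X: "\<pi> (X j) = x j" if "j \<in> {1..l}" for j using X that by (auto simp: \<pi>_def)
  have Xc: "X ` {1..l} \<subseteq> carrier T" using Xn n'(1) by blast
  have Xf: "X \<in> {1..l} \<rightarrow> carrier T" using Xc by blast
  have x': "x ` {1..l} \<subseteq> carrier R" "genideal R (x ` {1..l}) = \<mm>"
    using x(1) by (auto simp: minimal_generators_def)
  have xX: "x ` {1..l} = (\<lambda>t. \<aa> +>\<^bsub>T\<^esub> t) ` (X ` {1..l})" using \<pi>X by (force simp: \<pi>_def)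
  \<comment> \<open>The \<open>X j\<close> generate \<open>\<nn>\<close> up to \<open>\<aa>\<close>,
    and \<open>\<aa>\<close> lies in the square of \<open>\<nn>\<close>, so Nakayama's lemma removes
    the error.\<close>
  have XM: "genideal T (X ` {1..l}) = \<nn>"
  proof
    show "genideal T (X ` {1..l}) \<subseteq> \<nn>" using Xn by (intro T.genideal_minimal[OF idn]) auto
    note iX = T.genideal_ideal[OF Xc]
    show "\<nn> \<subseteq> genideal T (X ` {1..l})"
    proof (rule T.local_nakayama[OF pn T.sat_ideal_local[OF units iX] idn])
      fix D a assume D: "T.sat_ideal \<nn> D" "genideal T (X ` {1..l}) \<subseteq> D"
        and nn: "\<And>p b. p \<in> \<nn> \<Longrightarrow> b \<in> \<nn> \<Longrightarrow> p \<otimes>\<^bsub>T\<^esub> b \<in> D" and a: "a \<in> \<nn>"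
      have Di: "ideal D T" using D(1) by (simp add: T.sat_ideal_def)
      have "ideal_prod T \<nn> \<nn> \<subseteq> D"
      proof
        fix t assume "t \<in> ideal_prod T \<nn> \<nn>"
        then show "t \<in> D" by (induction rule: ideal_prod.induct) (auto intro: nn T.ideal_rules(4)[OF Di])
      qed
      then have aD: "\<aa> \<subseteq> D" using \<aa>(3) by blast
      have "\<aa> +>\<^bsub>T\<^esub> a \<in> genideal (T Quot \<aa>) ((\<lambda>t. \<aa> +>\<^bsub>T\<^esub> t) ` (X ` {1..l}))"
        using a x'(2) mm unfolding xX by (auto simp: R_def \<pi>_def)
      then obtain u \<alpha> where "u \<in> genideal T (X ` {1..l})" "\<alpha> \<in> \<aa>" "a = u \<oplus>\<^bsub>T\<^esub> \<alpha>"
        using T.coset_mem_Idl_iff[OF \<aa>(1) Xc n'(3)[OF a]] by blast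
      then have "\<one>\<^bsub>T\<^esub> \<otimes>\<^bsub>T\<^esub> a \<in> D" using D(2) aD T.ideal_rules(4)[OF Di] n'(3)[OF a] by auto
      then show "\<exists>s\<in>carrier T - \<nn>. s \<otimes>\<^bsub>T\<^esub> a \<in> D" using one_n by blast
    qed
  qed
  obtain P where P: "prime_chain T l P" "P l = \<nn>"
    using T.exists_prime_chain[OF loc T(2) l1] unfolding \<nn>_def by blast
  define Y where "Y k j = first_pow T X k j" for k j
  have Yfun: "first_pow T X k \<in> {1..l} \<rightarrow> carrier T" and Ji: "ideal (J k) T"
    and YJ: "j \<in> {1..l} \<Longrightarrow> Y k j \<in> J k" for k j
    unfolding J_def Y_def by (rule T.ideal_first_pow_ideal[OF Xf]; assumption?)+
  note J' = T.ideal_rules[OF Ji]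
  have Yc: "Y k j \<in> carrier T" if "j \<in> {1..l}" for k j using J'(3)[OF YJ[OF that]] .
  have JI: "J k \<subseteq> H" if "ideal H T" "\<And>j. j \<in> {1..l} \<Longrightarrow> Y k j \<in> H" for k H
    unfolding J_def first_pow_ideal_def using that(2) by (intro T.genideal_minimal[OF that(1)]) (auto simp: Y_def)
  have X1: "X 1 \<in> carrier T" using Pi_mem[OF Xf, of 1] l1 by simp
  have \<pi>Y: "\<pi> (Y k j) = first_pow R x k j" if "j \<in> {1..l}" for k j
  proof -
    have "\<pi> (X 1 [^]\<^bsub>T\<^esub> k) = \<pi> (X 1) [^]\<^bsub>R\<^esub> k" using X1 by (induction k) simp_all
    then show ?thesis using \<pi>X[OF that] \<pi>X[of 1] l1 by (simp add: Y_def first_pow_def)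
  qed
  have I_iff: "\<pi> t \<in> I k \<longleftrightarrow> (\<exists>u\<in>J k. \<exists>\<alpha>\<in>\<aa>. t = u \<oplus>\<^bsub>T\<^esub> \<alpha>)" if t: "t \<in> carrier T" for t k
  proof -
    have "first_pow R x k ` {1..l} = (\<lambda>t. \<aa> +>\<^bsub>T\<^esub> t) ` (first_pow T X k ` {1..l})"
      using \<pi>Y[of _ k] by (force simp: \<pi>_def Y_def)
    then show ?thesis using T.coset_mem_Idl_iff[OF \<aa>(1) funcset_image[OF Yfun[of k]] t]
      by (simp add: I_def J_def first_pow_ideal_def \<pi>_def R_def)
  qed
  have YI: "first_pow R x k j \<in> I k" if j: "j \<in> {1..l}" for k j
  proof -
    have "Y k j = Y k j \<oplus>\<^bsub>T\<^esub> \<zero>\<^bsub>T\<^esub>" using Yc[OF j] by simp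
    then have "\<pi> (Y k j) \<in> I k" unfolding I_iff[OF Yc[OF j]] using YJ[OF j] a'(2) by blast
    then show ?thesis using \<pi>Y[OF j] by simp
  qed
  have cI: "goto_conductor R Q \<phi> K = I n" using x(2) by (simp add: \<cc>_def R_def)
  \<comment> \<open>Otherwise all generators except \<open>x 1\<close> lie in the conductor
    \<open>I n\<close>, and so does the power of \<open>x 1\<close> with exponent
    \<open>n - 1\<close>; \<open>conductor_exponent_ge\<close> would give
    \<open>n \<le> n - 1\<close>.\<close>
  have xp: "x 1 [^]\<^bsub>R\<^esub> (n - 1) \<notin> I n"
  proof
    assume *: "x 1 [^]\<^bsub>R\<^esub> (n - 1) \<in> I n"
    have xj: "x j \<in> I n" if "j \<in> {2..l}" for j using YI[of j n] that by (simp add: first_pow_def)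
    have "n \<le> n - 1"
    proof (rule R.conductor_exponent_ge[OF R(1,2) Q K Goto x'(1) _ l1])
      show "genideal R (x ` {1..l}) = max_ideal R" using x'(2) maxR by simp
    qed (unfold cI, use xj * in auto)
    then show False using n by simp
  qed
  have aJ: "\<aa> \<subseteq> J n"
  proof
    fix t assume t: "t \<in> \<aa>"
    let ?p = "genideal T (X ` {1<..l})"
    have tail: "first_pow T X k ` {1<..l} = X ` {1<..l}" for k by (intro image_cong) (auto simp: first_pow_def)
    have ip: "ideal ?p T" by (rule T.ideal_Idl_tail[OF Xc])
    have l1': "{1..l} = insert 1 {1<..l}" using l1 by auto
    have img: "first_pow T X k ` {1..l} = insert (X 1 [^]\<^bsub>T\<^esub> k) (X ` {1<..l})" for k
      unfolding l1' image_insert tail by (simp add: first_pow_def)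
    have "X ` {1<..l} \<subseteq> carrier T" using Xc unfolding l1' by blast
    then have Jp: "J k = ?p <+>\<^bsub>T\<^esub> PIdl\<^bsub>T\<^esub> (X 1 [^]\<^bsub>T\<^esub> k)" for k
      unfolding J_def first_pow_ideal_def img using X1 by (intro T.Idl_insert) auto
    \<comment> \<open>Write \<open>t = y + r X\<^sub>1\<^sup>k\<close> with \<open>y\<close>
      generated by the later parameters. If \<open>r\<close> were a unit,
      \<open>X\<^sub>1\<^sup>k\<close> would lie in \<open>J n + \<aa>\<close> for some
      \<open>k < n\<close>, and multiplying up to exponent \<open>n - 1\<close> would contradict
      \<open>xp\<close>. So \<open>r\<close> lies in \<open>\<nn> = J 1\<close>, and the exponent
      rises by one. The start is \<open>J 0\<close>, the whole ring.\<close>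
    have "t \<in> J k" if "k \<le> n" for k
      using that
    proof (induction k)
      case 0
      have "\<one>\<^bsub>T\<^esub> \<in> J 0" using YJ[of 1 0] l1 X1 by (simp add: Y_def first_pow_def)
      then show ?case using ideal.one_imp_carrier[OF Ji] a'(3)[OF t] by blast
    next
      case (Suc k)
      then obtain y r where yr: "y \<in> ?p" "r \<in> carrier T" "t = y \<oplus>\<^bsub>T\<^esub> r \<otimes>\<^bsub>T\<^esub> X 1 [^]\<^bsub>T\<^esub> k"
        unfolding Jp T.mem_add_cgenideal by auto
      have yc: "y \<in> carrier T" using T.ideal_rules(3)[OF ip yr(1)] .
      have X1k: "X 1 [^]\<^bsub>T\<^esub> k \<in> carrier T" using X1 by simp
      show ?case
      proof (cases "r \<in> \<nn>")
        case True
        have "first_pow T X 1 ` {1..l} = X ` {1..l}"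
          using X1 by (intro image_cong refl) (simp add: first_pow_def)
        then have "J 1 = \<nn>" using XM by (simp only: J_def first_pow_ideal_def)
        then have "r \<in> J 1" using True by simp
        then obtain y' r' where yr': "y' \<in> ?p" "r' \<in> carrier T" "r = y' \<oplus>\<^bsub>T\<^esub> r' \<otimes>\<^bsub>T\<^esub> X 1 [^]\<^bsub>T\<^esub> (1::nat)"
          unfolding Jp T.mem_add_cgenideal by blast
        have y'c: "y' \<in> carrier T" using T.ideal_rules(3)[OF ip yr'(1)] .
        have "y \<oplus>\<^bsub>T\<^esub> (y' \<oplus>\<^bsub>T\<^esub> r' \<otimes>\<^bsub>T\<^esub> v) \<otimes>\<^bsub>T\<^esub> u = (y \<oplus>\<^bsub>T\<^esub> u \<otimes>\<^bsub>T\<^esub> y') \<oplus>\<^bsub>T\<^esub> r' \<otimes>\<^bsub>T\<^esub> (u \<otimes>\<^bsub>T\<^esub> v)"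
          if "u \<in> carrier T" "v \<in> carrier T" for u v
          using that yc y'c yr'(2) by algebra
        moreover have "r = y' \<oplus>\<^bsub>T\<^esub> r' \<otimes>\<^bsub>T\<^esub> X 1" using yr'(3) X1 by simp
        ultimately have "t = (y \<oplus>\<^bsub>T\<^esub> X 1 [^]\<^bsub>T\<^esub> k \<otimes>\<^bsub>T\<^esub> y') \<oplus>\<^bsub>T\<^esub> r' \<otimes>\<^bsub>T\<^esub> X 1 [^]\<^bsub>T\<^esub> Suc k"
          using yr(3) X1 X1k by simp
        moreover have "y \<oplus>\<^bsub>T\<^esub> X 1 [^]\<^bsub>T\<^esub> k \<otimes>\<^bsub>T\<^esub> y' \<in> ?p"
          using T.ideal_rules(4)[OF ip yr(1) T.ideal_rules(7)[OF ip yr'(1) X1k]] .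
        ultimately show ?thesis unfolding Jp T.mem_add_cgenideal using yr'(2) by blast
      next
        case False
        then have ru: "r \<in> Units T" using yr(2) units by blast
        define v where "v = inv\<^bsub>T\<^esub> r"
        have ir: "v \<in> carrier T" and vr: "v \<otimes>\<^bsub>T\<^esub> r = \<one>\<^bsub>T\<^esub>" using ru by (simp_all add: v_def)
        have "t \<ominus>\<^bsub>T\<^esub> y = r \<otimes>\<^bsub>T\<^esub> X 1 [^]\<^bsub>T\<^esub> k" unfolding yr(3) using yc yr(2) X1k by algebra
        then have "v \<otimes>\<^bsub>T\<^esub> (t \<ominus>\<^bsub>T\<^esub> y) = X 1 [^]\<^bsub>T\<^esub> k"
          using ir vr yr(2) X1k by (simp add: T.m_assoc[symmetric])
        then have eq: "X 1 [^]\<^bsub>T\<^esub> k = (\<ominus>\<^bsub>T\<^esub> v) \<otimes>\<^bsub>T\<^esub> y \<oplus>\<^bsub>T\<^esub> v \<otimes>\<^bsub>T\<^esub> t"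
          using ir yc a'(3)[OF t] by (simp add: T.minus_eq T.r_distr T.l_minus T.r_minus T.a_comm)
        define e where "e = X 1 [^]\<^bsub>T\<^esub> (n - 1 - k)"
        have ec: "e \<in> carrier T" using X1 by (simp add: e_def)
        have "X 1 [^]\<^bsub>T\<^esub> (n - 1) = e \<otimes>\<^bsub>T\<^esub> X 1 [^]\<^bsub>T\<^esub> k"
          unfolding e_def using X1 Suc.prems by (simp add: T.nat_pow_mult)
        also have "\<dots> = e \<otimes>\<^bsub>T\<^esub> ((\<ominus>\<^bsub>T\<^esub> v) \<otimes>\<^bsub>T\<^esub> y) \<oplus>\<^bsub>T\<^esub> e \<otimes>\<^bsub>T\<^esub> (v \<otimes>\<^bsub>T\<^esub> t)"
          unfolding eq using ec ir yc a'(3)[OF t] by (simp add: T.r_distr)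
        finally have split: "X 1 [^]\<^bsub>T\<^esub> (n - 1) =
            e \<otimes>\<^bsub>T\<^esub> ((\<ominus>\<^bsub>T\<^esub> v) \<otimes>\<^bsub>T\<^esub> y) \<oplus>\<^bsub>T\<^esub> e \<otimes>\<^bsub>T\<^esub> (v \<otimes>\<^bsub>T\<^esub> t)" .
        have "y \<in> J n" using yr(1) T.add_cgenideal(2)[OF ip, of "X 1 [^]\<^bsub>T\<^esub> n"] X1 unfolding Jp by auto
        then have "e \<otimes>\<^bsub>T\<^esub> ((\<ominus>\<^bsub>T\<^esub> v) \<otimes>\<^bsub>T\<^esub> y) \<in> J n" using ec ir by (intro J'(7)) auto
        moreover have "e \<otimes>\<^bsub>T\<^esub> (v \<otimes>\<^bsub>T\<^esub> t) \<in> \<aa>" using ec ir t by (intro a'(7)) auto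
        ultimately have "\<pi> (X 1 [^]\<^bsub>T\<^esub> (n - 1)) \<in> I n" 
          using I_iff[OF T.nat_pow_closed[OF X1]] split by blast
        moreover have "\<pi> (X 1 [^]\<^bsub>T\<^esub> (n - 1)) = x 1 [^]\<^bsub>R\<^esub> (n - 1)"
          using \<pi>Y[of 1 "n - 1"] l1 by (simp add: Y_def first_pow_def)
        ultimately show ?thesis using xp by simp
      qed
    qed
    then show "t \<in> J n" by simp
  qed
  have Jle: "J n \<subseteq> J k" if k: "k \<in> {1..n}" for k
  proof (rule JI[OF Ji])
    fix j assume j: "j \<in> {1..l}"
    show "Y n j \<in> J k"
    proof (cases "j = 1")
      case True
      have "Y n 1 = X 1 [^]\<^bsub>T\<^esub> (n - k) \<otimes>\<^bsub>T\<^esub> Y k 1" using k X1 by (simp add: Y_def first_pow_def T.nat_pow_mult)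
      then show ?thesis using J'(7)[OF YJ[OF j], of "X 1 [^]\<^bsub>T\<^esub> (n - k)" k] X1 True by simp
    next
      case False
      then show ?thesis using YJ[OF j, of k] by (simp add: Y_def first_pow_def)
    qed
  qed
  have Jn: "J k \<subseteq> \<nn>" if k: "k \<in> {1..n}" for k
  proof (rule JI[OF idn])
    fix j assume j: "j \<in> {1..l}"
    obtain k' where k': "k = Suc k'" using k by (cases k) auto
    show "Y k j \<in> \<nn>"
      using Xn[OF j] Xn[of 1] l1 X1 n'(7)[of "X 1" "X 1 [^]\<^bsub>T\<^esub> k'"] by (auto simp: Y_def first_pow_def k')
  qed
  \<comment> \<open>From here on \<open>\<aa>\<close> is absorbed by every \<open>J k\<close> in
    question, and \<open>I k\<close> can be tested on any lift.\<close>
  have I_mem: "\<pi> t \<in> I k \<longleftrightarrow> t \<in> J k" if t: "t \<in> carrier T" and k: "k \<in> {1..n}" for t k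
  proof
    assume "\<pi> t \<in> I k"
    then obtain u \<alpha> where "u \<in> J k" "\<alpha> \<in> \<aa>" "t = u \<oplus>\<^bsub>T\<^esub> \<alpha>" using I_iff[OF t] by blast
    moreover from this have "\<alpha> \<in> J k" using aJ Jle[OF k] by blast
    ultimately show "t \<in> J k" using J'(4)[of u k \<alpha>] by simp
  next
    assume "t \<in> J k"
    moreover have "t = t \<oplus>\<^bsub>T\<^esub> \<zero>\<^bsub>T\<^esub>" using t by simp
    ultimately show "\<pi> t \<in> I k" using I_iff[OF t] a'(2) by blast
  qed
  define \<psi> where "\<psi> t = \<phi> (\<pi> t)" for t
  have \<psi>: "\<psi> \<in> ring_hom T Q"
    using ring_hom_trans[of \<pi> T R \<phi> Q] \<pi>.homh Q'(2) by (simp add: \<psi>_def[abs_def] comp_def)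
  have \<psi>c: "\<psi> t \<in> carrier Q" if "t \<in> carrier T" for t using ring_hom_closed[OF \<psi> that] .
  have \<psi>R: "\<phi> ` carrier R = \<psi> ` carrier T" by (auto simp: carR \<psi>_def)
  have \<psi>1: "\<psi> \<one>\<^bsub>T\<^esub> = \<one>\<^bsub>Q\<^esub>" using ring_hom_one[OF \<psi>] .
  have \<psi>0: "\<psi> t = \<zero>\<^bsub>Q\<^esub> \<longleftrightarrow> t \<in> \<aa>" if t: "t \<in> carrier T" for t
  proof -
    have "\<phi> \<zero>\<^bsub>R\<^esub> = \<zero>\<^bsub>Q\<^esub>" using ring_hom_zero[OF Q'(2) R.ring_axioms Q.ring_axioms] .
    then have "\<psi> t = \<zero>\<^bsub>Q\<^esub> \<longleftrightarrow> \<pi> t = \<pi> \<zero>\<^bsub>T\<^esub>"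
      using inj_onD[OF Q'(3), of "\<pi> t" "\<pi> \<zero>\<^bsub>T\<^esub>"] t by (auto simp: \<psi>_def)
    also have "\<dots> \<longleftrightarrow> t \<in> \<aa>" using \<pi>_eq[OF t T.zero_closed] t by (simp add: T.minus_eq)
    finally show ?thesis .
  qed
  let ?W = "frac_module Q \<phi> (carrier Q)" and ?KK = "frac_module Q \<phi> K" and ?N = "\<phi> ` carrier R"
  have W: "module R ?W" by (rule module_frac_module[OF R.is_cring Q'(1,2)])
  interpret W: module R ?W by (rule W)
  have KW: "submodule K R ?W" and NK: "?N \<subseteq> K" and Kint: "K \<subseteq> integral_closure R Q \<phi>"
    using K by (auto simp: fractional_canonical_ideal_def)
  note K' = W.submodule_rules[OF KW, simplified]
  note cf = R.conductor_facts[OF Q KW NK]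
  have KK: "module R ?KK" using module_restrict_mod[OF W KW] by (simp add: restrict_frac_module)
  interpret KK: plain_module R ?KK unfolding plain_module_def by (rule KK)
  have NKK: "submodule ?N R ?KK"
  proof (rule KK.submoduleI')
    have "\<zero>\<^bsub>Q\<^esub> = \<psi> \<zero>\<^bsub>T\<^esub>" using \<psi>0[OF T.zero_closed] a'(2) by simp
    then show "\<zero>\<^bsub>?KK\<^esub> \<in> ?N" unfolding \<psi>R by simp
  qed (use NK in \<open>auto simp: ring_hom_add[OF Q'(2), symmetric] ring_hom_mult[OF Q'(2), symmetric]\<close>)
  have KRd: "KR = mod_quot ?KK ?N" by (simp add: KR_def R_def)
  have KR: "module R KR" unfolding KRd by (rule KK.module_mod_quot[OF NKK])
  interpret KR: module R KR by (rule KR)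
  define cl where "cl z = ?N +>\<^bsub>?KK\<^esub> z" for z
  have cl0: "cl z = \<zero>\<^bsub>KR\<^esub> \<longleftrightarrow> z \<in> ?N" if "z \<in> K" for z
    using KK.mod_coset_eq_zero_iff[OF NKK, of z] KK.mod_quot_simps(2)[OF NKK] that by (simp add: cl_def KRd)
  have clc: "cl z \<in> carrier KR" if "z \<in> K" for z
    using KK.mod_quot_simps(1)[OF NKK] that by (simp add: cl_def KRd)
  have cla: "cl (y \<oplus>\<^bsub>Q\<^esub> z) = cl y \<oplus>\<^bsub>KR\<^esub> cl z" if "y \<in> K" "z \<in> K" for y z
    using KK.mod_quot_simps(3)[OF NKK, of y z] that by (simp add: cl_def KRd)
  have cls: "cl (\<phi> r \<otimes>\<^bsub>Q\<^esub> z) = r \<odot>\<^bsub>KR\<^esub> cl z" if "r \<in> carrier R" "z \<in> K" for r z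
    using KK.mod_quot_simps(4)[OF NKK, of r z] that by (simp add: cl_def KRd)
  define F where "F p = f (fst p) (snd p)" for p
  have FK: "F p \<in> K" if "p \<in> blocks n L" for p using f(1) that by (auto simp: F_def)
  have kn: "fst p \<in> {1..n}" if "p \<in> blocks n L" for p using that by (auto simp: blocks_def)
  \<comment> \<open>The class of \<open>F p\<close> generates a copy of \<open>R / I k\<close>, so
    its annihilator is \<open>I k\<close>, and by \<open>I_mem\<close> the preimage in
    \<open>T\<close> is exactly \<open>J k\<close>.\<close>
  have annF: "\<psi> t \<otimes>\<^bsub>Q\<^esub> F p \<in> ?N \<longleftrightarrow> t \<in> J (fst p)" if p: "p \<in> blocks n L" and t: "t \<in> carrier T" for p t
  proof -
    have "mod_iso R (restrict_mod KR (mod_span R KR {cl (F p)})) (mod_quot (reg_module R) (I (fst p)))"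
      using f(4) p by (auto simp: F_def cl_def R_def)
    moreover have "ideal (I (fst p)) R"
    proof -
      have "x \<in> {1..l} \<rightarrow> carrier R" using x'(1) by blast
      then show ?thesis using R.ideal_first_pow_ideal(2) by (simp add: I_def R_def)
    qed
    ultimately have "\<pi> t \<odot>\<^bsub>KR\<^esub> cl (F p) = \<zero>\<^bsub>KR\<^esub> \<longleftrightarrow> \<pi> t \<in> I (fst p)"
      using t clc[OF FK[OF p]] by (intro R.cyclic_mod_iso_annihilator[OF KR]) auto
    moreover have "\<phi> (\<pi> t) \<otimes>\<^bsub>Q\<^esub> F p \<in> K" using K'(7)[OF FK[OF p], of "\<pi> t"] t by simp
    note cl0[OF this]
    moreover have "cl (\<phi> (\<pi> t) \<otimes>\<^bsub>Q\<^esub> F p) = \<pi> t \<odot>\<^bsub>KR\<^esub> cl (F p)" using cls[of "\<pi> t" "F p"] FK[OF p] t by simp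
    ultimately show ?thesis using I_mem[OF t kn[OF p]] unfolding \<psi>_def by metis
  qed
  let ?K = "frac_module Q \<psi> K" and ?V = "frac_module Q \<psi> (carrier Q)"
  have V: "module T ?V" by (rule module_frac_module[OF T.is_cring Q'(1) \<psi>])
  interpret V: module T ?V by (rule V)
  have KV: "submodule K T ?V"
    using K'(1,2,4) K'(7)[of _ "\<pi> _"] by (intro V.submoduleI') (auto simp: \<psi>_def)
  have KT: "module T ?K" using module_restrict_mod[OF V KV] by (simp add: restrict_frac_module)
  interpret KT: module T ?K by (rule KT)
  have oneK: "\<one>\<^bsub>Q\<^esub> \<in> K" using \<psi>1 NK T.one_closed unfolding \<psi>R by (metis imageI subsetD)
  \<comment> \<open>The negative in a module record is sought in the carrier of that record, here
    \<open>K\<close> instead of \<open>carrier Q\<close>. The entry \<open>-1\<close> of the row is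
    formed in \<open>Q\<close> and must be recognised in the module.\<close>
  have neg: "\<ominus>\<^bsub>Q\<^esub> \<one>\<^bsub>Q\<^esub> = \<ominus>\<^bsub>?K\<^esub> \<one>\<^bsub>Q\<^esub>"
  proof (rule Q.minus_equality)
    show "\<ominus>\<^bsub>?K\<^esub> \<one>\<^bsub>Q\<^esub> \<oplus>\<^bsub>Q\<^esub> \<one>\<^bsub>Q\<^esub> = \<zero>\<^bsub>Q\<^esub>" using KT.M.l_neg[of "\<one>\<^bsub>Q\<^esub>"] oneK by simp
    show "\<ominus>\<^bsub>?K\<^esub> \<one>\<^bsub>Q\<^esub> \<in> carrier Q" using KT.M.a_inv_closed[of "\<one>\<^bsub>Q\<^esub>"] oneK K'(3) by simp
  qed simp
  have ND: "pres_N Q f None = \<ominus>\<^bsub>?K\<^esub> \<one>\<^bsub>Q\<^esub>" "\<And>p. pres_N Q f (Some p) = f (fst p) (snd p)"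
    using neg by auto
  have gen: "mod_span T ?K (pres_N Q f ` pres_rows n L) = carrier ?K"
  proof
    let ?G = "pres_N Q f ` pres_rows n L"
    have Gs: "?G \<subseteq> carrier ?K"
      using KT.M.a_inv_closed[of "\<one>\<^bsub>Q\<^esub>"] oneK FK by (auto simp: pres_rows_def ND(1) F_def simp del: pres_N.simps(1))
    note sp = mod_span_submodule[OF KT Gs]
    note sp' = KT.submodule_rules[OF sp(1), simplified]
    show "mod_span T ?K ?G \<subseteq> carrier ?K" using sp'(1) by simp
    have "pres_N Q f None \<in> mod_span T ?K ?G" using sp(2) by (auto simp: pres_rows_def simp del: pres_N.simps)
    then have one: "\<one>\<^bsub>Q\<^esub> \<in> mod_span T ?K ?G"
      using sp'(5)[of "\<ominus>\<^bsub>?K\<^esub> \<one>\<^bsub>Q\<^esub>"] KT.M.minus_minus[of "\<one>\<^bsub>Q\<^esub>"] oneK unfolding ND(1) by simp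
    \<comment> \<open>\<open>T\<close> acts through its surjection onto \<open>R\<close>, so a
      submodule over \<open>T\<close> is one over \<open>R\<close>, and the given generators of
      \<open>K\<close> over \<open>R\<close> generate it over \<open>T\<close>.\<close>
    have "submodule (mod_span T ?K ?G) R ?W"
    proof (rule W.submoduleI')
      fix a r assume a: "a \<in> mod_span T ?K ?G" "r \<in> carrier R"
      then obtain t where "t \<in> carrier T" "r = \<pi> t" using carR by auto
      then show "r \<odot>\<^bsub>?W\<^esub> a \<in> mod_span T ?K ?G" using sp'(7)[OF a(1), of t] by (simp add: \<psi>_def)
    qed (use sp' K'(1) in auto)
    moreover have "\<phi> ` carrier R \<union> (\<lambda>(i, j). f i j) ` blocks n L \<subseteq> mod_span T ?K ?G"
    proof -
      have "\<psi> t \<in> mod_span T ?K ?G" if "t \<in> carrier T" for t using sp'(7)[OF one that] \<psi>c[OF that] by simp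
      moreover have "f i j \<in> mod_span T ?K ?G" if "(i, j) \<in> blocks n L" for i j
        using sp(2) that by (force simp: pres_rows_def)
      ultimately show ?thesis unfolding \<psi>R by auto
    qed
    ultimately have "K \<subseteq> mod_span T ?K ?G"
      unfolding f(2)[unfolded frac_span_def, folded R_def] by (intro mod_span_least) auto
    then show "carrier ?K \<subseteq> mod_span T ?K ?G" by simp
  qed
  have ann1: "t \<odot>\<^bsub>?K\<^esub> \<one>\<^bsub>Q\<^esub> = \<zero>\<^bsub>?K\<^esub> \<longleftrightarrow> t \<in> \<aa>" if "t \<in> carrier T" for t
    using \<psi>0[OF that] \<psi>c[OF that] by simp
  \<comment> \<open>Modulo \<open>R\<close> the equation becomes a vanishing sum in the direct
    decomposition of \<open>K / R\<close>, so every term vanishes there, and \<open>annF\<close>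
    identifies the coefficients.\<close>
  have indep: "\<forall>p\<in>blocks n L. t p \<in> J (fst p)"
    if t: "t \<in> blocks n L \<rightarrow> carrier T" "t0 \<in> carrier T"
    and eq: "(\<Oplus>\<^bsub>?K\<^esub>p\<in>blocks n L. t p \<odot>\<^bsub>?K\<^esub> f (fst p) (snd p)) = t0 \<odot>\<^bsub>?K\<^esub> \<one>\<^bsub>Q\<^esub>" for t t0
  proof
    fix p assume p: "p \<in> blocks n L"
    let ?u = "\<lambda>p. \<psi> (t p) \<otimes>\<^bsub>Q\<^esub> F p"
    have tc: "t p \<in> carrier T" if "p \<in> blocks n L" for p using t(1) that by auto
    have uK: "?u p \<in> K" if "p \<in> blocks n L" for p
      using K'(7)[OF FK[OF that], of "\<pi> (t p)"] tc[OF that] by (simp add: \<psi>_def)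
    have "cl (\<Oplus>\<^bsub>?K\<^esub>p\<in>blocks n L. ?u p) = (\<Oplus>\<^bsub>KR\<^esub>p\<in>blocks n L. cl (?u p))"
      using uK clc cla by (intro finsum_hom KT.abelian_group_axioms KR.abelian_group_axioms) auto
    moreover have "cl (\<Oplus>\<^bsub>?K\<^esub>p\<in>blocks n L. ?u p) = \<zero>\<^bsub>KR\<^esub>"
    proof -
      have s: "(\<Oplus>\<^bsub>?K\<^esub>p\<in>blocks n L. ?u p) = \<psi> t0" using eq \<psi>c[OF t(2)] by (simp add: F_def)
      have "\<psi> t0 \<in> ?N" unfolding \<psi>R using t(2) by blast
      then show ?thesis unfolding s using cl0[of "\<psi> t0"] NK by blast
    qed
    moreover have "cl (?u p) \<in> (case p of (i, j) \<Rightarrow> mod_span R KR {?N +>\<^bsub>?KK\<^esub> f i j})" if p: "p \<in> blocks n L" for p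
    proof -
      have "{cl (F p)} \<subseteq> carrier KR" using clc[OF FK[OF p]] by simp
      note sp = mod_span_submodule[OF KR this]
      have "cl (?u p) = \<pi> (t p) \<odot>\<^bsub>KR\<^esub> cl (F p)" using cls[of "\<pi> (t p)" "F p"] tc[OF p] FK[OF p] by (simp add: \<psi>_def)
      also have "\<dots> \<in> mod_span R KR {cl (F p)}" using sp(2) tc[OF p] by (intro KR.submodule_rules(7)[OF sp(1)]) auto
      finally show ?thesis by (simp add: cl_def F_def case_prod_unfold)
    qed
    ultimately have "cl (?u p) = \<zero>\<^bsub>KR\<^esub>"
      using f(3) p by (intro internal_direct_sum_zero[OF KR, where u = "\<lambda>p. cl (?u p)" and S = "blocks n L"]) (auto simp: R_def)
    then have "?u p \<in> ?N" using cl0[OF uK[OF p]] by simp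
    then show "t p \<in> J (fst p)" using annF[OF p tc[OF p]] by simp
  qed
  have "\<exists>a. a \<in> \<nn> \<and> (k = n \<or> 2 \<le> j \<longrightarrow> a \<in> J n) \<and> \<psi> (Y k j) \<otimes>\<^bsub>Q\<^esub> f k i = \<psi> a"
    if p: "(k, i) \<in> blocks n L" and j: "j \<in> {1..l}" for k i j
  proof -
    note fK = FK[OF p, unfolded F_def, simplified]
    have k: "k \<in> {1..n}" using kn[OF p] by simp
    show ?thesis
    proof (cases "k = n \<or> 2 \<le> j")
      case True
      \<comment> \<open>The generators of \<open>J k\<close> and \<open>J n\<close> differ only in
        the first one. So this generator maps into the conductor \<open>I n\<close> even if
        \<open>k < n\<close>, and the product with \<open>f k i\<close> stays in
        \<open>I n\<close>.\<close>
      have "Y k j = Y n j" using True by (auto simp: Y_def first_pow_def)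
      then have "\<pi> (Y k j) \<in> goto_conductor R Q \<phi> K" unfolding cI using YI[OF j, of n] \<pi>Y[OF j] by simp
      then obtain r where r: "r \<in> I n" "\<psi> (Y k j) \<otimes>\<^bsub>Q\<^esub> f k i = \<phi> r"
        using cf(4)[OF _ fK] unfolding cI \<psi>_def by blast
      have "r \<in> carrier R" using r(1) cI by (auto simp: goto_conductor_def)
      then obtain a where a: "a \<in> carrier T" "r = \<pi> a" using carR by auto
      then have "a \<in> J n" using r(1) I_mem[of a n] n by simp
      then show ?thesis using r(2) a Jn[of n] n by (auto simp: \<psi>_def)
    next
      case False
      have "\<psi> (Y k j) \<otimes>\<^bsub>Q\<^esub> f k i \<in> ?N" using annF[OF p Yc[OF j]] YJ[OF j] by (simp add: F_def)
      then obtain a where a: "a \<in> carrier T" "\<psi> (Y k j) \<otimes>\<^bsub>Q\<^esub> f k i = \<psi> a" unfolding \<psi>R by blast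
      \<comment> \<open>The remaining case is \<open>j = 1\<close> and \<open>k < n\<close>. The
        conductor gives nothing for this power of \<open>X 1\<close>; that the product lies in
        \<open>R\<close> comes from \<open>annF\<close>, and integrality of \<open>f k i\<close>
        keeps it in \<open>\<mm>\<close>.\<close>
      have "\<pi> a \<in> \<mm>"
      proof (rule integral_multiple_in_prime[OF R.is_cring Q'(1-3) pm])
        show "f k i \<in> integral_closure R Q \<phi>" using fK Kint by blast
        show "\<pi> (Y k j) \<in> \<mm>" using YJ[OF j, of k] Jn[OF k] mm by blast
        show "\<phi> (\<pi> (Y k j)) \<otimes>\<^bsub>Q\<^esub> f k i = \<phi> (\<pi> a)" using a(2) by (simp add: \<psi>_def)
      qed (use a in auto)
      then show ?thesis using \<pi>n[OF a(1)] a(2) False by blast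
    qed
  qed
  then obtain A where A: "\<And>k i j. (k, i) \<in> blocks n L \<Longrightarrow> j \<in> {1..l} \<Longrightarrow> A k i j \<in> \<nn>"
    "\<And>k i j. (k, i) \<in> blocks n L \<Longrightarrow> j \<in> {1..l} \<Longrightarrow> k = n \<or> 2 \<le> j \<Longrightarrow> A k i j \<in> J n"
    "\<And>k i j. (k, i) \<in> blocks n L \<Longrightarrow> j \<in> {1..l} \<Longrightarrow> \<psi> (Y k j) \<otimes>\<^bsub>Q\<^esub> f k i = \<psi> (A k i j)" by metis
  have "\<exists>q c. minimal_free_presentation T ?K (pres_rows n L) (pres_cols n L l q) (pres_M T X A c) (pres_N Q f) \<and>
    (\<forall>s\<in>{1..q}. c s \<in> \<nn>) \<and>
    \<aa> = ideal_sum T (blocks n L) (\<lambda>(i, j). I2 T l (A i j) (first_pow T X i)) <+>\<^bsub>T\<^esub> genideal T (c ` {1..q})"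
  proof (rule T.minimal_presentation[OF KT _ _ ND gen \<aa>(1) an ann1 idn _ units Xf])
    show "\<one>\<^bsub>Q\<^esub> \<in> carrier ?K" using oneK by simp
    show "f (fst p) (snd p) \<in> carrier ?K" if "p \<in> blocks n L" for p using FK[OF that] by (simp add: F_def)
    show "max_ideal T = \<nn>" by (simp add: \<nn>_def)
    show "first_pow_ideal T l X k \<subseteq> \<nn>" if "k \<in> {1..n}" for k using Jn[OF that] by (simp add: J_def)
    show "A (fst p) (snd p) j \<in> \<nn>" if "p \<in> blocks n L" "j \<in> {1..l}" for p j
      using A(1)[of "fst p" "snd p" j] that by simp
    show "first_pow T X (fst p) j \<odot>\<^bsub>?K\<^esub> f (fst p) (snd p) = A (fst p) (snd p) j \<odot>\<^bsub>?K\<^esub> \<one>\<^bsub>Q\<^esub>"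
      if "p \<in> blocks n L" "j \<in> {1..l}" for p j
      using A(1,3)[of "fst p" "snd p" j] that \<psi>c[OF n'(3)] by (simp add: Y_def)
    show "\<forall>p\<in>blocks n L. t p \<in> first_pow_ideal T l X (fst p)"
      if "t \<in> blocks n L \<rightarrow> carrier T" "t0 \<in> carrier T"
        "(\<Oplus>\<^bsub>?K\<^esub>p\<in>blocks n L. t p \<odot>\<^bsub>?K\<^esub> f (fst p) (snd p)) = t0 \<odot>\<^bsub>?K\<^esub> \<one>\<^bsub>Q\<^esub>" for t t0
      using indep[OF that] by (simp add: J_def)
    show "(\<forall>j\<in>{1..l}. w j \<in> \<nn>) \<and> (\<Oplus>\<^bsub>T\<^esub>j\<in>{1..l}. w j \<otimes>\<^bsub>T\<^esub> a j) \<in> I2 T l a (first_pow T X k)"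
      if "k \<in> {1..n}" "w \<in> {1..l} \<rightarrow> carrier T" "a \<in> {1..l} \<rightarrow> carrier T"
        "(\<Oplus>\<^bsub>T\<^esub>j\<in>{1..l}. w j \<otimes>\<^bsub>T\<^esub> first_pow T X k j) = \<zero>\<^bsub>T\<^esub>" for k w a
      using that(1) by (intro T.regular_parameters_first_pow_relation[OF Xc XM P units _ that(2-4)]) simp
  qed
  then obtain q c where qc:
    "minimal_free_presentation T ?K (pres_rows n L) (pres_cols n L l q) (pres_M T X A c) (pres_N Q f)"
    "\<forall>s\<in>{1..q}. c s \<in> \<nn>"
    "\<aa> = ideal_sum T (blocks n L) (\<lambda>(i, j). I2 T l (A i j) (first_pow T X i)) <+>\<^bsub>T\<^esub> genideal T (c ` {1..q})"
    by blast
  have blk: "(k, i) \<in> blocks n L" if "k \<in> {1..n}" "i \<in> {1..L k}" for k i using that by (simp add: blocks_def)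
  show ?thesis
  proof (intro exI conjI ballI)
    show "minimal_free_presentation T (frac_module Q (\<lambda>t. \<phi> (\<aa> +>\<^bsub>T\<^esub> t)) K)
      (pres_rows n L) (pres_cols n L l q) (pres_M T X A c) (pres_N Q f)"
      using qc(1) by (simp add: \<psi>_def[abs_def] \<pi>_def)
    show "A n i j \<in> J n" if "i \<in> {1..L n}" "j \<in> {1..l}" for i j
      using A(2)[OF blk[of n i] that(2)] that n by simp
    show "A k i 1 \<in> \<nn>" if "k \<in> {1..<n}" "i \<in> {1..L k}" for k i
      using A(1)[OF blk[of k i], of 1] that l1 by simp
    show "A k i j \<in> J n" if "k \<in> {1..<n}" "i \<in> {1..L k}" "j \<in> {2..l}" for k i j
      using A(2)[OF blk[of k i], of j] that by simp
    show "c s \<in> \<nn>" if "s \<in> {1..q}" for s using qc(2) that by blast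
    show "\<aa> = ideal_sum T (blocks n L) (\<lambda>(i, j). I2 T l (A i j) (first_pow T X i)) <+>\<^bsub>T\<^esub> genideal T (c ` {1..q})"
      by (rule qc(3))
  qed
qed

end
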